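(* Let $e\in\mathfrak g_{\bar0}$ be a regular nilpotent element in the Lie superalgebra $\mathfrak g=\mathfrak{osp}(1|2n)$ over $\mathbb C$. Then the finite $W$-superalgebra $U(\mathfrak g,e)$ affords a two-dimensional representation.
   Context: Conventions. All vector spaces, algebras and modules (representations) are $\mathbb Z_2$-graded; $\dim V=\dim V_{\bar0}+\dim V_{\bar1}$. $\mathfrak{osp}(1|2n)$ has even part $\mathfrak{sp}(2n)$; "regular nilpotent" refers to $\mathfrak g_{\bar0}$. Finite $W$-superalgebra. Let $(\cdot,\cdot)$ be an even non-degenerate supersymmetric invariant bilinear form on $\mathfrak g$. Fix an $\mathfrak{sl}_2$-triple $(e,h,f)$ in $\mathfrak g_{\bar0}$, normalise the form by $(e,f)=1$, put $\chi=(e,\cdot)\in\mathfrak g^*$, $\mathfrak g(i)=\{x:[h,x]=ix\}$. On $\mathfrak g(-1)_{\bar0}$ (resp. $\mathfrak g(-1)_{\bar1}$) the form $\langle x,y\rangle=\chi([x,y])$ is symplectic (resp. symmetric) non-degenerate; choose bases $u_1,\dots,u_{2s}$ with $\langle u_i,u_j\rangle=i^*\delta_{i+j,2s+1}$ ($i^*=-1$ for $i\le s$, $i^*=1$ for $i>s$), and $v_1,\dots,v_r$ with $\langle v_i,v_j\rangle=\delta_{i+j,r+1}$. Let $\mathfrak m=\bigoplus_{i\le-2}\mathfrak g(i)\oplus\operatorname{span}\{u_{s+1},\dots,u_{2s}\}\oplus\operatorname{span}\{v_j:j>\frac{r+1}{2}\}$. $\chi$ restricts to a character of $\mathfrak m$;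 $Q_\chi=U(\mathfrak g)\otimes_{U(\mathfrak m)}\mathbb C_\chi$ and $U(\mathfrak g,e)=(\operatorname{End}_{\mathfrak g}Q_\chi)^{\mathrm{op}}$. *)

theory Defs
  imports
    "HOL-Analysis.Analysis"
    "HOL-Library.Poly_Mapping"
    "HOL-Library.Set_Algebras"
    "HOL-Library.FuncSet"
    "HOL-Library.Z2"
begin

text \<open>
  Parities are elements of the two-element field \<open>bit\<close> (\<open>0\<close> even, \<open>1\<close> odd), and \<open>ksign p q\<close>
  is the Koszul sign $(-1)^{pq}$. Everything is over the complex numbers.
\<close>

definition ksign :: "bit \<Rightarrow> bit \<Rightarrow> complex" where
  "ksign p q = (if p = 1 \<and> q = 1 then - 1 else 1)"


section \<open>Lie superalgebras and \<open>osp(1|2n)\<close>\<close>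

text \<open>
  The underlying space of a Lie superalgebra is the subspace \<open>lcarrier L\<close> of the ambient additive
  group; passing to a graded subspace \<open>M\<close> means shrinking the homogeneous parts.
\<close>

record 'a lie_superalgebra =
  lscale :: "complex \<Rightarrow> 'a \<Rightarrow> 'a"
  lpart :: "bit \<Rightarrow> 'a set"
  lbracket :: "'a \<Rightarrow> 'a \<Rightarrow> 'a"

definition lcarrier :: "'a::ab_group_add lie_superalgebra \<Rightarrow> 'a set" where
  "lcarrier L = lpart L 0 + lpart L 1"

definition lrestrict :: "'a lie_superalgebra \<Rightarrow> 'a set \<Rightarrow> 'a lie_superalgebra" where
  "lrestrict L M = L\<lparr>lpart := (\<lambda>p. lpart L p \<inter> M)\<rparr>"

text \<open>
  \<open>None\<close> indexes the even basis vector of $\mathbb C^{1|2n}$, where \<open>n = CARD('n)\<close>; the odd part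
  has the symplectic basis \<open>Some (Inl i)\<close>, \<open>Some (Inr i)\<close>.
\<close>

type_synonym 'n idx = "('n + 'n) option"
type_synonym 'n smat = "complex ^ 'n idx ^ 'n idx"

definition idx_parity :: "'n idx \<Rightarrow> bit" where
  "idx_parity i = (case i of None \<Rightarrow> 0 | Some _ \<Rightarrow> 1)"

definition vec_part :: "bit \<Rightarrow> (complex ^ ('n::finite) idx) set" where
  "vec_part p = {v. \<forall>i. v $ i \<noteq> 0 \<longrightarrow> idx_parity i = p}"

definition mat_scale :: "complex \<Rightarrow> ('n::finite) smat \<Rightarrow> 'n smat" where
  "mat_scale c X = (\<chi> i j. c * X $ i $ j)"

definition mat_comp :: "bit \<Rightarrow> ('n::finite) smat \<Rightarrow> 'n smat" where
  "mat_comp p X = (\<chi> i j. if idx_parity i + idx_parity j = p then X $ i $ j else 0)"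

definition supercommutator :: "('n::finite) smat \<Rightarrow> 'n smat \<Rightarrow> 'n smat" where
  "supercommutator X Y = (\<Sum>p\<in>{0, 1}. \<Sum>q\<in>{0, 1}.
     mat_comp p X ** mat_comp q Y - mat_scale (ksign p q) (mat_comp q Y ** mat_comp p X))"

fun gram :: "'n idx \<Rightarrow> 'n idx \<Rightarrow> complex" where
  "gram None None = 1"
| "gram (Some (Inl i)) (Some (Inr j)) = (if i = j then 1 else 0)"
| "gram (Some (Inr i)) (Some (Inl j)) = (if i = j then - 1 else 0)"
| "gram _ _ = 0"

definition std_form :: "complex ^ ('n::finite) idx \<Rightarrow> complex ^ 'n idx \<Rightarrow> complex" where
  "std_form v w = (\<Sum>i\<in>UNIV. \<Sum>j\<in>UNIV. v $ i * gram i j * w $ j)"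

definition osp_part :: "bit \<Rightarrow> ('n::finite) smat set" where
  "osp_part p = {X. mat_comp p X = X \<and>
     (\<forall>q. \<forall>v\<in>vec_part q. \<forall>w. std_form (X *v v) w + ksign p q * std_form v (X *v w) = 0)}"

definition osp :: "('n::finite) smat lie_superalgebra" where
  "osp = \<lparr>lscale = mat_scale, lpart = osp_part, lbracket = supercommutator\<rparr>"

definition mat_nilpotent :: "('n::finite) smat \<Rightarrow> bool" where
  "mat_nilpotent X \<longleftrightarrow> (\<exists>k. (((**) X) ^^ k) (mat 1) = 0)"

definition even_centralizer :: "'a::ab_group_add lie_superalgebra \<Rightarrow> 'a \<Rightarrow> 'a set" where
  "even_centralizer L x = {y \<in> lpart L 0. lbracket L x y = 0}"

text \<open>Regular elements of the even part: those with centralizer of least dimension.\<close>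

definition regular_even :: "'a::ab_group_add lie_superalgebra \<Rightarrow> 'a \<Rightarrow> bool" where
  "regular_even L x \<longleftrightarrow> x \<in> lpart L 0 \<and>
     (\<forall>y\<in>lpart L 0. vector_space.dim (lscale L) (even_centralizer L x)
                   \<le> vector_space.dim (lscale L) (even_centralizer L y))"


section \<open>Superspaces and associative superalgebras\<close>

text \<open>
  These carry their own operations because the instances below are quotients, whose elements are
  cosets, and spaces of maps between quotients.
\<close>

record 'v superspace =
  scarrier :: "'v set"
  sadd :: "'v \<Rightarrow> 'v \<Rightarrow> 'v"
  sscale :: "complex \<Rightarrow> 'v \<Rightarrow> 'v"
  spart :: "bit \<Rightarrow> 'v set"

record 'v superalgebra = "'v superspace" +
  smult :: "'v \<Rightarrow> 'v \<Rightarrow> 'v"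
  sone :: "'v"

definition slinear :: "('v, 'x) superspace_scheme \<Rightarrow> ('w, 'y) superspace_scheme \<Rightarrow> ('v \<Rightarrow> 'w) \<Rightarrow> bool"
  where "slinear V W f \<longleftrightarrow>
     (\<forall>a\<in>scarrier V. \<forall>b\<in>scarrier V. f (sadd V a b) = sadd W (f a) (f b)) \<and>
     (\<forall>c. \<forall>a\<in>scarrier V. f (sscale V c a) = sscale W c (f a))"

definition scomponent :: "('v, 'x) superspace_scheme \<Rightarrow> bit \<Rightarrow> 'v \<Rightarrow> 'v" where
  "scomponent V p v = (THE w. w \<in> spart V p \<and> (\<exists>w'\<in>spart V (p + 1). v = sadd V w w'))"

text \<open>
  The opposite superalgebra, with product $a \cdot b = (-1)^{|a||b|} b a$ on homogeneous elements.
  Only the odd-odd term \<open>b1 a1\<close> changes sign.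
\<close>

definition opposite :: "'v superalgebra \<Rightarrow> 'v superalgebra" where
  "opposite A = A\<lparr>smult := (\<lambda>a b.
     let a0 = scomponent A 0 a; a1 = scomponent A 1 a;
         b0 = scomponent A 0 b; b1 = scomponent A 1 b
     in sadd A (smult A b a0) (sadd A (smult A b0 a1) (sscale A (- 1) (smult A b1 a1))))\<rparr>"

text \<open>
  The module is the direct sum of \<open>W 0\<close> and \<open>W 1\<close>, which need not be the whole of the ambient space.
\<close>

definition superrepresentation ::
  "'v superalgebra \<Rightarrow> (bit \<Rightarrow> (complex ^ 'd) set) \<Rightarrow> ('v \<Rightarrow> complex ^ 'd \<Rightarrow> complex ^ 'd) \<Rightarrow> bool"
  where "superrepresentation A W act \<longleftrightarrow>
     (\<forall>p. vec.subspace (W p)) \<and> W 0 \<inter> W 1 = {0} \<and>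
     (\<forall>p q. \<forall>a\<in>spart A p. \<forall>w\<in>W q. act a w \<in> W (p + q)) \<and>
     (\<forall>a\<in>scarrier A. \<forall>v\<in>W 0 + W 1. \<forall>w\<in>W 0 + W 1. act a (v + w) = act a v + act a w) \<and>
     (\<forall>a\<in>scarrier A. \<forall>c. \<forall>w\<in>W 0 + W 1. act a (c *s w) = c *s act a w) \<and>
     (\<forall>a\<in>scarrier A. \<forall>b\<in>scarrier A. \<forall>w\<in>W 0 + W 1. act (sadd A a b) w = act a w + act b w) \<and>
     (\<forall>a\<in>scarrier A. \<forall>c. \<forall>w\<in>W 0 + W 1. act (sscale A c a) w = c *s act a w) \<and>
     (\<forall>a\<in>scarrier A. \<forall>b\<in>scarrier A. \<forall>w\<in>W 0 + W 1. act (smult A a b) w = act a (act b w)) \<and>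
     (\<forall>w\<in>W 0 + W 1. act (sone A) w = w)"


section \<open>Quotients of free spaces\<close>

definition fscale :: "complex \<Rightarrow> ('k \<Rightarrow>\<^sub>0 complex) \<Rightarrow> ('k \<Rightarrow>\<^sub>0 complex)" where
  "fscale c p = Poly_Mapping.map ((*) c) p"

abbreviation fspan :: "('k \<Rightarrow>\<^sub>0 complex) set \<Rightarrow> ('k \<Rightarrow>\<^sub>0 complex) set" where
  "fspan \<equiv> module.span fscale"

definition fextend :: "('k \<Rightarrow> 'l) \<Rightarrow> ('k \<Rightarrow>\<^sub>0 complex) \<Rightarrow> ('l \<Rightarrow>\<^sub>0 complex)" where
  "fextend g p = (\<Sum>k\<in>Poly_Mapping.keys p. Poly_Mapping.single (g k) (Poly_Mapping.lookup p k))"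

text \<open>
  The quotient by \<open>N\<close> of the space spanned by the basis \<open>K\<close>, its part of parity \<open>p\<close> being the image
  of the span of \<open>B p\<close>. Cosets are added by elementwise addition of sets.
\<close>

definition fquotient ::
  "'k set \<Rightarrow> (bit \<Rightarrow> ('k \<Rightarrow>\<^sub>0 complex) set) \<Rightarrow> ('k \<Rightarrow>\<^sub>0 complex) set \<Rightarrow> ('k \<Rightarrow>\<^sub>0 complex) set superspace"
  where "fquotient K B N =
     \<lparr>scarrier = (\<lambda>a. a +o N) ` {a. Poly_Mapping.keys a \<subseteq> K},
      sadd = (+),
      sscale = (\<lambda>c X. fscale c ` X + N),
      spart = (\<lambda>p. (\<lambda>a. a +o N) ` fspan (B p))\<rparr>"


section \<open>The universal enveloping superalgebra\<close>

text \<open>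
  With lists as the free monoid, \<open>'a list \<Rightarrow>\<^sub>0 complex\<close> is the free associative algebra on \<open>'a\<close>.
\<close>

instantiation list :: (type) monoid_add
begin

definition zero_list :: "'a list" where "zero_list = []"

definition plus_list :: "'a list \<Rightarrow> 'a list \<Rightarrow> 'a list" where "plus_list xs ys = xs @ ys"

instance
  by standard (simp_all add: zero_list_def plus_list_def)

end

definition gen :: "'a \<Rightarrow> ('a list \<Rightarrow>\<^sub>0 complex)" where
  "gen x = Poly_Mapping.single [x] 1"

definition free_alg :: "'a::ab_group_add lie_superalgebra \<Rightarrow> ('a list \<Rightarrow>\<^sub>0 complex) set" where
  "free_alg L = {a. Poly_Mapping.keys a \<subseteq> lists (lcarrier L)}"

text \<open>
  The first two families of relations turn the free algebra on the set \<open>lcarrier L\<close> into the tensor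
  algebra of the vector space.
\<close>

definition uea_relations :: "'a::ab_group_add lie_superalgebra \<Rightarrow> ('a list \<Rightarrow>\<^sub>0 complex) set" where
  "uea_relations L =
     {gen (x + y) - gen x - gen y | x y. x \<in> lcarrier L \<and> y \<in> lcarrier L} \<union>
     {gen (lscale L c x) - fscale c (gen x) | c x. x \<in> lcarrier L} \<union>
     {gen x * gen y - fscale (ksign p q) (gen y * gen x) - gen (lbracket L x y) | x y p q.
        x \<in> lpart L p \<and> y \<in> lpart L q}"

definition uea_ideal :: "'a::ab_group_add lie_superalgebra \<Rightarrow> ('a list \<Rightarrow>\<^sub>0 complex) set" where
  "uea_ideal L =
     fspan {a * r * b | a r b. a \<in> free_alg L \<and> r \<in> uea_relations L \<and> b \<in> free_alg L}"

definition homogeneous_words :: "'a lie_superalgebra \<Rightarrow> bit \<Rightarrow> ('a list \<Rightarrow>\<^sub>0 complex) set" where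
  "homogeneous_words L p = {Poly_Mapping.single xs 1 | xs ps.
     list_all2 (\<lambda>x q. x \<in> lpart L q) xs ps \<and> sum_list ps = p}"

definition uea :: "'a::ab_group_add lie_superalgebra \<Rightarrow> ('a list \<Rightarrow>\<^sub>0 complex) set superalgebra" where
  "uea L = superspace.extend
     (fquotient (lists (lcarrier L)) (homogeneous_words L) (uea_ideal L))
     (superalgebra.fields (\<lambda>X Y. X * Y + uea_ideal L) (1 +o uea_ideal L))"

definition uea_gen :: "'a::ab_group_add lie_superalgebra \<Rightarrow> 'a \<Rightarrow> ('a list \<Rightarrow>\<^sub>0 complex) set" where
  "uea_gen L x = gen x +o uea_ideal L"

text \<open>
  The homomorphism from the enveloping algebra of a subalgebra to that of \<open>L\<close>: a coset of the smaller
  ideal is sent to the coset of the larger ideal containing it.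
\<close>

definition uea_map ::
  "'a::ab_group_add lie_superalgebra \<Rightarrow> ('a list \<Rightarrow>\<^sub>0 complex) set \<Rightarrow> ('a list \<Rightarrow>\<^sub>0 complex) set" where
  "uea_map L X = X + uea_ideal L"

text \<open>
  For a character \<open>chi\<close>, the map \<open>free_char chi\<close> is constant on each coset of the ideal.
\<close>

definition free_char :: "('a \<Rightarrow> complex) \<Rightarrow> ('a list \<Rightarrow>\<^sub>0 complex) \<Rightarrow> complex" where
  "free_char chi a = (\<Sum>xs\<in>Poly_Mapping.keys a. Poly_Mapping.lookup a xs * prod_list (map chi xs))"

definition uea_char :: "('a \<Rightarrow> complex) \<Rightarrow> ('a list \<Rightarrow>\<^sub>0 complex) set \<Rightarrow> complex" where
  "uea_char chi X = (THE c. \<exists>a\<in>X. c = free_char chi a)"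


section \<open>Tensor products over a superalgebra\<close>

text \<open>
  \<open>M\<close> is a right module by \<open>ract\<close> and \<open>N\<close> a left module by \<open>lact\<close> over \<open>A\<close>.
\<close>

definition tensor_relations ::
  "('b, 'x) superspace_scheme \<Rightarrow> ('m, 'y) superspace_scheme \<Rightarrow> ('m \<Rightarrow> 'b \<Rightarrow> 'm) \<Rightarrow>
   ('n, 'z) superspace_scheme \<Rightarrow> ('b \<Rightarrow> 'n \<Rightarrow> 'n) \<Rightarrow> ('m \<times> 'n \<Rightarrow>\<^sub>0 complex) set" where
  "tensor_relations A M ract N lact = (let \<delta> = (\<lambda>m n. Poly_Mapping.single (m, n) 1) in
     {\<delta> (sadd M m m') n - \<delta> m n - \<delta> m' n | m m' n.
        m \<in> scarrier M \<and> m' \<in> scarrier M \<and> n \<in> scarrier N} \<union>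
     {\<delta> m (sadd N n n') - \<delta> m n - \<delta> m n' | m n n'.
        m \<in> scarrier M \<and> n \<in> scarrier N \<and> n' \<in> scarrier N} \<union>
     {\<delta> (sscale M c m) n - fscale c (\<delta> m n) | c m n. m \<in> scarrier M \<and> n \<in> scarrier N} \<union>
     {\<delta> m (sscale N c n) - fscale c (\<delta> m n) | c m n. m \<in> scarrier M \<and> n \<in> scarrier N} \<union>
     {\<delta> (ract m a) n - \<delta> m (lact a n) | m a n.
        m \<in> scarrier M \<and> a \<in> scarrier A \<and> n \<in> scarrier N})"

definition tensor ::
  "('b, 'x) superspace_scheme \<Rightarrow> ('m, 'y) superspace_scheme \<Rightarrow> ('m \<Rightarrow> 'b \<Rightarrow> 'm) \<Rightarrow>
   ('n, 'z) superspace_scheme \<Rightarrow> ('b \<Rightarrow> 'n \<Rightarrow> 'n) \<Rightarrow> ('m \<times> 'n \<Rightarrow>\<^sub>0 complex) set superspace" where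
  "tensor A M ract N lact = fquotient
     (scarrier M \<times> scarrier N)
     (\<lambda>p. {Poly_Mapping.single (m, n) 1 | m n q r. m \<in> spart M q \<and> n \<in> spart N r \<and> q + r = p})
     (fspan (tensor_relations A M ract N lact))"


section \<open>Finite W-superalgebras\<close>

definition sl2_triple :: "'a::ab_group_add lie_superalgebra \<Rightarrow> 'a \<Rightarrow> 'a \<Rightarrow> 'a \<Rightarrow> bool" where
  "sl2_triple L e h f \<longleftrightarrow> e \<in> lpart L 0 \<and> h \<in> lpart L 0 \<and> f \<in> lpart L 0 \<and>
     lbracket L h e = lscale L 2 e \<and> lbracket L h f = lscale L (- 2) f \<and> lbracket L e f = h"

definition invariant_form :: "'a::ab_group_add lie_superalgebra \<Rightarrow> ('a \<Rightarrow> 'a \<Rightarrow> complex) \<Rightarrow> bool" where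
  "invariant_form L B \<longleftrightarrow>
     (\<forall>x\<in>lcarrier L. \<forall>y\<in>lcarrier L. \<forall>z\<in>lcarrier L. \<forall>c.
        B (x + y) z = B x z + B y z \<and> B z (x + y) = B z x + B z y \<and>
        B (lscale L c x) y = c * B x y \<and> B x (lscale L c y) = c * B x y) \<and>
     (\<forall>p q. \<forall>x\<in>lpart L p. \<forall>y\<in>lpart L q. p \<noteq> q \<longrightarrow> B x y = 0) \<and>
     (\<forall>x\<in>lcarrier L. (\<forall>y\<in>lcarrier L. B x y = 0) \<longrightarrow> x = 0) \<and>
     (\<forall>p q. \<forall>x\<in>lpart L p. \<forall>y\<in>lpart L q. B x y = ksign p q * B y x) \<and>
     (\<forall>x\<in>lcarrier L. \<forall>y\<in>lcarrier L. \<forall>z\<in>lcarrier L.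
        B (lbracket L x y) z = B x (lbracket L y z))"

definition grading :: "'a::ab_group_add lie_superalgebra \<Rightarrow> 'a \<Rightarrow> int \<Rightarrow> 'a set" where
  "grading L h i = {x \<in> lcarrier L. lbracket L h x = lscale L (of_int i) x}"

definition is_basis_of ::
  "'a::ab_group_add lie_superalgebra \<Rightarrow> nat set \<Rightarrow> (nat \<Rightarrow> 'a) \<Rightarrow> 'a set \<Rightarrow> bool" where
  "is_basis_of L I b W \<longleftrightarrow>
     inj_on b I \<and> \<not> module.dependent (lscale L) (b ` I) \<and> module.span (lscale L) (b ` I) = W"

definition adapted_bases ::
  "'a::ab_group_add lie_superalgebra \<Rightarrow> 'a \<Rightarrow> ('a \<Rightarrow> complex) \<Rightarrow>
   nat \<Rightarrow> (nat \<Rightarrow> 'a) \<Rightarrow> nat \<Rightarrow> (nat \<Rightarrow> 'a) \<Rightarrow> bool" where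
  "adapted_bases L h chi s u r v \<longleftrightarrow>
     is_basis_of L {1..2 * s} u (grading L h (- 1) \<inter> lpart L 0) \<and>
     is_basis_of L {1..r} v (grading L h (- 1) \<inter> lpart L 1) \<and>
     (\<forall>i\<in>{1..2 * s}. \<forall>j\<in>{1..2 * s}. chi (lbracket L (u i) (u j)) =
        (if i + j = 2 * s + 1 then (if i \<le> s then - 1 else 1) else 0)) \<and>
     (\<forall>i\<in>{1..r}. \<forall>j\<in>{1..r}. chi (lbracket L (v i) (v j)) = (if i + j = r + 1 then 1 else 0))"

definition m_subspace ::
  "'a::ab_group_add lie_superalgebra \<Rightarrow> 'a \<Rightarrow> nat \<Rightarrow> (nat \<Rightarrow> 'a) \<Rightarrow> nat \<Rightarrow> (nat \<Rightarrow> 'a) \<Rightarrow> 'a set" where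
  "m_subspace L h s u r v = module.span (lscale L)
     ((\<Union>i\<in>{..-2}. grading L h i) \<union> u ` {s + 1..2 * s} \<union> v ` {j \<in> {1..r}. 2 * j > r + 1})"

text \<open>The superspace underlying $\mathbb C_\chi$.\<close>

definition even_line :: "complex superspace" where
  "even_line = \<lparr>scarrier = UNIV, sadd = (+), sscale = (*), spart = (\<lambda>p. if p = 0 then UNIV else {0})\<rparr>"

definition Q_relations ::
  "'a::ab_group_add lie_superalgebra \<Rightarrow> 'a set \<Rightarrow> ('a \<Rightarrow> complex) \<Rightarrow>
   (('a list \<Rightarrow>\<^sub>0 complex) set \<times> complex \<Rightarrow>\<^sub>0 complex) set" where
  "Q_relations L M chi = tensor_relations (uea (lrestrict L M))
     (uea L) (\<lambda>X Y. smult (uea L) X (uea_map L Y))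
     even_line (\<lambda>Y z. uea_char chi Y * z)"

definition Q_module ::
  "'a::ab_group_add lie_superalgebra \<Rightarrow> 'a set \<Rightarrow> ('a \<Rightarrow> complex) \<Rightarrow>
   (('a list \<Rightarrow>\<^sub>0 complex) set \<times> complex \<Rightarrow>\<^sub>0 complex) set superspace" where
  "Q_module L M chi = tensor (uea (lrestrict L M))
     (uea L) (\<lambda>X Y. smult (uea L) X (uea_map L Y))
     even_line (\<lambda>Y z. uea_char chi Y * z)"

definition Q_action ::
  "'a::ab_group_add lie_superalgebra \<Rightarrow> 'a set \<Rightarrow> ('a \<Rightarrow> complex) \<Rightarrow> 'a \<Rightarrow>
   (('a list \<Rightarrow>\<^sub>0 complex) set \<times> complex \<Rightarrow>\<^sub>0 complex) set \<Rightarrow>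
   (('a list \<Rightarrow>\<^sub>0 complex) set \<times> complex \<Rightarrow>\<^sub>0 complex) set" where
  "Q_action L M chi x T =
     fextend (\<lambda>(X, z). (smult (uea L) (uea_gen L x) X, z)) ` T + fspan (Q_relations L M chi)"

text \<open>
  Endomorphisms of an \<open>L\<close>-module \<open>V\<close>, even and odd. A homogeneous endomorphism \<open>F\<close> of parity \<open>p\<close>
  supercommutes with the action: $F(x v) = (-1)^{p|x|} x F(v)$. Maps are taken to be \<open>undefined\<close>
  outside the carrier of \<open>V\<close>.
\<close>

definition endo_part ::
  "'a lie_superalgebra \<Rightarrow> 'v superspace \<Rightarrow> ('a \<Rightarrow> 'v \<Rightarrow> 'v) \<Rightarrow> bit \<Rightarrow> ('v \<Rightarrow> 'v) set" where
  "endo_part L V act p = {F \<in> scarrier V \<rightarrow>\<^sub>E scarrier V. slinear V V F \<and>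
     (\<forall>q. F ` spart V q \<subseteq> spart V (p + q)) \<and>
     (\<forall>q. \<forall>x\<in>lpart L q. \<forall>w\<in>scarrier V. F (act x w) = sscale V (ksign p q) (act x (F w)))}"

definition endo_algebra ::
  "'a lie_superalgebra \<Rightarrow> 'v superspace \<Rightarrow> ('a \<Rightarrow> 'v \<Rightarrow> 'v) \<Rightarrow> ('v \<Rightarrow> 'v) superalgebra" where
  "endo_algebra L V act =
     \<lparr>scarrier = {\<lambda>w\<in>scarrier V. sadd V (F w) (G w) | F G.
                    F \<in> endo_part L V act 0 \<and> G \<in> endo_part L V act 1},
      sadd = (\<lambda>F G. \<lambda>w\<in>scarrier V. sadd V (F w) (G w)),
      sscale = (\<lambda>c F. \<lambda>w\<in>scarrier V. sscale V c (F w)),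
      spart = endo_part L V act,
      smult = compose (scarrier V),
      sone = (\<lambda>w\<in>scarrier V. w)\<rparr>"

definition finite_W ::
  "'a::ab_group_add lie_superalgebra \<Rightarrow> 'a set \<Rightarrow> ('a \<Rightarrow> complex) \<Rightarrow>
   ((('a list \<Rightarrow>\<^sub>0 complex) set \<times> complex \<Rightarrow>\<^sub>0 complex) set \<Rightarrow>
    (('a list \<Rightarrow>\<^sub>0 complex) set \<times> complex \<Rightarrow>\<^sub>0 complex) set) superalgebra" where
  "finite_W L M chi = opposite (endo_algebra L (Q_module L M chi) (Q_action L M chi))"

end

theory Submission
  imports Defs
begin

text \<open>
  Let $\mathfrak b$ be the sum of the $\mathfrak g(i)$ with $i \ge 0$. For a regular nilpotent
  $e$ the space $\mathfrak g(-1)$ is an odd line $\mathbb C\Theta$, so that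
  $\mathfrak g = \mathfrak b \oplus \mathbb C\Theta \oplus \mathfrak m$, with
  $\chi([\Theta,\Theta]) = 1$ and $\chi([\Theta,\mathfrak m]) = 0$. An endomorphism of $Q_\chi$
  supercommutes with $\mathfrak g$, hence acts on the coinvariants $Q_\chi / \mathfrak b Q_\chi$,
  and the opposite algebra acts on the dual of this space. The representation is this dual: the
  coinvariants have the images of $1$ and $\Theta$ as a basis
  (\<open>two_dimensional_representation\<close>).

  That $1$ and $\Theta$ span is a matter of rewriting words in $U(\mathfrak g)$: move letters from
  $\mathfrak b$ to the left and letters from $\mathfrak m$ to the right, and replace $\Theta^2$ by
  $\frac12[\Theta,\Theta]$, each time at the cost of shorter words (\<open>FA_reduce\<close>).

  That they are independent would follow from the Poincare-Birkhoff-Witt theorem, but there is a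
  direct way. Two functionals on $U(\mathfrak g)$ are needed that vanish on
  $\mathfrak b U(\mathfrak g)$ and satisfy $\phi(ux) = \chi(x)\phi(u)$ for $x \in \mathfrak m$.
  Let $\rho$ be $\chi$ on $\mathfrak m$, $1/\sqrt2$ at $\Theta$, and zero on $\mathfrak b$. On
  $\mathfrak n = \mathbb C\Theta \oplus \mathfrak m$ it is a character, although not a graded one,
  because $2\rho(\Theta)^2 = \chi([\Theta,\Theta])$. It extends to words in $\mathfrak g$ by
  recursion on the length: a last letter from $\mathfrak n$ is evaluated by $\rho$, and a last letter
  from $\mathfrak b$ is pulled to the front, where it dies, which turns the rest of the word into a
  sum of words of the same length as that rest. This is the functional \<open>psi\<close>. That it
  respects the relations of $U(\mathfrak g)$ is the computation showing that an induced module is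
  well defined (\<open>rel_psi\<close>). Its even and odd parts are the two functionals: they are nonzero
  because $\rho$ is nonzero both at $1$ and at $\Theta$.

  It remains to find the decomposition of $\mathfrak g$. In a finite-dimensional
  $\mathfrak{sl}_2$-module the coefficients of the Laurent polynomial
  $\exp(te)\exp(-t^{-1}f)\exp(te)$ consist of eigenvectors of $h$, and at $t = 1$ it is invertible,
  so $h$ is diagonalisable with integer eigenvalues (\<open>weight_decomposition\<close>). Compare the
  centralizer of $e$ with that of $h + tz$, for $z \in \mathfrak g(0)_{\bar0}$ and small $t$:
  regularity forces $\mathfrak g(1)_{\bar0} = 0$ and $\mathfrak g(0)_{\bar0}$ abelian
  (\<open>regular_degree_0\<close>). On the odd part of $\mathfrak{osp}(1|2n)$ there is an invariant
  symplectic form $\omega$ with $[[x,y],w] = \omega(w,y)x + \omega(w,x)y$, so a large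
  $\mathfrak g(0)_{\bar1}$ or $\mathfrak g(-1)_{\bar1}$ would produce noncommuting elements of
  $\mathfrak g(0)_{\bar0}$. This leaves $\dim \mathfrak g(-1)_{\bar1} = 1$.
\<close>


section \<open>Free vector spaces\<close>

lemma lookup_fscale [simp]: "Poly_Mapping.lookup (fscale c p) k = c * Poly_Mapping.lookup p k"
  unfolding fscale_def by (simp add: Poly_Mapping.map.rep_eq when_def)

interpretation fs: module fscale
  by standard (auto intro!: poly_mapping_eqI simp: lookup_add algebra_simps)

lemma fscale_single [simp]: "fscale c (Poly_Mapping.single k a) = Poly_Mapping.single k (c * a)"
  by (intro poly_mapping_eqI) (simp add: lookup_single when_def)

lemma fscale_mult_left: "fscale c a * b = fscale c (a * b)"
  for a b :: "('k::monoid_add) \<Rightarrow>\<^sub>0 complex"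
  by (simp add: fscale_def mult_map_scale_conv_mult mult.assoc)

lemma fscale_mult_right: "a * fscale c b = fscale c (a * b)"
  for a b :: "('k::monoid_add) \<Rightarrow>\<^sub>0 complex"
proof -
  have "a * Poly_Mapping.single 0 c = Poly_Mapping.single 0 c * a"
    for a :: "('k::monoid_add) \<Rightarrow>\<^sub>0 complex"
  proof (induction a rule: update_induct)
    case const then show ?case by simp
  next
    case (update a k v)
    have "Poly_Mapping.update k v a = a + Poly_Mapping.single k v"
      using update.hyps by (intro poly_mapping_eqI)
        (auto simp: lookup_update lookup_add lookup_single when_def not_in_keys_iff_lookup_eq_zero)
    then show ?case
      using update.IH by (simp add: algebra_simps mult_single)
  qed
  then show ?thesis
    by (simp add: fscale_def mult_map_scale_conv_mult mult.assoc[symmetric])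
qed

definition fev :: "('k \<Rightarrow> complex) \<Rightarrow> ('k \<Rightarrow>\<^sub>0 complex) \<Rightarrow> complex" where
  "fev f a = (\<Sum>k\<in>Poly_Mapping.keys a. Poly_Mapping.lookup a k * f k)"

lemma fev_superset:
  assumes "finite S" "Poly_Mapping.keys a \<subseteq> S"
  shows "fev f a = (\<Sum>k\<in>S. Poly_Mapping.lookup a k * f k)"
  unfolding fev_def
  by (rule sum.mono_neutral_left) (use assms in \<open>auto simp: in_keys_iff\<close>)

lemma fev_zero [simp]: "fev f 0 = 0"
  by (simp add: fev_def)

lemma fev_single [simp]: "fev f (Poly_Mapping.single k c) = c * f k"
  by (subst fev_superset[of "{k}"]) (auto simp: lookup_single)

lemma fev_add: "fev f (a + b) = fev f a + fev f b"
proof -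
  let ?S = "Poly_Mapping.keys a \<union> Poly_Mapping.keys b"
  have "fev f (a + b) = (\<Sum>k\<in>?S. Poly_Mapping.lookup (a + b) k * f k)"
    by (rule fev_superset) (use keys_add[of a b] in auto)
  also have "\<dots> = fev f a + fev f b"
    by (subst (1 2) fev_superset[of ?S])
      (auto simp: lookup_add algebra_simps sum.distrib)
  finally show ?thesis .
qed

lemma keys_fscale: "Poly_Mapping.keys (fscale c a) \<subseteq> Poly_Mapping.keys a"
  by (auto simp: in_keys_iff)

lemma fev_fscale: "fev f (fscale c a) = c * fev f a"
  by (subst fev_superset[of "Poly_Mapping.keys a"])
    (use keys_fscale[of c a] in \<open>auto simp: fev_def sum_distrib_left algebra_simps\<close>)

lemma fev_diff: "fev f (a - b) = fev f a - fev f b"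
proof -
  have "fev f (a - b) + fev f b = fev f a"
    by (simp add: fev_add[symmetric])
  then show ?thesis by (simp add: algebra_simps)
qed

lemma fev_vanish_span:
  assumes "\<And>a. a \<in> S \<Longrightarrow> fev f a = 0" "a \<in> fspan S"
  shows "fev f a = 0"
  using assms(2)
  by (induction rule: fs.span_induct_alt) (auto simp: fev_add fev_fscale assms(1))

definition flin :: "('k \<Rightarrow> ('l \<Rightarrow>\<^sub>0 complex)) \<Rightarrow> ('k \<Rightarrow>\<^sub>0 complex) \<Rightarrow> ('l \<Rightarrow>\<^sub>0 complex)" where
  "flin g a = (\<Sum>k\<in>Poly_Mapping.keys a. fscale (Poly_Mapping.lookup a k) (g k))"

lemma flin_superset:
  assumes "finite S" "Poly_Mapping.keys a \<subseteq> S"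
  shows "flin g a = (\<Sum>k\<in>S. fscale (Poly_Mapping.lookup a k) (g k))"
  unfolding flin_def
  by (rule sum.mono_neutral_left) (use assms in \<open>auto simp: in_keys_iff\<close>)

lemma flin_zero [simp]: "flin g 0 = 0"
  by (simp add: flin_def)

lemma flin_single [simp]: "flin g (Poly_Mapping.single k c) = fscale c (g k)"
  by (subst flin_superset[of "{k}"]) (auto simp: lookup_single)

lemma flin_add: "flin g (a + b) = flin g a + flin g b"
proof -
  let ?S = "Poly_Mapping.keys a \<union> Poly_Mapping.keys b"
  have "flin g (a + b) = (\<Sum>k\<in>?S. fscale (Poly_Mapping.lookup (a + b) k) (g k))"
    by (rule flin_superset) (use keys_add[of a b] in auto)
  also have "\<dots> = flin g a + flin g b"
    by (subst (1 2) flin_superset[of ?S])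
      (auto simp: lookup_add fs.scale_left_distrib sum.distrib)
  finally show ?thesis .
qed

lemma flin_fscale: "flin g (fscale c a) = fscale c (flin g a)"
  by (subst flin_superset[of "Poly_Mapping.keys a"])
    (use keys_fscale[of c a] in \<open>auto simp: flin_def fs.scale_sum_right\<close>)

lemma flin_diff: "flin g (a - b) = flin g a - flin g b"
proof -
  have "flin g (a - b) + flin g b = flin g a" by (simp add: flin_add[symmetric])
  then show ?thesis by (simp add: algebra_simps)
qed

lemma fextend_flin: "fextend g = flin (\<lambda>k. Poly_Mapping.single (g k) 1)"
  by (intro ext) (simp add: fextend_def flin_def)

lemma fextend_zero [simp]: "fextend g 0 = 0"
  and fextend_single [simp]: "fextend g (Poly_Mapping.single k c) = Poly_Mapping.single (g k) c"
  and fextend_add: "fextend g (a + b) = fextend g a + fextend g b"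
  and fextend_fscale: "fextend g (fscale c a) = fscale c (fextend g a)"
  and fextend_diff: "fextend g (a - b) = fextend g a - fextend g b"
  by (simp_all add: fextend_flin flin_add flin_fscale flin_diff)

lemma poly_mapping_sum_single:
  fixes a :: "'k \<Rightarrow>\<^sub>0 complex"
  shows "a = (\<Sum>k\<in>Poly_Mapping.keys a. Poly_Mapping.single k (Poly_Mapping.lookup a k))"
proof (rule poly_mapping_eqI)
  fix k
  show "Poly_Mapping.lookup a k = Poly_Mapping.lookup
    (\<Sum>k\<in>Poly_Mapping.keys a. Poly_Mapping.single k (Poly_Mapping.lookup a k)) k"
    by (simp add: lookup_sum lookup_single when_def sum.delta in_keys_iff)
qed

lemma keys_induct [consumes 1, case_names zero add single]:
  fixes a :: "'k \<Rightarrow>\<^sub>0 complex"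
  assumes "Poly_Mapping.keys a \<subseteq> K"
    and "P 0" "\<And>a b. P a \<Longrightarrow> P b \<Longrightarrow> P (a + b)" "\<And>k c. k \<in> K \<Longrightarrow> P (Poly_Mapping.single k c)"
  shows "P a"
proof -
  have "P (\<Sum>k\<in>S. Poly_Mapping.single k (Poly_Mapping.lookup a k))" if "finite S" "S \<subseteq> K" for S
    using that by (induction S) (auto intro: assms)
  from this[of "Poly_Mapping.keys a"] show ?thesis
    using assms(1) by (simp flip: poly_mapping_sum_single)
qed


section \<open>Lie superalgebras\<close>

lemma ksign_simps [simp]:
  "ksign 0 q = 1" "ksign p 0 = 1" "ksign 1 1 = -1"
  by (auto simp: ksign_def)

\<comment> \<open>Parities are added by case distinction; the bit operation would hide the sums.\<close>
declare add_bit_eq_xor [simp del]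

lemma bit_add_self [simp]: "p + p = (0::bit)" "p + (p + q) = (q::bit)" "q + p + p = (q::bit)"
  by (cases p; simp add: add.assoc; fail)+

locale lie_super = module "lscale L" for L :: "('a::ab_group_add) lie_superalgebra" +
  assumes subspace_part: "subspace (lpart L p)"
    and part_disjoint: "x \<in> lpart L 0 \<Longrightarrow> x \<in> lpart L 1 \<Longrightarrow> x = 0"
    and bracket_part: "x \<in> lpart L p \<Longrightarrow> y \<in> lpart L q \<Longrightarrow> lbracket L x y \<in> lpart L (p + q)"
    and bracket_add_left: "x \<in> lcarrier L \<Longrightarrow> x' \<in> lcarrier L \<Longrightarrow> y \<in> lcarrier L \<Longrightarrow>
      lbracket L (x + x') y = lbracket L x y + lbracket L x' y"
    and bracket_add_right: "x \<in> lcarrier L \<Longrightarrow> y \<in> lcarrier L \<Longrightarrow> y' \<in> lcarrier L \<Longrightarrow>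
      lbracket L x (y + y') = lbracket L x y + lbracket L x y'"
    and bracket_scale_left: "x \<in> lcarrier L \<Longrightarrow> y \<in> lcarrier L \<Longrightarrow>
      lbracket L (lscale L c x) y = lscale L c (lbracket L x y)"
    and bracket_scale_right: "x \<in> lcarrier L \<Longrightarrow> y \<in> lcarrier L \<Longrightarrow>
      lbracket L x (lscale L c y) = lscale L c (lbracket L x y)"
    and bracket_super: "x \<in> lpart L p \<Longrightarrow> y \<in> lpart L q \<Longrightarrow>
      lbracket L x y = lscale L (- ksign p q) (lbracket L y x)"
    and super_jacobi: "x \<in> lpart L p \<Longrightarrow> y \<in> lpart L q \<Longrightarrow> z \<in> lpart L t \<Longrightarrow>
      lbracket L x (lbracket L y z) =
      lbracket L (lbracket L x y) z + lscale L (ksign p q) (lbracket L y (lbracket L x z))"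
begin

abbreviation "G \<equiv> lcarrier L"
abbreviation "P \<equiv> lpart L"
abbreviation "sc \<equiv> lscale L"
abbreviation "br \<equiv> lbracket L"

lemma P_zero [simp]: "0 \<in> P p"
  and P_add: "x \<in> P p \<Longrightarrow> y \<in> P p \<Longrightarrow> x + y \<in> P p"
  and P_scale: "x \<in> P p \<Longrightarrow> sc c x \<in> P p"
  and P_diff: "x \<in> P p \<Longrightarrow> y \<in> P p \<Longrightarrow> x - y \<in> P p"
  using subspace_part[of p] by (auto intro: subspace_0 subspace_add subspace_scale subspace_diff)

lemma G_iff: "x \<in> G \<longleftrightarrow> (\<exists>a\<in>P 0. \<exists>b\<in>P 1. x = a + b)"
  by (auto simp: lcarrier_def set_plus_def)

lemma P_G: "x \<in> P p \<Longrightarrow> x \<in> G"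
  by (cases p) (metis G_iff P_zero add.right_neutral add.left_neutral)+

lemma subspace_G: "subspace G"
proof (rule subspaceI)
  show "0 \<in> G" using P_G[OF P_zero] .
  fix x y c assume x: "x \<in> G" 
  show "sc c x \<in> G" using x unfolding G_iff by (metis scale_right_distrib P_scale)
  assume y: "y \<in> G"
  from x y obtain a b a' b' where "a \<in> P 0" "b \<in> P 1" "x = a + b" "a' \<in> P 0" "b' \<in> P 1" "y = a' + b'"
    by (auto simp: G_iff)
  then have "a + a' \<in> P 0" "b + b' \<in> P 1" "x + y = (a + a') + (b + b')"
    by (auto simp: algebra_simps intro: P_add)
  then show "x + y \<in> G" unfolding G_iff by blast
qed

lemma G_zero [simp]: "0 \<in> G"
  and G_add: "x \<in> G \<Longrightarrow> y \<in> G \<Longrightarrow> x + y \<in> G"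
  and G_scale: "x \<in> G \<Longrightarrow> sc c x \<in> G"
  and G_diff: "x \<in> G \<Longrightarrow> y \<in> G \<Longrightarrow> x - y \<in> G"
  using subspace_G by (auto intro: subspace_0 subspace_add subspace_scale subspace_diff)

lemma br_G: assumes "x \<in> G" "y \<in> G" shows "br x y \<in> G"
proof -
  from assms obtain a b a' b' where "a \<in> P 0" "b \<in> P 1" "x = a + b" "a' \<in> P 0" "b' \<in> P 1" "y = a' + b'"
    by (auto simp: G_iff)
  then show ?thesis
    by (auto simp: bracket_add_left bracket_add_right P_G G_add intro!: G_add intro: P_G bracket_part)
qed

lemma br_zero [simp]: "x \<in> G \<Longrightarrow> br 0 x = 0" "x \<in> G \<Longrightarrow> br x 0 = 0"
  using bracket_scale_left[of 0 x 0] bracket_scale_right[of x 0 0] by auto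

definition pc :: "bit \<Rightarrow> 'a \<Rightarrow> 'a" where
  "pc p x = (THE a. a \<in> P p \<and> x - a \<in> P (p + 1))"

lemma pc_eqI: assumes "a \<in> P p" "x - a \<in> P (p + 1)" shows "pc p x = a"
  unfolding pc_def
proof (rule the_equality)
  fix a' assume a': "a' \<in> P p \<and> x - a' \<in> P (p + 1)"
  have "a' - a \<in> P p" using a' assms P_diff by blast
  moreover have "a' - a \<in> P (p + 1)"
    using P_diff[of "x - a" "p + 1" "x - a'"] a' assms by simp
  ultimately have "a' - a = 0" using part_disjoint[of "a' - a"] by (cases p) auto
  then show "a' = a" by simp
qed (use assms in auto)

lemma pc_exists: assumes "x \<in> G" shows "\<exists>a. a \<in> P p \<and> x - a \<in> P (p + 1)"
proof -
  from assms obtain a b where "a \<in> P 0" "b \<in> P 1" "x = a + b" by (auto simp: G_iff)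
  then show ?thesis by (cases p) (auto intro: exI[of _ a] exI[of _ b])
qed

lemma pc_P: "x \<in> G \<Longrightarrow> pc p x \<in> P p"
  using pc_exists[of x p] pc_eqI by metis

lemma pc_sum: assumes "x \<in> G" shows "x = pc 0 x + pc 1 x"
proof -
  from assms obtain a b where ab: "a \<in> P 0" "b \<in> P 1" "x = a + b" by (auto simp: G_iff)
  then have "pc 0 x = a" "pc 1 x = b" by (auto intro!: pc_eqI)
  with ab show ?thesis by simp
qed

lemma pc_hom: "x \<in> P p \<Longrightarrow> pc p x = x" "x \<in> P p \<Longrightarrow> q \<noteq> p \<Longrightarrow> pc q x = 0"
  by (cases p; cases q; auto intro: pc_eqI)+

lemma pc_add: assumes "x \<in> G" "y \<in> G" shows "pc p (x + y) = pc p x + pc p y"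
proof (rule pc_eqI)
  obtain "pc p x \<in> P p" "x - pc p x \<in> P (p+1)" "pc p y \<in> P p" "y - pc p y \<in> P (p+1)"
    using pc_exists[OF assms(1), of p] pc_exists[OF assms(2), of p] pc_eqI by metis
  then show "pc p x + pc p y \<in> P p" "x + y - (pc p x + pc p y) \<in> P (p + 1)"
    using P_add[of "x - pc p x" "p+1" "y - pc p y"] P_add by (auto simp: algebra_simps)
qed

lemma pc_scale: assumes "x \<in> G" shows "pc p (sc c x) = sc c (pc p x)"
proof (rule pc_eqI)
  obtain "pc p x \<in> P p" "x - pc p x \<in> P (p+1)"
    using pc_exists[OF assms(1), of p] pc_eqI by metis
  then show "sc c (pc p x) \<in> P p" "sc c x - sc c (pc p x) \<in> P (p + 1)"
    using P_scale[of "x - pc p x" "p+1" c] P_scale by (auto simp: scale_right_diff_distrib)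
qed

text \<open>
  The Koszul twist: what becomes of \<open>y\<close> when it moves past something of parity \<open>p\<close>. Words may
  have inhomogeneous letters; the twist makes it unnecessary to expand them.
\<close>

definition tw :: "bit \<Rightarrow> 'a \<Rightarrow> 'a" where
  "tw p y = (if p = 0 then y else pc 0 y - pc 1 y)"

lemma tw_hom: "y \<in> P q \<Longrightarrow> tw p y = sc (ksign p q) y"
  by (cases p; cases q) (auto simp: tw_def pc_hom)

lemma tw_0 [simp]: "tw 0 y = y" by (simp add: tw_def)

lemma tw_G [simp]: "y \<in> G \<Longrightarrow> tw p y \<in> G"
  by (auto simp: tw_def intro!: G_diff P_G[OF pc_P])

lemma tw_P: "y \<in> P q \<Longrightarrow> tw p y \<in> P q"
  by (simp add: tw_hom P_scale)

lemma tw_add: "x \<in> G \<Longrightarrow> y \<in> G \<Longrightarrow> tw p (x + y) = tw p x + tw p y"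
  by (auto simp: tw_def pc_add)

lemma tw_scale: "x \<in> G \<Longrightarrow> tw p (sc c x) = sc c (tw p x)"
  by (auto simp: tw_def pc_scale scale_right_diff_distrib)

lemma tw_tw: assumes "x \<in> G" shows "tw p (tw q x) = tw (p + q) x"
proof -
  have [simp]: "pc 0 (pc 0 x - pc 1 x) = pc 0 x" "pc 1 (pc 0 x - pc 1 x) = - pc 1 x"
    using pc_P[OF assms, of 0] pc_P[OF assms, of 1] P_scale[of _ 1 "-1"]
    by (auto intro!: pc_eqI)
  show ?thesis
    by (cases p; cases q) (use pc_sum[OF assms] in \<open>auto simp: tw_def\<close>)
qed

lemma G_hom_induct [consumes 1, case_names hom add]:
  assumes "x \<in> G" "\<And>p x. x \<in> P p \<Longrightarrow> Q x" "\<And>x y. x \<in> G \<Longrightarrow> y \<in> G \<Longrightarrow> Q x \<Longrightarrow> Q y \<Longrightarrow> Q (x + y)"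
  shows "Q x"
proof -
  have "Q (pc 0 x + pc 1 x)" using assms pc_P P_G by metis
  then show ?thesis using pc_sum[OF assms(1)] by simp
qed

lemma tw_br: assumes "x \<in> G" "y \<in> G" shows "tw p (br x y) = br (tw p x) (tw p y)"
  using assms
proof (induction x rule: G_hom_induct)
  case (hom q x)
  from hom(2) show ?case
  proof (induction y rule: G_hom_induct)
    case (hom t y)
    have *: "ksign p (q + t) = ksign p q * ksign p t"
      by (cases p; cases q; cases t) simp_all
    show ?case
      using hom \<open>x \<in> P q\<close> tw_hom[OF bracket_part[of x q y t]]
      by (simp add: tw_hom[of x q] tw_hom[of y t] bracket_scale_left bracket_scale_right P_G G_scale *)
        (simp add: mult.commute)
  next
    case (add a b)
    then show ?case using hom(1) by (simp add: bracket_add_right tw_add br_G P_G)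
  qed
next
  case (add a b)
  then show ?case by (simp add: bracket_add_left tw_add br_G)
qed

text \<open>
  Letters will be pulled to the left through words, so the adjoint action is used on the right.
\<close>

lemma right_jacobi:
  assumes "a \<in> G" "x \<in> P p" "y \<in> P q"
  shows "br (br a x) y = br a (br x y) + sc (ksign p q) (br (br a y) x)"
  using assms(1)
proof (induction a rule: G_hom_induct)
  case (hom t a)
  have ax: "br a x \<in> P (t + p)" and ay: "br a y \<in> P (t + q)"
    using hom assms bracket_part by auto
  have "br a (br x y) = br (br a x) y + sc (ksign t p) (br x (br a y))"
    by (rule super_jacobi[OF hom assms(2,3)])
  moreover have "br x (br a y) = sc (- ksign p (t + q)) (br (br a y) x)"
    by (rule bracket_super[OF assms(2) ay])
  ultimately have "br a (br x y) = br (br a x) y + sc (ksign t p * (- ksign p (t+q))) (br (br a y) x)"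
    by (simp only: scale_scale)
  moreover have "ksign t p * (- ksign p (t+q)) = - ksign p q"
    by (cases p; cases q; cases t) simp_all
  ultimately show ?case by (simp add: scale_minus_left)
next
  case (add a b)
  moreover have "x \<in> G" "y \<in> G" "br x y \<in> G" using assms by (auto intro: P_G br_G)
  ultimately show ?case by (simp add: bracket_add_left br_G scale_right_distrib algebra_simps)
qed

end

section \<open>Derivations of words\<close>

context lie_super
begin

definition multilinear :: "('a list \<Rightarrow> complex) \<Rightarrow> bool" where
  "multilinear f \<longleftrightarrow> (\<forall>u w. set u \<subseteq> G \<longrightarrow> set w \<subseteq> G \<longrightarrow>
     (\<forall>x\<in>G. \<forall>y\<in>G. f (u @ (x + y) # w) = f (u @ x # w) + f (u @ y # w)) \<and>
     (\<forall>x\<in>G. \<forall>c. f (u @ sc c x # w) = c * f (u @ x # w)))"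

lemma multilinear_add: "multilinear f \<Longrightarrow> set u \<subseteq> G \<Longrightarrow> set w \<subseteq> G \<Longrightarrow> x \<in> G \<Longrightarrow> y \<in> G \<Longrightarrow>
    f (u @ (x + y) # w) = f (u @ x # w) + f (u @ y # w)"
  and multilinear_scale: "multilinear f \<Longrightarrow> set u \<subseteq> G \<Longrightarrow> set w \<subseteq> G \<Longrightarrow> x \<in> G \<Longrightarrow>
    f (u @ sc c x # w) = c * f (u @ x # w)"
  by (auto simp: multilinear_def)

lemmas multilinear_add_hd = multilinear_add[of _ "[]", simplified]
  and multilinear_scale_hd = multilinear_scale[of _ "[]", simplified]
  and multilinear_add_hd2 = multilinear_add[of _ "[a]" for a, simplified]

lemma multilinear_Cons: "multilinear f \<Longrightarrow> a \<in> G \<Longrightarrow> multilinear (\<lambda>w. f (a # w))"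
  unfolding multilinear_def by (metis append_Cons insert_subset list.simps(15))

text \<open>
  Words are written from right to left from here until they are evaluated on the free algebra, so
  that the last letter of a product is the head of the list. The functional \<open>derv p x f\<close> sums the
  values of \<open>f\<close> over the words that arise when \<open>x\<close>, of parity \<open>p\<close>, is pulled from the last
  position to the front: $w x = \sum w_{(i)} \pm x w$, where in $w_{(i)}$ the letter $y_i$ is replaced
  by $[y_i, x]$ and the letters behind it are twisted.
\<close>

primrec derv :: "bit \<Rightarrow> 'a \<Rightarrow> ('a list \<Rightarrow> complex) \<Rightarrow> 'a list \<Rightarrow> complex" where
  "derv p x f [] = 0"
| "derv p x f (y # w) = f (br y x # w) + derv p x (\<lambda>w'. f (tw p y # w')) w"

lemma derv_Cons: "derv p x f (y # w) = f (br y x # w) + derv p x (\<lambda>w'. f (tw p y # w')) w"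
  by simp

lemma derv_cong:
  assumes "\<And>w'. set w' \<subseteq> G \<Longrightarrow> length w' = length w \<Longrightarrow> f w' = g w'" "set w \<subseteq> G" "x \<in> G"
  shows "derv p x f w = derv p x g w"
  using assms
proof (induction w arbitrary: f g)
  case (Cons y w)
  have "derv p x (\<lambda>w'. f (tw p y # w')) w = derv p x (\<lambda>w'. g (tw p y # w')) w"
    using Cons.prems by (intro Cons.IH) auto
  moreover have "f (br y x # w) = g (br y x # w)"
    using Cons.prems by (intro Cons.prems(1)) (auto intro: br_G)
  ultimately show ?case by simp
qed simp

lemma derv_fadd: "derv p x (\<lambda>w. f w + g w) w = derv p x f w + derv p x g w"
  by (induction w arbitrary: f g) (auto simp: algebra_simps)

lemma derv_fscale: "derv p x (\<lambda>w. c * f w) w = c * derv p x f w"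
  by (induction w arbitrary: f) (auto simp: algebra_simps)

lemma derv_xadd: "multilinear f \<Longrightarrow> set w \<subseteq> G \<Longrightarrow> x \<in> G \<Longrightarrow> y \<in> G \<Longrightarrow>
   derv p (x + y) f w = derv p x f w + derv p y f w"
  by (induction w arbitrary: f) (auto simp: bracket_add_right multilinear_add_hd br_G multilinear_Cons)

lemma derv_xscale: "multilinear f \<Longrightarrow> set w \<subseteq> G \<Longrightarrow> x \<in> G \<Longrightarrow>
   derv p (sc c x) f w = c * derv p x f w"
  by (induction w arbitrary: f) (auto simp: bracket_scale_right multilinear_scale_hd br_G multilinear_Cons algebra_simps)

lemma derv_xzero: "multilinear f \<Longrightarrow> set w \<subseteq> G \<Longrightarrow> derv p 0 f w = 0"
  using derv_xscale[of f w 0 p 0] by simp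

lemma multilinear_derv:
  assumes "multilinear f" "x \<in> G"
  shows "multilinear (derv p x f)"
proof -
  have "derv p x f (u @ (a + b) # w) = derv p x f (u @ a # w) + derv p x f (u @ b # w)"
    if "multilinear f" "set u \<subseteq> G" "set w \<subseteq> G" "a \<in> G" "b \<in> G" for f u w a b
    using that
  proof (induction u arbitrary: f)
    case Nil
    have "derv p x (\<lambda>w'. f (tw p (a + b) # w')) w =
        derv p x (\<lambda>w'. f (tw p a # w') + f (tw p b # w')) w"
      using Nil assms(2) by (intro derv_cong) (auto simp: tw_add multilinear_add_hd)
    then show ?case
      using Nil assms(2) by (simp add: bracket_add_left multilinear_add_hd br_G derv_fadd)
  next
    case (Cons c u)
    show ?case
      using Cons.prems assms(2) multilinear_add[of f "br c x # u" w a b]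
        Cons.IH[of "\<lambda>w'. f (tw p c # w')"]
      by (simp add: br_G multilinear_Cons)
  qed
  moreover have "derv p x f (u @ sc d a # w) = d * derv p x f (u @ a # w)"
    if "multilinear f" "set u \<subseteq> G" "set w \<subseteq> G" "a \<in> G" for f u w a d
    using that
  proof (induction u arbitrary: f)
    case Nil
    have "derv p x (\<lambda>w'. f (tw p (sc d a) # w')) w =
        derv p x (\<lambda>w'. d * f (tw p a # w')) w"
      using Nil assms(2) by (intro derv_cong) (auto simp: tw_scale multilinear_scale_hd)
    then show ?case
      using Nil assms(2) by (simp add: bracket_scale_left multilinear_scale_hd br_G derv_fscale algebra_simps)
  next
    case (Cons c u)
    show ?case
      using Cons.prems assms(2) multilinear_scale[of f "br c x # u" w a d]
        Cons.IH[of "\<lambda>w'. f (tw p c # w')"]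
      by (simp add: br_G multilinear_Cons algebra_simps)
  qed
  ultimately show ?thesis using assms(1) unfolding multilinear_def by blast
qed

text \<open>
  Pulling letters to the front is a representation of the Lie superalgebra. The terms in which both
  letters hit the same position agree by the Jacobi identity; the others cancel in pairs.
\<close>

lemma derv_bracket:
  assumes "x \<in> P p" "y \<in> P q" "multilinear f" "set w \<subseteq> G"
  shows "derv p x (derv q y f) w =
    derv (p + q) (br x y) f w + ksign p q * derv q y (derv p x f) w"
  using assms(3,4)
proof (induction w arbitrary: f)
  case (Cons a w)
  have [simp]: "x \<in> G" "y \<in> G" using assms P_G by auto
  have a [simp]: "a \<in> G" and w: "set w \<subseteq> G" using Cons.prems by auto
  let ?s = "ksign p q"
  have s2: "?s * ?s = 1" by (cases p; cases q) auto
  have sqp: "ksign q p = ?s" by (cases p; cases q) auto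
  have twb: "tw q (br a x) = sc ?s (br (tw q a) x)" "tw p (br a y) = sc ?s (br (tw p a) y)"
    using assms by (auto simp: tw_br tw_hom[of x p] tw_hom[of y q] bracket_scale_right sqp)
  have 1: "derv p x (derv q y f) (a # w) =
     f (br (br a x) y # w) + ?s * derv q y (\<lambda>w'. f (br (tw q a) x # w')) w
     + derv p x (\<lambda>w'. f (br (tw p a) y # w')) w
     + derv p x (derv q y (\<lambda>w'. f (tw q (tw p a) # w'))) w"
  proof -
    have "derv q y (\<lambda>w'. f (tw q (br a x) # w')) w = derv q y (\<lambda>w'. ?s * f (br (tw q a) x # w')) w"
      using Cons.prems by (intro derv_cong) (auto simp: twb multilinear_scale_hd br_G)
    then show ?thesis
      by (simp add: derv_fadd derv_fscale)
  qed
  have 2: "derv q y (derv p x f) (a # w) =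
     f (br (br a y) x # w) + ?s * derv p x (\<lambda>w'. f (br (tw p a) y # w')) w
     + derv q y (\<lambda>w'. f (br (tw q a) x # w')) w
     + derv q y (derv p x (\<lambda>w'. f (tw p (tw q a) # w'))) w"
  proof -
    have "derv p x (\<lambda>w'. f (tw p (br a y) # w')) w = derv p x (\<lambda>w'. ?s * f (br (tw p a) y # w')) w"
      using Cons.prems by (intro derv_cong) (auto simp: twb multilinear_scale_hd br_G)
    then show ?thesis
      by (simp add: derv_fadd derv_fscale)
  qed
  have 3: "f (br (br a x) y # w) = f (br a (br x y) # w) + ?s * f (br (br a y) x # w)"
    using right_jacobi[OF a assms(1,2)] Cons.prems
    by (simp add: multilinear_add_hd multilinear_scale_hd br_G G_scale)
  have 4: "tw q (tw p a) = tw (p + q) a" "tw p (tw q a) = tw (p + q) a"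
    by (simp_all add: tw_tw add.commute)
  have IH: "derv p x (derv q y (\<lambda>w'. f (tw (p + q) a # w'))) w =
     derv (p + q) (br x y) (\<lambda>w'. f (tw (p + q) a # w')) w
      + ?s * derv q y (derv p x (\<lambda>w'. f (tw (p + q) a # w'))) w"
    using Cons.prems w by (intro Cons.IH multilinear_Cons) auto
  show ?case
    unfolding 1 2 unfolding 3 4 IH derv_Cons
    using s2 by (simp add: algebra_simps)
qed simp

text \<open>
  For words of length at most \<open>n\<close>, the functional respects the relation that replaces a product
  $y x$ by $[y,x] \pm x y$. The bound makes the induction for \<open>psi\<close> possible, whose value on a word
  is defined through shorter ones.
\<close>

definition rel :: "nat \<Rightarrow> ('a list \<Rightarrow> complex) \<Rightarrow> bool" where
  "rel n f \<longleftrightarrow> (\<forall>u w q x y. set u \<subseteq> G \<longrightarrow> set w \<subseteq> G \<longrightarrow> x \<in> P q \<longrightarrow> y \<in> G \<longrightarrow>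
     length u + length w + 2 \<le> n \<longrightarrow>
     f (u @ x # y # w) = f (u @ br y x # w) + f (u @ tw q y # x # w))"

lemma relD: "rel n f \<Longrightarrow> set u \<subseteq> G \<Longrightarrow> set w \<subseteq> G \<Longrightarrow> x \<in> P q \<Longrightarrow> y \<in> G \<Longrightarrow>
   length u + length w + 2 \<le> n \<Longrightarrow>
   f (u @ x # y # w) = f (u @ br y x # w) + f (u @ tw q y # x # w)"
  unfolding rel_def by blast

lemma relD_hd: "rel n f \<Longrightarrow> set w \<subseteq> G \<Longrightarrow> x \<in> P q \<Longrightarrow> y \<in> G \<Longrightarrow> length w + 2 \<le> n \<Longrightarrow>
   f (x # y # w) = f (br y x # w) + f (tw q y # x # w)"
  using relD[of n f "[]"] by simp

lemma rel_Cons: "rel (Suc n) f \<Longrightarrow> a \<in> G \<Longrightarrow> rel n (\<lambda>w. f (a # w))"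
  unfolding rel_def
  by (metis Suc_le_mono add_Suc append_Cons insert_subset length_Cons list.simps(15))

text \<open>
  The derivation along \<open>z\<close> maps a relation to a combination of relations; where it hits the two
  letters of the relation this is again the Jacobi identity.
\<close>

lemma derv_rel_hd:
  assumes "z \<in> P p" "x \<in> P q" "y \<in> G" "multilinear f" "rel n f" "set w \<subseteq> G" "length w + 2 \<le> n"
  shows "derv p z f (x # y # w) = derv p z f (br y x # w) + derv p z f (tw q y # x # w)"
proof -
  let ?s = "ksign p q"
  have [simp]: "z \<in> G" "x \<in> G" "y \<in> G" using assms P_G by auto
  have s2: "?s * ?s = 1" by (cases p; cases q) auto
  have sqp: "ksign q p = ?s" by (cases p; cases q) auto
  have bxz: "br x z \<in> P (p + q)" using bracket_part[OF assms(2,1)] by (simp add: add.commute)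
  have twx: "tw p x = sc ?s x" using assms(2) by (simp add: tw_hom)
  have tyz: "tw q (br y z) = sc ?s (br (tw q y) z)"
    using assms by (simp add: tw_br tw_hom[of z p] bracket_scale_right sqp)
  have a: "f (br x z # y # w) = f (br y (br x z) # w) + f (tw (p + q) y # br x z # w)"
    using relD_hd[OF assms(5,6) bxz] assms by simp
  have b: "f (tw p x # br y z # w) = ?s * f (br (br y z) x # w) + f (br (tw q y) z # x # w)"
  proof -
    have "f (tw p x # br y z # w) = ?s * f (x # br y z # w)"
      using assms by (simp add: twx multilinear_scale_hd br_G)
    also have "f (x # br y z # w) = f (br (br y z) x # w) + ?s * f (br (tw q y) z # x # w)"
      using relD_hd[OF assms(5,6,2), of "br y z"] assms by (simp add: br_G tyz multilinear_scale_hd)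
    finally show ?thesis using s2 by (simp add: algebra_simps flip: mult.assoc)
  qed
  have c: "derv p z (\<lambda>w'. f (tw p x # tw p y # w')) w =
      derv p z (\<lambda>w'. f (tw p (br y x) # w')) w + derv p z (\<lambda>w'. f (tw p (tw q y) # tw p x # w')) w"
  proof -
    have "derv p z (\<lambda>w'. f (tw p x # tw p y # w')) w =
      derv p z (\<lambda>w'. f (tw p (br y x) # w') + f (tw p (tw q y) # tw p x # w')) w"
    proof (rule derv_cong)
      fix w' assume "set w' \<subseteq> G" "length w' = length w"
      then show "f (tw p x # tw p y # w') = f (tw p (br y x) # w') + f (tw p (tw q y) # tw p x # w')"
        using relD_hd[OF assms(5) _ tw_P[OF assms(2)], of w' "tw p y" p] assms(7)
        by (simp add: tw_br tw_tw add.commute)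
    qed (use assms in auto)
    then show ?thesis by (simp add: derv_fadd)
  qed
  have d: "f (br (br y x) z # w) = f (br y (br x z) # w) + ?s * f (br (br y z) x # w)"
    using right_jacobi[of y x q z p] assms
    by (simp add: multilinear_add_hd multilinear_scale_hd br_G G_scale sqp)
  show ?thesis
    using a b c d by (simp add: tw_tw add.commute)
qed

lemma rel_derv:
  assumes "z \<in> P p" "multilinear f" "rel n f"
  shows "rel n (derv p z f)"
  unfolding rel_def
proof (intro allI impI)
  fix u w q x y
  assume "set u \<subseteq> G" "set w \<subseteq> G" "x \<in> P q" "y \<in> G" "length u + length w + 2 \<le> n"
  then show "derv p z f (u @ x # y # w) = derv p z f (u @ br y x # w) + derv p z f (u @ tw q y # x # w)"
    using assms(2,3)
  proof (induction u arbitrary: f n)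
    case Nil
    then show ?case using derv_rel_hd[OF assms(1)] by simp
  next
    case (Cons a u)
    then obtain n' where n': "n = Suc n'" by (cases n) auto
    have z: "z \<in> G" using assms P_G by auto
    have "f ((br a z # u) @ x # y # w) = f ((br a z # u) @ br y x # w) + f ((br a z # u) @ tw q y # x # w)"
      using Cons.prems z by (intro relD[OF Cons.prems(7)]) (auto intro: br_G)
    moreover have "derv p z (\<lambda>w. f (tw p a # w)) (u @ x # y # w) =
       derv p z (\<lambda>w. f (tw p a # w)) (u @ br y x # w) + derv p z (\<lambda>w. f (tw p a # w)) (u @ tw q y # x # w)"
      using Cons.prems n' by (intro Cons.IH[of n']) (auto intro: multilinear_Cons rel_Cons)
    ultimately show ?case by simp
  qed
qed

end

section \<open>A Whittaker functional\<close>

text \<open>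
  The situation of a decomposition $\mathfrak g = \mathfrak b \oplus \mathbb C\Theta \oplus \mathfrak m$.
  The map \<open>\<beta>\<close> is the projection to \<open>b\<close> and \<open>\<theta>\<close> is the coefficient of \<open>\<Theta>\<close>. The character of
  \<open>m\<close> is called \<open>\<xi>\<close> here.
\<close>

locale split_lie_super = lie_super +
  fixes b m :: "'a set" and \<Theta> :: 'a and \<xi> :: "'a \<Rightarrow> complex"
    and \<beta> :: "'a \<Rightarrow> 'a" and \<theta> :: "'a \<Rightarrow> complex"
  assumes subspace_b: "subspace b" and b_G: "b \<subseteq> G"
    and subspace_m: "subspace m" and m_G: "m \<subseteq> G"
    and b_bracket: "x \<in> b \<Longrightarrow> y \<in> b \<Longrightarrow> br x y \<in> b"
    and m_bracket: "x \<in> m \<Longrightarrow> y \<in> m \<Longrightarrow> br x y \<in> m \<and> \<xi> (br x y) = 0"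
    and Theta_odd: "\<Theta> \<in> P 1"
    and Theta_m: "x \<in> m \<Longrightarrow> br \<Theta> x \<in> m \<and> \<xi> (br \<Theta> x) = 0"
    and Theta_Theta: "br \<Theta> \<Theta> \<in> m" "\<xi> (br \<Theta> \<Theta>) = 1"
    and xi_add: "x \<in> m \<Longrightarrow> y \<in> m \<Longrightarrow> \<xi> (x + y) = \<xi> x + \<xi> y"
    and xi_scale: "x \<in> m \<Longrightarrow> \<xi> (sc c x) = c * \<xi> x"
    and xi_odd: "x \<in> m \<Longrightarrow> x \<in> P 1 \<Longrightarrow> \<xi> x = 0"
    and beta_add: "x \<in> G \<Longrightarrow> y \<in> G \<Longrightarrow> \<beta> (x + y) = \<beta> x + \<beta> y"
    and beta_scale: "x \<in> G \<Longrightarrow> \<beta> (sc c x) = sc c (\<beta> x)"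
    and beta_part: "x \<in> P p \<Longrightarrow> \<beta> x \<in> P p"
    and beta_b: "x \<in> G \<Longrightarrow> \<beta> x \<in> b"
    and beta_on_b: "x \<in> b \<Longrightarrow> \<beta> x = x"
    and beta_on_m: "x \<in> m \<Longrightarrow> \<beta> x = 0"
    and beta_Theta: "\<beta> \<Theta> = 0"
    and theta_add: "x \<in> G \<Longrightarrow> y \<in> G \<Longrightarrow> \<theta> (x + y) = \<theta> x + \<theta> y"
    and theta_scale: "x \<in> G \<Longrightarrow> \<theta> (sc c x) = c * \<theta> x"
    and theta_even: "x \<in> P 0 \<Longrightarrow> \<theta> x = 0"
    and theta_on_b: "x \<in> b \<Longrightarrow> \<theta> x = 0"
    and theta_on_m: "x \<in> m \<Longrightarrow> \<theta> x = 0"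
    and theta_Theta: "\<theta> \<Theta> = 1"
    and decomposition: "x \<in> G \<Longrightarrow> x - \<beta> x - sc (\<theta> x) \<Theta> \<in> m"
begin

definition \<mu> :: "'a \<Rightarrow> 'a" where "\<mu> x = x - \<beta> x - sc (\<theta> x) \<Theta>"

lemma mu_m: "x \<in> G \<Longrightarrow> \<mu> x \<in> m"
  by (simp add: \<mu>_def decomposition)

lemma split: "x = \<beta> x + sc (\<theta> x) \<Theta> + \<mu> x"
  by (simp add: \<mu>_def)

lemma Theta_G [simp]: "\<Theta> \<in> G" using Theta_odd P_G by auto
lemma mG: "x \<in> m \<Longrightarrow> x \<in> G" using m_G by auto
lemma bG: "x \<in> b \<Longrightarrow> x \<in> G" using b_G by auto
lemma beta_G [simp]: "x \<in> G \<Longrightarrow> \<beta> x \<in> G" using beta_b bG by auto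

lemma mu_add: "x \<in> G \<Longrightarrow> y \<in> G \<Longrightarrow> \<mu> (x + y) = \<mu> x + \<mu> y"
  by (simp add: \<mu>_def beta_add theta_add scale_left_distrib)

lemma mu_scale: "x \<in> G \<Longrightarrow> \<mu> (sc c x) = sc c (\<mu> x)"
  by (simp add: \<mu>_def beta_scale theta_scale scale_right_diff_distrib)

lemma mu_on_m: "x \<in> m \<Longrightarrow> \<mu> x = x"
  by (simp add: \<mu>_def beta_on_m theta_on_m)

lemma mu_on_b: "x \<in> b \<Longrightarrow> \<mu> x = 0"
  by (simp add: \<mu>_def beta_on_b theta_on_b)

lemma mu_Theta: "\<mu> \<Theta> = 0"
  by (simp add: \<mu>_def beta_Theta theta_Theta)

lemma mu_part: assumes "x \<in> P p" shows "\<mu> x \<in> P p"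
  using assms unfolding \<mu>_def
  by (cases p) (auto intro!: P_diff P_scale beta_part Theta_odd simp: theta_even)

lemma xi_zero: "\<xi> 0 = 0"
  using xi_scale[of 0 0] subspace_0[OF subspace_m] by simp

lemma graded_m: assumes "x \<in> m" shows "pc p x \<in> m"
proof -
  have x: "x \<in> G" using assms mG by auto
  have "pc p x \<in> P p" "x - pc p x \<in> P (p + 1)"
    using pc_P[OF x] pc_exists[OF x, of p] pc_eqI by metis+
  then have "\<mu> (pc p x) \<in> P p" "\<mu> (x - pc p x) \<in> P (p + 1)" and g: "pc p x \<in> G" "x - pc p x \<in> G"
    using mu_part P_G by auto
  moreover have "x = \<mu> (pc p x) + \<mu> (x - pc p x)"
    using mu_add[OF g] mu_on_m[OF assms] by simp
  ultimately have "pc p x = \<mu> (pc p x)"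
    by (metis pc_eqI add_diff_cancel_left')
  then show ?thesis using mu_m g by metis
qed

lemma beta_pc: "x \<in> G \<Longrightarrow> pc p (\<beta> x) = \<beta> (pc p x)"
proof (rule pc_eqI)
  assume x: "x \<in> G"
  have *: "pc p x \<in> P p" "x - pc p x \<in> P (p + 1)"
    using pc_P[OF x] pc_exists[OF x, of p] pc_eqI by metis+
  then show "\<beta> (pc p x) \<in> P p" by (simp add: beta_part)
  have "\<beta> x - \<beta> (pc p x) = \<beta> (x - pc p x)"
    using beta_add[of "x - pc p x" "pc p x"] P_G[OF *(1)] P_G[OF *(2)] by (simp add: algebra_simps)
  then show "\<beta> x - \<beta> (pc p x) \<in> P (p + 1)" using * beta_part by simp
qed

lemma graded_b: assumes "x \<in> b" shows "pc p x \<in> b"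
proof -
  have x: "x \<in> G" using assms bG by auto
  have "pc p x = \<beta> (pc p x)" using beta_pc[OF x, of p] beta_on_b[OF assms] by simp
  then show ?thesis using beta_b P_G[OF pc_P[OF x]] by metis
qed

lemma tw_m: "x \<in> m \<Longrightarrow> tw p x \<in> m"
  using graded_m[of x 0] graded_m[of x 1] subspace_diff[OF subspace_m] by (auto simp: tw_def)

lemma xi_tw: assumes "x \<in> m" shows "\<xi> (tw p x) = \<xi> x"
proof -
  have x: "x \<in> G" using assms mG by auto
  have "tw p x = pc 0 x + sc (ksign p 1) (pc 1 x)"
    using pc_sum[OF x] by (cases p) (auto simp: tw_def)
  moreover have "\<xi> (pc 1 x) = 0" using xi_odd graded_m[OF assms] pc_P[OF x] by blast
  moreover have "\<xi> x = \<xi> (pc 0 x) + \<xi> (pc 1 x)"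
    using pc_sum[OF x] xi_add graded_m[OF assms] by metis
  ultimately show ?thesis
    using graded_m[OF assms] by (simp add: xi_add xi_scale subspace_scale[OF subspace_m])
qed

lemma m_Theta: assumes "x \<in> m" shows "br x \<Theta> \<in> m \<and> \<xi> (br x \<Theta>) = 0"
proof -
  have x: "x \<in> G" using assms mG by auto
  have *: "br (pc p x) \<Theta> \<in> m \<and> \<xi> (br (pc p x) \<Theta>) = 0" for p
    using bracket_super[OF pc_P[OF x] Theta_odd] Theta_m[OF graded_m[OF assms]]
    by (simp add: subspace_scale[OF subspace_m] xi_scale del: scale_minus_left)
  have "br x \<Theta> = br (pc 0 x) \<Theta> + br (pc 1 x) \<Theta>"
    using pc_sum[OF x] bracket_add_left[OF P_G[OF pc_P[OF x]] P_G[OF pc_P[OF x]] Theta_G] by metis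
  then show ?thesis
    using *[of 0] *[of 1] by (simp add: subspace_add[OF subspace_m] xi_add)
qed

text \<open>The value of \<open>\<rho>\<close> at \<open>\<Theta>\<close>, a square root of half of \<open>\<xi> (br \<Theta> \<Theta>)\<close>.\<close>

definition \<kappa> :: complex where "\<kappa> = complex_of_real (sqrt (1/2))"

lemma kappa_sq: "\<kappa> * \<kappa> = 1/2"
  unfolding \<kappa>_def by (simp flip: of_real_mult add: real_sqrt_mult_self)

definition \<rho> :: "'a \<Rightarrow> complex" where "\<rho> x = \<xi> (\<mu> x) + \<kappa> * \<theta> x"

lemma rho_add: "x \<in> G \<Longrightarrow> y \<in> G \<Longrightarrow> \<rho> (x + y) = \<rho> x + \<rho> y"
  by (simp add: \<rho>_def mu_add xi_add mu_m theta_add algebra_simps)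

lemma rho_scale: "x \<in> G \<Longrightarrow> \<rho> (sc c x) = c * \<rho> x"
  by (simp add: \<rho>_def mu_scale xi_scale mu_m theta_scale algebra_simps)

lemma rho_b: "x \<in> b \<Longrightarrow> \<rho> x = 0"
  by (simp add: \<rho>_def mu_on_b theta_on_b xi_zero)

lemma rho_m: "x \<in> m \<Longrightarrow> \<rho> x = \<xi> x"
  by (simp add: \<rho>_def mu_on_m theta_on_m)

lemma rho_Theta: "\<rho> \<Theta> = \<kappa>"
  by (simp add: \<rho>_def mu_Theta theta_Theta xi_zero)

text \<open>
  On $\mathbb C\Theta \oplus \mathfrak m$ the functional \<open>\<rho>\<close> is a representation on an ungraded line:
  supercommutators of even with arbitrary elements are killed, and for two odd elements the relation
  comes down to $2\kappa^2 = \chi([\Theta,\Theta])$.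
\<close>

lemma rho_bracket:
  assumes "x \<in> P q" "y \<in> P t" "\<beta> x = 0" "\<beta> y = 0"
  shows "\<rho> y * \<rho> x = \<rho> (br y x) + ksign q t * \<rho> y * \<rho> x" "\<beta> (br y x) = 0"
proof -
  have G: "x \<in> G" "y \<in> G" using assms P_G by auto
  let ?c = "\<theta> x" and ?d = "\<theta> y"
  have x: "x = sc ?c \<Theta> + \<mu> x" and y: "y = sc ?d \<Theta> + \<mu> y"
    using split[of x] split[of y] assms by simp_all
  have m: "\<mu> x \<in> m" "\<mu> y \<in> m" using G mu_m by auto
  then have mg: "\<mu> x \<in> G" "\<mu> y \<in> G" using mG by auto
  have "br y x = sc ?d (sc ?c (br \<Theta> \<Theta>)) + sc ?d (br \<Theta> (\<mu> x)) + (sc ?c (br (\<mu> y) \<Theta>) + br (\<mu> y) (\<mu> x))"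
    by (subst x, subst y)
      (simp add: bracket_add_left bracket_add_right bracket_scale_left bracket_scale_right
        G_scale G_add mg scale_right_distrib mult.commute)
  moreover have "sc ?d (sc ?c (br \<Theta> \<Theta>)) \<in> m" "sc ?d (br \<Theta> (\<mu> x)) \<in> m"
      "sc ?c (br (\<mu> y) \<Theta>) \<in> m" "br (\<mu> y) (\<mu> x) \<in> m"
    using m Theta_m m_Theta m_bracket Theta_Theta subspace_scale[OF subspace_m] by auto
  ultimately have inm: "br y x \<in> m" and chi: "\<xi> (br y x) = ?d * ?c"
    using m Theta_m m_Theta m_bracket Theta_Theta
    by (auto simp: subspace_add[OF subspace_m] subspace_scale[OF subspace_m] xi_add xi_scale)
  show "\<beta> (br y x) = 0" using inm by (rule beta_on_m)
  have rho0: "\<rho> z = \<xi> (\<mu> z)" if "z \<in> P 0" for z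
    using that by (simp add: \<rho>_def theta_even)
  have rho1: "\<rho> z = \<kappa> * \<theta> z" if "z \<in> P 1" for z
    using that mu_part[OF that] mu_m[OF P_G[OF that]] xi_odd by (simp add: \<rho>_def)
  show "\<rho> y * \<rho> x = \<rho> (br y x) + ksign q t * \<rho> y * \<rho> x"
  proof (cases "q = 1 \<and> t = 1")
    case True
    have "2 * (\<rho> y * \<rho> x) = ?d * ?c"
    proof -
      have "\<rho> y * \<rho> x = (\<kappa> * \<kappa>) * (?d * ?c)" using assms True by (simp add: rho1)
      then show ?thesis by (simp add: kappa_sq mult.commute)
    qed
    then show ?thesis using True by (simp add: rho_m[OF inm] chi algebra_simps)
  next
    case False
    then have "?d * ?c = 0" using assms theta_even by (cases q; cases t) auto
    then show ?thesis using False by (auto simp: rho_m[OF inm] chi ksign_def)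
  qed
qed

text \<open>
  The recursion of the induced module: the component of the last letter in
  $\mathbb C\Theta \oplus \mathfrak m$ is evaluated by \<open>\<rho>\<close>, the one in \<open>b\<close> is pulled to the front. As
  the recursive calls are hidden in \<open>derv\<close>, the length of the word is made an argument; on words of
  a different length the value is zero, which keeps \<open>Psi n\<close> multilinear.
\<close>

primrec Psi :: "nat \<Rightarrow> 'a list \<Rightarrow> complex" where
  "Psi 0 = (\<lambda>w. if w = [] then 1 else 0)"
| "Psi (Suc n) = (\<lambda>w. case w of [] \<Rightarrow> 0 | z # w' \<Rightarrow>
     \<rho> z * Psi n w' + derv 0 (\<beta> (pc 0 z)) (Psi n) w' + derv 1 (\<beta> (pc 1 z)) (Psi n) w')"

definition psi :: "'a list \<Rightarrow> complex" where "psi w = Psi (length w) w"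

lemma pcG [simp]: "x \<in> G \<Longrightarrow> pc p x \<in> G" using pc_P P_G by blast

lemma psi_Nil: "psi [] = 1" by (simp add: psi_def)

lemma psi_Cons:
  assumes "set w \<subseteq> G" "z \<in> G"
  shows "psi (z # w) = \<rho> z * psi w + derv 0 (\<beta> (pc 0 z)) psi w + derv 1 (\<beta> (pc 1 z)) psi w"
proof -
  have "derv p (\<beta> (pc p z)) (Psi (length w)) w = derv p (\<beta> (pc p z)) psi w" for p
    using assms by (intro derv_cong) (auto simp: psi_def)
  then show ?thesis by (simp add: psi_def)
qed

lemma multilinear_Psi: "multilinear (Psi n)"
proof (induction n)
  case 0 show ?case by (simp add: multilinear_def)
next
  case (Suc n)
  have D: "multilinear (derv p (\<beta> (pc p z)) (Psi n))" if "z \<in> G" for p z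
    using that by (intro multilinear_derv Suc) auto
  show ?case
    unfolding multilinear_def
  proof (intro allI impI conjI ballI)
    fix u w x y
    assume G: "set u \<subseteq> G" "set w \<subseteq> G" "x \<in> G" "y \<in> G"
    show "Psi (Suc n) (u @ (x + y) # w) = Psi (Suc n) (u @ x # w) + Psi (Suc n) (u @ y # w)"
    proof (cases u)
      case Nil
      have "derv p (\<beta> (pc p (x + y))) (Psi n) w =
          derv p (\<beta> (pc p x)) (Psi n) w + derv p (\<beta> (pc p y)) (Psi n) w" for p
        using G Suc by (simp add: pc_add beta_add derv_xadd)
      then show ?thesis using Nil G by (simp add: rho_add algebra_simps)
    next
      case (Cons a u')
      then show ?thesis using G multilinear_add[OF Suc, of u' w x y] multilinear_add[OF D[of a 0], of u' w x y] multilinear_add[OF D[of a 1], of u' w x y]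
        by (simp add: algebra_simps)
    qed
  next
    fix u w x c
    assume G: "set u \<subseteq> G" "set w \<subseteq> G" "x \<in> G"
    show "Psi (Suc n) (u @ sc c x # w) = c * Psi (Suc n) (u @ x # w)"
    proof (cases u)
      case Nil
      have "derv p (\<beta> (pc p (sc c x))) (Psi n) w = c * derv p (\<beta> (pc p x)) (Psi n) w" for p
        using G Suc by (simp add: pc_scale beta_scale derv_xscale)
      then show ?thesis using Nil G by (simp add: rho_scale algebra_simps)
    next
      case (Cons a u')
      then show ?thesis using G multilinear_scale[OF Suc, of u' w x c] multilinear_scale[OF D[of a 0], of u' w x c] multilinear_scale[OF D[of a 1], of u' w x c]
        by (simp add: algebra_simps)
    qed
  qed
qed

lemma multilinear_psi: "multilinear psi"
  unfolding multilinear_def psi_def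
  by (auto simp: multilinear_add[OF multilinear_Psi] multilinear_scale[OF multilinear_Psi] simp del: Psi.simps)

lemma psi_Cons_hom:
  assumes "set w \<subseteq> G" "z \<in> P p"
  shows "psi (z # w) = \<rho> z * psi w + derv p (\<beta> z) psi w"
proof -
  have [simp]: "\<beta> 0 = 0" using beta_on_m subspace_0[OF subspace_m] by simp
  show ?thesis
    using psi_Cons[OF assms(1) P_G[OF assms(2)]] assms derv_xzero[OF multilinear_psi assms(1)]
    by (cases p) (auto simp: pc_hom)
qed

lemma psi_b: "set w \<subseteq> G \<Longrightarrow> z \<in> P p \<Longrightarrow> z \<in> b \<Longrightarrow> psi (z # w) = derv p z psi w"
  by (simp add: psi_Cons_hom rho_b beta_on_b)

lemma psi_n: "set w \<subseteq> G \<Longrightarrow> z \<in> P p \<Longrightarrow> \<beta> z = 0 \<Longrightarrow> psi (z # w) = \<rho> z * psi w"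
  by (simp add: psi_Cons_hom derv_xzero multilinear_psi)

lemma psi_m: assumes "set w \<subseteq> G" "z \<in> m" shows "psi (z # w) = \<xi> z * psi w"
proof -
  have z: "z \<in> G" using assms mG by auto
  have "\<beta> (pc p z) = 0" for p using beta_on_m graded_m[OF assms(2)] by simp
  then show ?thesis using psi_Cons[OF assms(1) z] derv_xzero[OF multilinear_psi assms(1)] rho_m[OF assms(2)] by simp
qed

lemma psi_Theta: "set w \<subseteq> G \<Longrightarrow> psi (\<Theta> # w) = \<kappa> * psi w"
  using psi_n[OF _ Theta_odd beta_Theta] by (simp add: rho_Theta)

text \<open>
  The only case with content is that of two letters from \<open>b\<close>: it says that pulling to the front is a
  representation. If one letter is from \<open>b\<close> and the other from the complement, the definition of
  \<open>psi\<close> is the relation itself, and if none is from \<open>b\<close>, it is the relation for \<open>\<rho>\<close>.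
\<close>

lemma psi_rel_hd_hom:
  assumes "set w \<subseteq> G" "x \<in> P q" "y \<in> P t" and x: "x \<in> b \<or> \<beta> x = 0" and y: "y \<in> b \<or> \<beta> y = 0"
  shows "psi (x # y # w) = psi (br y x # w) + psi (tw q y # x # w)"
proof -
  let ?s = "ksign q t"
  have G [simp]: "x \<in> G" "y \<in> G" using assms P_G by auto
  have s2: "?s * ?s = 1" by (cases q; cases t) auto
  have stq: "ksign t q = ?s" by (cases q; cases t) auto
  have tw: "psi (tw q y # v) = ?s * psi (y # v)" if "set v \<subseteq> G" for v
    using that assms by (simp add: tw_hom multilinear_scale_hd[OF multilinear_psi])
  have twx: "psi (tw t x # v) = ?s * psi (x # v)" if "set v \<subseteq> G" for v
    using that assms by (simp add: tw_hom stq multilinear_scale_hd[OF multilinear_psi])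
  have byx: "br y x \<in> P (t + q)" using assms bracket_part by auto
  consider "x \<in> b" "y \<in> b" | "x \<in> b" "\<beta> y = 0" | "\<beta> x = 0" "y \<in> b" | "\<beta> x = 0" "\<beta> y = 0"
    using x y by blast
  then show ?thesis
  proof cases
    case 1
    have D: "derv q x (\<lambda>v. psi (tw q y # v)) w = ?s * derv q x (derv t y psi) w"
    proof -
      have "derv q x (\<lambda>v. psi (tw q y # v)) w = derv q x (\<lambda>v. ?s * derv t y psi v) w"
        using assms 1 by (intro derv_cong) (auto simp: tw psi_b)
      then show ?thesis by (simp add: derv_fscale)
    qed
    have D': "derv t y (\<lambda>v. psi (tw t x # v)) w = ?s * derv t y (derv q x psi) w"
    proof -
      have "derv t y (\<lambda>v. psi (tw t x # v)) w = derv t y (\<lambda>v. ?s * derv q x psi v) w"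
        using assms 1 by (intro derv_cong) (auto simp: twx psi_b)
      then show ?thesis by (simp add: derv_fscale)
    qed
    have D'': "psi (br x y # w) = derv (q + t) (br x y) psi w"
      using psi_b[OF assms(1) bracket_part[OF assms(2,3)] b_bracket[OF 1]] .
    show ?thesis
      using s2 derv_bracket[OF assms(2,3) multilinear_psi assms(1)]
      using psi_b[OF _ assms(2) 1(1), of "y # w"] psi_b[OF _ assms(3) 1(2), of "x # w"] assms(1)
      by (simp add: tw D D' D'' distrib_left)
  next
    case 2
    have "derv q x (\<lambda>v. psi (tw q y # v)) w = derv q x (\<lambda>v. ?s * \<rho> y * psi v) w"
      using assms 2 by (intro derv_cong) (auto simp: tw psi_n)
    then show ?thesis
      using assms 2 by (simp add: psi_b[of _ x q] psi_n[of _ y t] tw derv_fscale)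
  next
    case 3
    have "derv t y (\<lambda>v. psi (tw t x # v)) w = derv t y (\<lambda>v. ?s * \<rho> x * psi v) w"
      using assms 3 by (intro derv_cong) (auto simp: twx psi_n)
    then have yx: "psi (y # x # w) = psi (br x y # w) + ?s * (\<rho> x * derv t y psi w)"
      using assms 3 by (simp add: psi_b[of _ y t] psi_n[of _ x q] derv_fscale)
    have "psi (br x y # w) = - ?s * psi (br y x # w)"
      using assms bracket_super[OF assms(2,3)] multilinear_scale_hd[OF multilinear_psi, of w "br y x" "- ?s"]
      by (simp add: br_G)
    then show ?thesis
      using assms 3 yx s2 by (simp add: psi_b[of _ y t] psi_n[of _ x q] tw algebra_simps flip: mult.assoc)
  next
    case 4
    have "psi (br y x # w) = \<rho> (br y x) * psi w"
      using assms 4 rho_bracket(2)[OF assms(2,3)] byx by (intro psi_n) auto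
    moreover have "psi (x # y # w) = \<rho> x * (\<rho> y * psi w)"
      using assms 4 psi_n by auto
    moreover have "psi (tw q y # x # w) = ?s * (\<rho> y * (\<rho> x * psi w))"
      using assms 4 psi_n by (auto simp: tw)
    moreover have "\<rho> x * (\<rho> y * psi w) = (\<rho> y * \<rho> x) * psi w" by simp
    ultimately show ?thesis
      using rho_bracket(1)[OF assms(2,3) 4]
      by (metis (no_types, lifting) distrib_right mult.assoc)
  qed
qed

text \<open>
  Both sides are bilinear in the two letters, which are split into their components in \<open>b\<close> and in
  the complement.
\<close>

lemma psi_rel_hd:
  assumes "set w \<subseteq> G" "x \<in> P q" "y \<in> G"
  shows "psi (x # y # w) = psi (br y x # w) + psi (tw q y # x # w)"
  using assms(3)
proof (induction y rule: G_hom_induct)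
  case (hom t y)
  let ?x' = "x - \<beta> x" and ?y' = "y - \<beta> y"
  have xG: "x \<in> G" and yG: "y \<in> G" using assms hom P_G by auto
  have comp: "\<beta> z \<in> P p" "z - \<beta> z \<in> P p" "\<beta> z \<in> b" "\<beta> (z - \<beta> z) = 0" if "z \<in> P p" for z p
  proof -
    have z: "z \<in> G" using that P_G by auto
    show "\<beta> z \<in> P p" "z - \<beta> z \<in> P p" "\<beta> z \<in> b" using that beta_part P_diff beta_b z by auto
    show "\<beta> (z - \<beta> z) = 0"
      using beta_add[of "z - \<beta> z" "\<beta> z"] z G_diff beta_on_b[OF beta_b[OF z]] by simp
  qed
  have rel: "psi (x1 # y1 # w) = psi (br y1 x1 # w) + psi (tw q y1 # x1 # w)"
    if "x1 \<in> {\<beta> x, ?x'}" "y1 \<in> {\<beta> y, ?y'}" for x1 y1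
    using that comp[OF assms(2)] comp[OF hom] assms(1)
    by (intro psi_rel_hd_hom[where t = t]) auto
  have rely: "psi (x # y1 # w) = psi (br y1 x # w) + psi (tw q y1 # x # w)" if y1: "y1 \<in> {\<beta> y, ?y'}" for y1
  proof -
    have G: "\<beta> x \<in> G" "?x' \<in> G" "y1 \<in> G" using xG yG that G_diff by auto
    have "psi ((x1 + x2) # y1 # w) = psi (br y1 (x1 + x2) # w) + psi (tw q y1 # (x1 + x2) # w)"
      if "x1 \<in> {\<beta> x, ?x'}" "x2 \<in> {\<beta> x, ?x'}" for x1 x2
    proof -
      have "x1 \<in> G" "x2 \<in> G" using that G by auto
      then show ?thesis
        using rel[OF that(1) y1] rel[OF that(2) y1] G assms(1) multilinear_psi
        by (simp add: multilinear_add_hd multilinear_add_hd2 bracket_add_right br_G)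
    qed
    from this[of "\<beta> x" ?x'] show ?thesis by simp
  qed
  have G: "\<beta> y \<in> G" "?y' \<in> G" using xG yG G_diff by auto
  have "psi (x # (y1 + y2) # w) = psi (br (y1 + y2) x # w) + psi (tw q (y1 + y2) # x # w)"
    if "y1 \<in> {\<beta> y, ?y'}" "y2 \<in> {\<beta> y, ?y'}" for y1 y2
  proof -
    have "y1 \<in> G" "y2 \<in> G" using that G by auto
    then show ?thesis
      using rely[OF that(1)] rely[OF that(2)] xG assms(1) multilinear_psi
      by (simp add: multilinear_add_hd multilinear_add_hd2 bracket_add_left br_G tw_add)
  qed
  from this[of "\<beta> y" ?y'] show ?case by simp
next
  case (add y y')
  moreover have "x \<in> G" using assms P_G by auto
  ultimately show ?case using assms(1) multilinear_psi
    by (simp add: multilinear_add_hd multilinear_add_hd2 bracket_add_left br_G tw_add)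
qed

text \<open>
  A relation behind the last letter is handled by induction, since both terms of the recursion
  respect relations in shorter words.
\<close>

lemma rel_psi: "rel n psi"
proof (induction n)
  case 0 show ?case by (simp add: rel_def)
next
  case (Suc n)
  show ?case unfolding rel_def
  proof (intro allI impI)
    fix u w q x y
    assume A: "set u \<subseteq> G" "set w \<subseteq> G" "x \<in> P q" "y \<in> G" "length u + length w + 2 \<le> Suc n"
    have xG: "x \<in> G" using A P_G by auto
    show "psi (u @ x # y # w) = psi (u @ br y x # w) + psi (u @ tw q y # x # w)"
    proof (cases u)
      case Nil then show ?thesis using psi_rel_hd[OF A(2,3,4)] by simp
    next
      case (Cons z u')
      have "rel n (derv p (\<beta> (pc p z)) psi)" for p
        using A Cons by (intro rel_derv[OF _ multilinear_psi Suc]) (simp add: beta_part pc_P)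
      note D = relD[OF this, of u' w x q y]
      show ?thesis
        using Cons A xG D[of 0] D[of 1] relD[OF Suc, of u' w x q y]
        by (simp add: psi_Cons br_G algebra_simps)
    qed
  qed
qed

lemma derv_first_b:
  assumes "z \<in> b" "\<And>u x. set u \<subseteq> G \<Longrightarrow> x \<in> b \<Longrightarrow> length u = length w \<Longrightarrow> f (u @ [x]) = 0"
    "set w \<subseteq> G" "x \<in> b"
  shows "derv p z f (w @ [x]) = 0"
  using assms(2-)
proof (induction w arbitrary: f)
  case Nil
  then show ?case using b_bracket[OF _ assms(1), of x] Nil(1)[of "[]" "br x z"] by simp
next
  case (Cons a w)
  have "derv p z (\<lambda>w'. f (tw p a # w')) (w @ [x]) = 0"
    using Cons.prems Cons.prems(1)[of "tw p a # u" for u] by (intro Cons.IH) auto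
  moreover have "f ((br a z # w) @ [x]) = 0"
    using Cons.prems assms(1) by (intro Cons.prems(1)) (auto intro: br_G bG)
  ultimately show ?case by simp
qed

text \<open>
  A first letter from \<open>b\<close> stays one when another letter from \<open>b\<close> is pulled past it, because \<open>b\<close> is
  a subalgebra.
\<close>

lemma psi_first_b: "set w \<subseteq> G \<Longrightarrow> x \<in> b \<Longrightarrow> psi (w @ [x]) = 0"
proof (induction "length w" arbitrary: w x)
  case 0
  then show ?case using psi_Cons[of "[]" x] bG rho_b by simp
next
  case (Suc n)
  then obtain z w' where w: "w = z # w'" by (cases w) auto
  have "derv p (\<beta> (pc p z)) psi (w' @ [x]) = 0" for p
    using Suc w by (intro derv_first_b) (auto intro: beta_b)
  then show ?case using Suc w psi_Cons[of "w' @ [x]" z] bG by simp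
qed

end

section \<open>The enveloping algebra\<close>

abbreviation wd :: "'a list \<Rightarrow> ('a list \<Rightarrow>\<^sub>0 complex)" where
  "wd w \<equiv> Poly_Mapping.single w 1"

lemma wd_mult: "wd u * wd v = wd (u @ v)"
  by (simp add: mult_single plus_list_def)

lemma one_wd: "1 = wd []"
  by (simp add: zero_list_def flip: single_one)

lemma gen_wd: "gen x = wd [x]"
  by (simp add: gen_def)

lemma fscale_wd: "Poly_Mapping.single w c = fscale c (wd w)"
  by simp

context lie_super
begin

abbreviation "FA \<equiv> free_alg L"
abbreviation "I \<equiv> uea_ideal L"

lemma FA_iff: "a \<in> FA \<longleftrightarrow> Poly_Mapping.keys a \<subseteq> {w. set w \<subseteq> G}"
  by (auto simp: free_alg_def in_lists_conv_set)

lemma FA_add: "a \<in> FA \<Longrightarrow> c \<in> FA \<Longrightarrow> a + c \<in> FA"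
  using keys_add[of a c] by (auto simp: FA_iff)

lemma FA_zero [simp]: "0 \<in> FA" by (simp add: FA_iff)

lemma FA_fscale: "a \<in> FA \<Longrightarrow> fscale c a \<in> FA"
  using keys_fscale[of c a] by (auto simp: FA_iff)

lemma subspace_FA: "fs.subspace FA"
  by (intro fs.subspaceI FA_add FA_fscale FA_zero)

lemma FA_diff: "a \<in> FA \<Longrightarrow> c \<in> FA \<Longrightarrow> a - c \<in> FA"
  by (rule fs.subspace_diff[OF subspace_FA])

lemma FA_wd [simp]: "wd w \<in> FA \<longleftrightarrow> set w \<subseteq> G"
  by (simp add: FA_iff)

lemma FA_gen [simp]: "gen x \<in> FA \<longleftrightarrow> x \<in> G"
  by (simp add: gen_wd)

lemma FA_one [simp]: "1 \<in> FA" by (simp add: one_wd)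

lemma FA_induct [consumes 1, case_names zero add scale word]:
  assumes "a \<in> FA" "Q 0" "\<And>a c. Q a \<Longrightarrow> Q c \<Longrightarrow> Q (a + c)" "\<And>c a. Q a \<Longrightarrow> Q (fscale c a)"
    "\<And>w. set w \<subseteq> G \<Longrightarrow> Q (wd w)"
  shows "Q a"
proof -
  have "Poly_Mapping.keys a \<subseteq> {w. set w \<subseteq> G}" using assms(1) by (simp add: FA_iff)
  then show ?thesis
  proof (induction a rule: keys_induct)
    case (single k c) then show ?case using assms(4)[OF assms(5), of k c] by simp
  qed (use assms in auto)
qed

lemma FA_mult: assumes "a \<in> FA" "c \<in> FA" shows "a * c \<in> FA"
  using assms(1)
proof (induction a rule: FA_induct)
  case (word w)
  show ?case using assms(2)
  proof (induction c rule: FA_induct)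
    case (word v) then show ?case using \<open>set w \<subseteq> G\<close> by (simp add: wd_mult)
  qed (auto simp: algebra_simps fscale_mult_right FA_add FA_fscale)
qed (auto simp: algebra_simps fscale_mult_left FA_add FA_fscale)

lemma rel_FA: assumes "r \<in> uea_relations L" shows "r \<in> FA"
  using assms unfolding uea_relations_def
  by (auto intro!: FA_diff FA_fscale FA_mult G_add G_scale br_G intro: P_G)

lemma subspace_I: "fs.subspace I"
  by (simp add: uea_ideal_def fs.subspace_span)

lemma I_gen: "a \<in> FA \<Longrightarrow> r \<in> uea_relations L \<Longrightarrow> c \<in> FA \<Longrightarrow> a * r * c \<in> I"
  unfolding uea_ideal_def by (intro fs.span_base) auto

lemma I_FA: "I \<subseteq> FA"
  unfolding uea_ideal_def
  by (intro fs.span_minimal subspace_FA) (auto intro: FA_mult rel_FA)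

lemma I_zero: "0 \<in> I" and I_add: "a \<in> I \<Longrightarrow> c \<in> I \<Longrightarrow> a + c \<in> I"
  and I_fscale: "a \<in> I \<Longrightarrow> fscale d a \<in> I" and I_diff: "a \<in> I \<Longrightarrow> c \<in> I \<Longrightarrow> a - c \<in> I"
  using subspace_I by (auto intro: fs.subspace_0 fs.subspace_add fs.subspace_scale fs.subspace_diff)

lemma I_left: assumes "a \<in> FA" "i \<in> I" shows "a * i \<in> I"
  using assms(2) unfolding uea_ideal_def
proof (induction i rule: fs.span_induct_alt)
  case base then show ?case using I_zero by (simp add: uea_ideal_def)
next
  case (step c x y)
  then obtain a' r b' where x: "x = a' * r * b'" "a' \<in> FA" "r \<in> uea_relations L" "b' \<in> FA" by auto
  then have "(a * a') * r * b' \<in> I" using assms FA_mult I_gen by blast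
  then show ?case using step(2) x I_add[OF I_fscale, of "a * a' * r * b'" "a * y" c]
    by (simp add: algebra_simps fscale_mult_right uea_ideal_def)
qed

lemma I_right: assumes "a \<in> FA" "i \<in> I" shows "i * a \<in> I"
  using assms(2) unfolding uea_ideal_def
proof (induction i rule: fs.span_induct_alt)
  case base then show ?case using I_zero by (simp add: uea_ideal_def)
next
  case (step c x y)
  then obtain a' r b' where x: "x = a' * r * b'" "a' \<in> FA" "r \<in> uea_relations L" "b' \<in> FA" by auto
  then have "a' * r * (b' * a) \<in> I" using assms FA_mult I_gen by blast
  then show ?case using step(2) x I_add[OF I_fscale, of "a' * r * (b' * a)" "y * a" c]
    by (simp add: algebra_simps fscale_mult_left uea_ideal_def)
qed

lemma I_word:
  assumes "set u \<subseteq> G" "set w \<subseteq> G" "r \<in> uea_relations L"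
  shows "wd u * r * wd w \<in> I"
  using assms by (intro I_gen) auto

lemma word_add:
  assumes "set u \<subseteq> G" "set w \<subseteq> G" "x \<in> G" "y \<in> G"
  shows "wd (u @ (x + y) # w) - wd (u @ x # w) - wd (u @ y # w) \<in> I"
proof -
  have "gen (x + y) - gen x - gen y \<in> uea_relations L"
    using assms unfolding uea_relations_def by blast
  from I_word[OF assms(1,2) this] show ?thesis
    by (simp add: algebra_simps gen_wd wd_mult)
qed

lemma word_scale:
  assumes "set u \<subseteq> G" "set w \<subseteq> G" "x \<in> G"
  shows "wd (u @ sc c x # w) - fscale c (wd (u @ x # w)) \<in> I"
proof -
  have "gen (sc c x) - fscale c (gen x) \<in> uea_relations L"
    using assms unfolding uea_relations_def by blast
  from I_word[OF assms(1,2) this] show ?thesis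
    by (simp add: algebra_simps gen_wd wd_mult fscale_mult_left fscale_mult_right del: fscale_single)
qed

lemma word_swap_hom:
  assumes "set u \<subseteq> G" "set w \<subseteq> G" "x \<in> P p" "y \<in> P q"
  shows "wd (u @ x # y # w) - fscale (ksign p q) (wd (u @ y # x # w)) - wd (u @ br x y # w) \<in> I"
proof -
  have "gen x * gen y - fscale (ksign p q) (gen y * gen x) - gen (br x y) \<in> uea_relations L"
    using assms unfolding uea_relations_def by blast
  from I_word[OF assms(1,2) this] show ?thesis
    by (simp add: algebra_simps gen_wd wd_mult fscale_mult_left fscale_mult_right del: fscale_single)
qed

lemma word_swap:
  assumes "set u \<subseteq> G" "set w \<subseteq> G" "x \<in> P q" "y \<in> G"
  shows "wd (u @ y # x # w) - wd (u @ x # tw q y # w) - wd (u @ br y x # w) \<in> I"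
  using assms(4)
proof (induction y rule: G_hom_induct)
  case (hom p y)
  have s: "ksign q p = ksign p q" by (cases p; cases q) auto
  have "wd ((u @ [x]) @ tw q y # w) - fscale (ksign p q) (wd ((u @ [x]) @ y # w)) \<in> I"
    using assms hom P_G unfolding tw_hom[OF hom] s by (intro word_scale) auto
  from I_diff[OF word_swap_hom[OF assms(1,2) hom assms(3)] this] show ?case
    by (simp add: algebra_simps del: fscale_single)
next
  case (add y z)
  have xG: "x \<in> G" using assms P_G by auto
  have 1: "wd (u @ (y + z) # x # w) - wd (u @ y # x # w) - wd (u @ z # x # w) \<in> I"
    using assms add xG by (intro word_add) auto
  have 2: "wd ((u @ [x]) @ (tw q y + tw q z) # w) - wd ((u @ [x]) @ tw q y # w) - wd ((u @ [x]) @ tw q z # w) \<in> I"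
    using assms add xG by (intro word_add) auto
  have 3: "wd (u @ (br y x + br z x) # w) - wd (u @ br y x # w) - wd (u @ br z x # w) \<in> I"
    using assms add xG by (intro word_add) (auto intro: br_G)
  from I_diff[OF I_diff[OF I_add[OF I_add[OF add(3) add(4)] 1] 2] 3] show ?case
    using add xG by (simp add: tw_add bracket_add_left algebra_simps)
qed

text \<open>
  The passage from functionals on words to functionals on the enveloping algebra. The reversal
  accounts for the two ways of writing words.
\<close>

lemma fev_I:
  assumes "multilinear f" "\<And>n. rel n f" "a \<in> I"
  shows "fev (\<lambda>w. f (rev w)) a = 0"
proof (rule fev_vanish_span)
  show "a \<in> fspan {a * r * b |a r b. a \<in> FA \<and> r \<in> uea_relations L \<and> b \<in> FA}"
    using assms(3) by (simp add: uea_ideal_def)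
  fix z assume "z \<in> {a * r * b |a r b. a \<in> FA \<and> r \<in> uea_relations L \<and> b \<in> FA}"
  then obtain a r b where z: "z = a * r * b" "a \<in> FA" "r \<in> uea_relations L" "b \<in> FA" by auto
  have W: "fev (\<lambda>w. f (rev w)) (wd u * r * wd v) = 0" if uv: "set u \<subseteq> G" "set v \<subseteq> G" for u v
    using z(3) unfolding uea_relations_def
  proof (elim UnE CollectE exE conjE)
    fix x y assume r: "r = gen (x + y) - gen x - gen y" and "x \<in> G" "y \<in> G"
    then show ?thesis using uv multilinear_add[OF assms(1), of "rev v" "rev u" x y] unfolding r
      by (simp add: algebra_simps gen_wd wd_mult fev_diff fev_add)
  next
    fix x c assume r: "r = gen (sc c x) - fscale c (gen x)" and "x \<in> G"
    then show ?thesis using uv multilinear_scale[OF assms(1), of "rev v" "rev u" x c] unfolding r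
      by (simp add: algebra_simps gen_wd wd_mult fev_diff fscale_mult_left fscale_mult_right fev_fscale del: fscale_single)
  next
    fix x y p q assume r: "r = gen x * gen y - fscale (ksign p q) (gen y * gen x) - gen (br x y)"
      and xy: "x \<in> P p" "y \<in> P q"
    have s: "ksign q p = ksign p q" by (cases p; cases q) auto
    have G: "x \<in> G" "y \<in> G" using xy P_G by auto
    have "f (rev v @ y # x # rev u) = f (rev v @ br x y # rev u) + f (rev v @ tw q x # y # rev u)"
      using uv xy G by (intro relD[OF assms(2)]) auto
    moreover have "f (rev v @ tw q x # y # rev u) = ksign p q * f (rev v @ x # y # rev u)"
      using uv xy G by (simp add: tw_hom multilinear_scale[OF assms(1)] s)
    ultimately show ?thesis
      by (simp add: r algebra_simps gen_wd wd_mult fev_diff fev_add fscale_mult_left fscale_mult_right fev_fscale del: fscale_single)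
  qed
  have *: "fev (\<lambda>w. f (rev w)) (wd u * r * b) = 0" if "set u \<subseteq> G" for u
    using z(4) that W[of u]
    by (induction b rule: FA_induct) (auto simp: algebra_simps fev_add fscale_mult_right fev_fscale)
  show "fev (\<lambda>w. f (rev w)) z = 0" unfolding z(1)
    using z(2) *
    by (induction a rule: FA_induct) (auto simp: algebra_simps fev_add fscale_mult_left fev_fscale)
qed

subsection \<open>The parity automorphism\<close>

abbreviation "\<sigma> \<equiv> tw 1"

lemma sigma_list_G: "set w \<subseteq> G \<Longrightarrow> set (map \<sigma> w) \<subseteq> G"
  by auto

end

lemma fextend_map_mult: "fextend (map g) (a * b) = fextend (map g) a * fextend (map g) b"
proof -
  have *: "fextend (map g) (wd u * b) = wd (map g u) * fextend (map g) b" for u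
  proof -
    have "Poly_Mapping.keys b \<subseteq> UNIV" by simp
    then show ?thesis
      by (induction b rule: keys_induct)
        (auto simp: algebra_simps fextend_add mult_single plus_list_def)
  qed
  have "Poly_Mapping.keys a \<subseteq> UNIV" by simp
  then show ?thesis
  proof (induction a rule: keys_induct)
    case (single u c)
    have "Poly_Mapping.single u c * b = fscale c (wd u * b)"
      by (subst fscale_wd) (simp add: fscale_mult_left del: fscale_single)
    moreover have "Poly_Mapping.single (map g u) c * fextend (map g) b =
        fscale c (wd (map g u) * fextend (map g) b)"
      by (subst fscale_wd) (simp add: fscale_mult_left del: fscale_single)
    ultimately show ?case by (simp add: fextend_fscale *)
  qed (auto simp: algebra_simps fextend_add)
qed

context lie_super
begin

text \<open>
  The parity automorphism of the enveloping algebra, on the level of the free algebra. It is needed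
  to separate the even from the odd part of a quotient.
\<close>

definition Sg :: "('a list \<Rightarrow>\<^sub>0 complex) \<Rightarrow> ('a list \<Rightarrow>\<^sub>0 complex)" where
  "Sg = fextend (map \<sigma>)"

lemma Sg_simps: "Sg 0 = 0" "Sg (a + c) = Sg a + Sg c" "Sg (a - c) = Sg a - Sg c"
    "Sg (fscale d a) = fscale d (Sg a)" "Sg (a * c) = Sg a * Sg c" "Sg (wd w) = wd (map \<sigma> w)"
    "Sg (gen x) = gen (\<sigma> x)" "Sg 1 = 1"
  by (simp_all add: Sg_def fextend_add fextend_diff fextend_fscale fextend_map_mult gen_wd one_wd)

lemma Sg_FA: "a \<in> FA \<Longrightarrow> Sg a \<in> FA"
  by (induction a rule: FA_induct) (auto simp: Sg_simps FA_add FA_fscale)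

lemma Sg_rel: assumes "r \<in> uea_relations L" shows "Sg r \<in> uea_relations L"
  using assms unfolding uea_relations_def
proof (elim UnE CollectE exE conjE)
  fix x y assume "r = gen (x + y) - gen x - gen y" "x \<in> G" "y \<in> G"
  then have "Sg r = gen (\<sigma> x + \<sigma> y) - gen (\<sigma> x) - gen (\<sigma> y)" "\<sigma> x \<in> G" "\<sigma> y \<in> G"
    by (auto simp: Sg_simps tw_add)
  then show "Sg r \<in> {gen (x + y) - gen x - gen y |x y. x \<in> G \<and> y \<in> G} \<union>
          {gen (sc c x) - fscale c (gen x) |c x. x \<in> G} \<union>
          {gen x * gen y - fscale (ksign p q) (gen y * gen x) - gen (br x y) |x y p q. x \<in> P p \<and> y \<in> P q}"
    by blast
next
  fix c x assume "r = gen (sc c x) - fscale c (gen x)" "x \<in> G"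
  then have "Sg r = gen (sc c (\<sigma> x)) - fscale c (gen (\<sigma> x))" "\<sigma> x \<in> G"
    by (auto simp: Sg_simps tw_scale)
  then show "Sg r \<in> {gen (x + y) - gen x - gen y |x y. x \<in> G \<and> y \<in> G} \<union>
          {gen (sc c x) - fscale c (gen x) |c x. x \<in> G} \<union>
          {gen x * gen y - fscale (ksign p q) (gen y * gen x) - gen (br x y) |x y p q. x \<in> P p \<and> y \<in> P q}"
    by blast
next
  fix x y p q assume "r = gen x * gen y - fscale (ksign p q) (gen y * gen x) - gen (br x y)"
    "x \<in> P p" "y \<in> P q"
  then have "Sg r = gen (\<sigma> x) * gen (\<sigma> y) - fscale (ksign p q) (gen (\<sigma> y) * gen (\<sigma> x)) - gen (br (\<sigma> x) (\<sigma> y))"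
      "\<sigma> x \<in> P p" "\<sigma> y \<in> P q"
    by (auto simp: Sg_simps tw_br P_G tw_P)
  then show "Sg r \<in> {gen (x + y) - gen x - gen y |x y. x \<in> G \<and> y \<in> G} \<union>
          {gen (sc c x) - fscale c (gen x) |c x. x \<in> G} \<union>
          {gen x * gen y - fscale (ksign p q) (gen y * gen x) - gen (br x y) |x y p q. x \<in> P p \<and> y \<in> P q}"
    by blast
qed

lemma Sg_I: assumes "a \<in> I" shows "Sg a \<in> I"
  using assms unfolding uea_ideal_def
proof (induction a rule: fs.span_induct_alt)
  case base then show ?case using I_zero by (simp add: Sg_simps uea_ideal_def)
next
  case (step c x y)
  then obtain a r b where "x = a * r * b" "a \<in> FA" "r \<in> uea_relations L" "b \<in> FA" by auto
  then have "Sg x \<in> I" using Sg_FA Sg_rel I_gen by (simp add: Sg_simps)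
  then show ?case using step(2) by (simp add: Sg_simps I_add I_fscale flip: uea_ideal_def)
qed

lemma Sg_hom_word:
  assumes "list_all2 (\<lambda>x q. x \<in> P q) w ps"
  shows "set w \<subseteq> G \<and> wd (map \<sigma> w) - fscale (ksign 1 (sum_list ps)) (wd w) \<in> I"
  using assms
proof (induction w ps rule: list_all2_induct)
  case Nil then show ?case by (simp add: I_zero)
next
  case (Cons x w p ps)
  have G: "x \<in> G" "set w \<subseteq> G" using Cons P_G by auto
  have "wd [\<sigma> x] * (wd (map \<sigma> w) - fscale (ksign 1 (sum_list ps)) (wd w)) \<in> I"
    using Cons G by (intro I_left) auto
  moreover have "wd ([] @ \<sigma> x # w) - fscale (ksign 1 p) (wd ([] @ x # w)) \<in> I"
    using Cons G unfolding tw_hom[OF Cons(1)] by (intro word_scale) auto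
  ultimately have "wd (map \<sigma> (x # w)) - fscale (ksign 1 (sum_list ps)) (wd (\<sigma> x # w)) +
     fscale (ksign 1 (sum_list ps)) (wd (\<sigma> x # w) - fscale (ksign 1 p) (wd (x # w))) \<in> I"
    by (intro I_add I_fscale) (auto simp: algebra_simps wd_mult fscale_mult_right simp del: fscale_single)
  moreover have "ksign 1 (p + sum_list ps) = ksign 1 (sum_list ps) * ksign 1 p"
    by (cases p; cases "sum_list ps") auto
  ultimately show ?case using G
    by (simp add: algebra_simps fs.scale_right_diff_distrib del: fscale_single)
qed

lemma Sg_hom:
  assumes "a \<in> fspan (homogeneous_words L p)"
  shows "a \<in> FA \<and> Sg a - fscale (ksign 1 p) a \<in> I"
  using assms
proof (induction a rule: fs.span_induct_alt)
  case base then show ?case by (simp add: Sg_simps I_zero)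
next
  case (step c x y)
  then obtain w ps where "list_all2 (\<lambda>x q. x \<in> P q) w ps" "x = wd w" "sum_list ps = p"
    by (auto simp: homogeneous_words_def)
  then have "x \<in> FA" "Sg x - fscale (ksign 1 p) x \<in> I" using Sg_hom_word by (auto simp: Sg_simps)
  with step(2) have "fscale c (Sg x - fscale (ksign 1 p) x) + (Sg y - fscale (ksign 1 p) y) \<in> I"
    by (intro I_add I_fscale) auto
  moreover have "fscale c (fscale d x) = fscale d (fscale c x)" for d by (simp add: mult.commute)
  ultimately show ?case using step(2) \<open>x \<in> FA\<close>
    by (simp add: Sg_simps FA_add FA_fscale algebra_simps fs.scale_right_diff_distrib fs.scale_right_distrib
       del: fs.scale_scale)
qed

end

section \<open>The left ideal of the Whittaker module\<close>

context split_lie_super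
begin

text \<open>The preimage in the free algebra of the left ideal generated by the $x - \chi(x)$.\<close>

definition J :: "('a list \<Rightarrow>\<^sub>0 complex) set" where
  "J = fspan (I \<union> {a * (gen x - fscale (\<xi> x) 1) | a x. a \<in> FA \<and> x \<in> m})"

lemma I_J: "a \<in> I \<Longrightarrow> a \<in> J"
  unfolding J_def by (intro fs.span_base) auto

lemma J_zero: "0 \<in> J" and J_add: "a \<in> J \<Longrightarrow> c \<in> J \<Longrightarrow> a + c \<in> J"
  and J_fscale: "a \<in> J \<Longrightarrow> fscale d a \<in> J" and J_diff: "a \<in> J \<Longrightarrow> c \<in> J \<Longrightarrow> a - c \<in> J"
  using fs.subspace_span[of "I \<union> {a * (gen x - fscale (\<xi> x) 1) | a x. a \<in> FA \<and> x \<in> m}"]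
  unfolding J_def
  by (auto intro: fs.subspace_0 fs.subspace_add fs.subspace_scale fs.subspace_diff)

lemma J_gen: "a \<in> FA \<Longrightarrow> x \<in> m \<Longrightarrow> a * (gen x - fscale (\<xi> x) 1) \<in> J"
  unfolding J_def by (intro fs.span_base) auto

lemma J_left: assumes "a \<in> FA" "j \<in> J" shows "a * j \<in> J"
  using assms(2) unfolding J_def
proof (induction j rule: fs.span_induct_alt)
  case base then show ?case using J_zero by (simp add: J_def)
next
  case (step c x y)
  from step(1) have "a * x \<in> J"
  proof
    assume "x \<in> I" then show ?thesis using I_J I_left assms by blast
  next
    assume "x \<in> {a * (gen x - fscale (\<xi> x) 1) | a x. a \<in> FA \<and> x \<in> m}"
    then obtain a' x' where x: "x = a' * (gen x' - fscale (\<xi> x') 1)" and "a' \<in> FA" "x' \<in> m" by auto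
    then show ?thesis unfolding x mult.assoc[symmetric] using assms FA_mult by (intro J_gen) auto
  qed
  then show ?case using step(2) J_add[OF J_fscale, of "a * x" "a * y" c]
    by (simp add: algebra_simps fscale_mult_right J_def)
qed

lemma Sg_J: assumes "a \<in> J" shows "Sg a \<in> J"
  using assms unfolding J_def
proof (induction a rule: fs.span_induct_alt)
  case base then show ?case using J_zero by (simp add: J_def Sg_simps)
next
  case (step c x y)
  from step(1) have "Sg x \<in> J"
  proof
    assume "x \<in> I" then show ?thesis using I_J Sg_I by blast
  next
    assume "x \<in> {a * (gen x - fscale (\<xi> x) 1) | a x. a \<in> FA \<and> x \<in> m}"
    then obtain a' x' where x: "x = a' * (gen x' - fscale (\<xi> x') 1)" and a': "a' \<in> FA" "x' \<in> m" by auto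
    have "Sg x = Sg a' * (gen (\<sigma> x') - fscale (\<xi> (\<sigma> x')) 1)"
      unfolding x Sg_simps using xi_tw[OF a'(2)] by simp
    then show ?thesis using a' Sg_FA tw_m J_gen by simp
  qed
  then show ?case using step(2) J_add[OF J_fscale]
    by (simp add: Sg_simps flip: J_def)
qed

text \<open>
  The two homogeneous components of the quotient by \<open>J\<close> meet in zero: if \<open>a\<close> of parity \<open>p\<close> and
  \<open>c\<close> of the other parity are congruent, then the parity automorphism shows that \<open>a\<close> and \<open>- c\<close> are
  congruent as well.
\<close>

lemma J_graded:
  assumes "a \<in> fspan (homogeneous_words L p)" "c \<in> fspan (homogeneous_words L (p + 1))" "a - c \<in> J"
  shows "a \<in> J"
proof -
  let ?s = "ksign 1 p"
  have s: "ksign 1 (p + 1) = - ?s" "?s * ?s = 1" by (cases p; simp)+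
  have 1: "Sg a - fscale ?s a \<in> J" "Sg c + fscale ?s c \<in> J"
    using Sg_hom[OF assms(1)] Sg_hom[OF assms(2)] I_J by (auto simp: s)
  have "fscale ?s (Sg (a - c) - (Sg a - fscale ?s a) + (Sg c + fscale ?s c)) \<in> J"
    by (intro J_fscale J_add J_diff 1 Sg_J assms)
  moreover have "Sg (a - c) - (Sg a - fscale ?s a) + (Sg c + fscale ?s c) = fscale ?s (a + c)"
    by (simp add: Sg_simps fs.scale_right_distrib)
  ultimately have "a + c \<in> J" by (simp add: s)
  then have "fscale (1/2) ((a - c) + (a + c)) \<in> J"
    using assms(3) by (intro J_fscale) (rule J_add)
  moreover have "fscale (1/2) ((a - c) + (a + c)) = a"
    by (intro poly_mapping_eqI) (simp add: lookup_add lookup_minus)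
  ultimately show ?thesis by simp
qed

subsection \<open>Whittaker functionals\<close>

text \<open>
  The functionals on $U(\mathfrak g)$ that live on the coinvariants of the Whittaker module, as
  functionals on words written from right to left.
\<close>

definition whittaker :: "('a list \<Rightarrow> complex) \<Rightarrow> bool" where
  "whittaker f \<longleftrightarrow> multilinear f \<and> (\<forall>n. rel n f) \<and>
     (\<forall>x\<in>m. \<forall>w. set w \<subseteq> G \<longrightarrow> f (x # w) = \<xi> x * f w) \<and>
     (\<forall>x\<in>b. \<forall>w. set w \<subseteq> G \<longrightarrow> f (w @ [x]) = 0)"

lemma whittaker_psi: "whittaker psi"
  unfolding whittaker_def using multilinear_psi rel_psi psi_m psi_first_b by blast

lemma whittaker_lin: assumes "whittaker f" "whittaker g" shows "whittaker (\<lambda>w. c * f w + d * g w)"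
  using assms unfolding whittaker_def multilinear_def rel_def by (auto simp: algebra_simps)

lemma tw_b: "x \<in> b \<Longrightarrow> tw p x \<in> b"
  using graded_b[of x 0] graded_b[of x 1] subspace_diff[OF subspace_b] by (auto simp: tw_def)

lemma whittaker_sigma: assumes "whittaker f" shows "whittaker (\<lambda>w. f (map \<sigma> w))"
  unfolding whittaker_def
proof (intro conjI allI ballI impI)
  have ml: "multilinear f" using assms by (simp add: whittaker_def)
  have rl: "rel n f" for n using assms by (simp add: whittaker_def)
  have S: "set (map \<sigma> w) \<subseteq> G" if "set w \<subseteq> G" for w using that by auto
  show "multilinear (\<lambda>w. f (map \<sigma> w))"
    unfolding multilinear_def
    by (auto simp: tw_add tw_scale multilinear_add[OF ml S S] multilinear_scale[OF ml S S] simp del: set_map)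
  fix n show "rel n (\<lambda>w. f (map \<sigma> w))"
    unfolding rel_def
  proof (intro allI impI)
    fix u w q x y
    assume A: "set u \<subseteq> G" "set w \<subseteq> G" "x \<in> P q" "y \<in> G" "length u + length w + 2 \<le> n"
    have "\<sigma> (tw q y) = tw q (\<sigma> y)" using A by (simp add: tw_tw add.commute)
    then show "f (map \<sigma> (u @ x # y # w)) = f (map \<sigma> (u @ br y x # w)) + f (map \<sigma> (u @ tw q y # x # w))"
      using relD[OF rl[of n], of "map \<sigma> u" "map \<sigma> w" "\<sigma> x" q "\<sigma> y"] A S[OF A(1)] S[OF A(2)] P_G[OF A(3)]
      by (simp add: tw_br tw_P)
  qed
next
  fix x w assume "x \<in> m" "set w \<subseteq> G"
  then show "f (map \<sigma> (x # w)) = \<xi> x * f (map \<sigma> w)"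
    using assms tw_m[of x 1] xi_tw[of x 1] sigma_list_G[of w] unfolding whittaker_def by simp
next
  fix x w assume "x \<in> b" "set w \<subseteq> G"
  then show "f (map \<sigma> (w @ [x])) = 0"
    using assms tw_b[of x 1] sigma_list_G[of w] unfolding whittaker_def by simp
qed

text \<open>
  The even and the odd part of \<open>psi\<close>, scaled to form the dual basis of \<open>1\<close> and \<open>\<Theta>\<close>. The factor
  of the odd part is $\kappa = 1/(2\kappa)$.
\<close>

definition phi0 :: "'a list \<Rightarrow> complex" where "phi0 w = 1/2 * psi w + 1/2 * psi (map \<sigma> w)"
definition phi1 :: "'a list \<Rightarrow> complex" where "phi1 w = \<kappa> * psi w + (- \<kappa>) * psi (map \<sigma> w)"

lemma whittaker_phi: "whittaker phi0" "whittaker phi1"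
  unfolding phi0_def phi1_def
  by (intro whittaker_lin whittaker_psi whittaker_sigma)+

lemma sigma_sigma: "set w \<subseteq> G \<Longrightarrow> map \<sigma> (map \<sigma> w) = w"
  by (induction w) (auto simp: tw_tw)

lemma phi_sigma: assumes "set w \<subseteq> G"
  shows "phi0 (map \<sigma> w) = phi0 w" "phi1 (map \<sigma> w) = - phi1 w"
  using sigma_sigma[OF assms] by (simp_all add: phi0_def phi1_def del: map_map)

lemma psi_sigma_Theta: "psi [\<sigma> \<Theta>] = - \<kappa>"
  using multilinear_scale_hd[OF multilinear_psi, of "[]" \<Theta> "-1"] tw_hom[OF Theta_odd, of 1]
    psi_Theta[of "[]"] by (simp add: psi_Nil)

lemma phi_values: "phi0 [] = 1" "phi1 [] = 0" "phi0 [\<Theta>] = 0" "phi1 [\<Theta>] = 1"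
  using psi_Theta[of "[]"] kappa_sq
  by (simp_all add: phi0_def phi1_def psi_Nil psi_sigma_Theta mult.commute)

text \<open>Products in the free algebra are read from left to right, hence the reversal.\<close>

definition ev :: "('a list \<Rightarrow> complex) \<Rightarrow> ('a list \<Rightarrow>\<^sub>0 complex) \<Rightarrow> complex" where
  "ev f = fev (\<lambda>w. f (rev w))"

lemma ev_simps: "ev f (a + c) = ev f a + ev f c" "ev f (fscale d a) = d * ev f a" "ev f 0 = 0"
    "ev f (wd w) = f (rev w)" "ev f (a - c) = ev f a - ev f c"
  by (simp_all add: ev_def fev_add fev_fscale fev_diff)

lemma ev_J: assumes "whittaker f" "a \<in> J" shows "ev f a = 0"
  unfolding ev_def
proof (rule fev_vanish_span)
  show "a \<in> fspan (I \<union> {a * (gen x - fscale (\<xi> x) 1) | a x. a \<in> FA \<and> x \<in> m})"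
    using assms(2) by (simp add: J_def)
  fix z assume "z \<in> I \<union> {a * (gen x - fscale (\<xi> x) 1) | a x. a \<in> FA \<and> x \<in> m}"
  then show "fev (\<lambda>w. f (rev w)) z = 0"
  proof
    assume "z \<in> I" then show ?thesis using assms(1) fev_I unfolding whittaker_def by blast
  next
    assume "z \<in> {a * (gen x - fscale (\<xi> x) 1) | a x. a \<in> FA \<and> x \<in> m}"
    then obtain a x where z: "z = a * (gen x - fscale (\<xi> x) 1)" and "a \<in> FA" and x: "x \<in> m" by auto
    from this(2) show ?thesis unfolding z
    proof (induction a rule: FA_induct)
      case (word w)
      have "f (x # rev w) = \<xi> x * f (rev w)" using assms(1) x word unfolding whittaker_def by simp
      then show ?case
        by (simp add: algebra_simps gen_wd one_wd wd_mult fev_diff fscale_mult_right fev_fscale del: fscale_single)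
    qed (auto simp: distrib_right fev_add fscale_mult_left fev_fscale)
  qed
qed

lemma ev_b: assumes "whittaker f" "x \<in> b" "a \<in> FA" shows "ev f (gen x * a) = 0"
  using assms(3)
proof (induction a rule: FA_induct)
  case (word w)
  then show ?case using assms(1,2) unfolding whittaker_def by (simp add: gen_wd wd_mult ev_simps)
qed (auto simp: distrib_left ev_simps fscale_mult_right)

lemma multilinear_sigma_sign:
  assumes "list_all2 (\<lambda>x q. x \<in> P q) w ps" "multilinear f"
  shows "set w \<subseteq> G \<and> (\<forall>u. set u \<subseteq> G \<longrightarrow> f (u @ map \<sigma> w) = ksign 1 (sum_list ps) * f (u @ w))"
  using assms(1)
proof (induction w ps rule: list_all2_induct)
  case (Cons x w p ps)
  have G: "x \<in> G" "set w \<subseteq> G" using Cons P_G by auto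
  have "ksign 1 (p + sum_list ps) = ksign 1 p * ksign 1 (sum_list ps)"
    by (cases p; cases "sum_list ps") auto
  then show ?case
    using Cons G spec[OF conjunct2[OF Cons(3)], of "u @ [\<sigma> x]" for u] multilinear_scale[OF assms(2) _ G(2,1)]
    by (auto simp: tw_hom[of x p] P_scale G_scale)
qed simp

lemma phi_hom:
  assumes "a \<in> fspan (homogeneous_words L p)"
  shows "p = 1 \<Longrightarrow> ev phi0 a = 0" "p = 0 \<Longrightarrow> ev phi1 a = 0"
proof -
  have *: "phi0 (rev w) = 0 \<or> p = 0" "phi1 (rev w) = 0 \<or> p = 1"
    if "list_all2 (\<lambda>x q. x \<in> P q) w ps" "sum_list ps = p" for w ps
  proof -
    have l: "list_all2 (\<lambda>x q. x \<in> P q) (rev w) (rev ps)" using that by simp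
    have "sum_list (rev ps) = p" using that by simp
    then have F: "f (map \<sigma> (rev w)) = ksign 1 p * f (rev w)" if "multilinear f" for f
      using multilinear_sigma_sign[OF l that] by (auto dest: spec[of _ "[]"])
    have w: "set (rev w) \<subseteq> G" using multilinear_sigma_sign[OF l multilinear_psi] by blast
    have "multilinear phi0" "multilinear phi1" using whittaker_phi by (auto simp: whittaker_def)
    note E = F[OF this(1)] F[OF this(2)] phi_sigma[OF w]
    have "phi0 (rev w) = 0" if "p = 1" using E(1,3) that by (simp del: rev_map)
    then show "phi0 (rev w) = 0 \<or> p = 0" by (cases p) auto
    have "phi1 (rev w) = 0" if "p = 0" using E(2,4) that by (simp del: rev_map)
    then show "phi1 (rev w) = 0 \<or> p = 1" by (cases p) auto
  qed
  show "ev phi0 a = 0" if "p = 1"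
    unfolding ev_def using that
    by (intro fev_vanish_span[OF _ assms]) (auto dest: *(1) simp: homogeneous_words_def)
  show "ev phi1 a = 0" if "p = 0"
    unfolding ev_def using that
    by (intro fev_vanish_span[OF _ assms]) (auto dest: *(2) simp: homogeneous_words_def)
qed

subsection \<open>Reduction to two generators\<close>

text \<open>
  Modulo \<open>b U\<close> and \<open>J\<close> everything is a combination of \<open>1\<close> and \<open>\<Theta>\<close>. The induction is on the
  length of words: a letter from \<open>b\<close> can be moved to the front and a letter from \<open>m\<close> to the end,
  each commutator producing a shorter word, and a word with \<open>\<Theta>\<close> as its only letter is shortened by
  $2\Theta^2 = [\Theta,\Theta]$.
\<close>

lemma FA_reduce:
  assumes Y: "fs.subspace Y" and YJ: "J \<subseteq> Y" and Y1: "1 \<in> Y" and YT: "gen \<Theta> \<in> Y"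
    and Yb: "\<And>x a p. x \<in> b \<Longrightarrow> x \<in> P p \<Longrightarrow> a \<in> FA \<Longrightarrow> gen x * a \<in> Y"
    and a: "a \<in> FA"
  shows "a \<in> Y"
proof -
  note Ya = fs.subspace_add[OF Y] and Ys = fs.subspace_scale[OF Y] and Yd = fs.subspace_diff[OF Y]
  have YI: "i \<in> Y" if "i \<in> I" for i using that I_J YJ by auto
  have "wd w \<in> Y" if "set w \<subseteq> G" for w
    using that
  proof (induction "length w" arbitrary: w rule: less_induct)
    case (less w0)
    define n where "n = length w0"
    have IH: "wd w \<in> Y" if "length w < n" "set w \<subseteq> G" for w
      using less(1)[of w] that by (simp add: n_def)
    have B: "wd (u @ x # w) \<in> Y" if "length u + length w + 1 = n" "set u \<subseteq> G" "set w \<subseteq> G" "x \<in> b" "x \<in> P p" for u w x p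
      using that
    proof (induction u arbitrary: w rule: rev_induct)
      case Nil
      then show ?case using Yb[of x p "wd w"] by (simp add: gen_wd wd_mult)
    next
      case (snoc y u)
      have xG: "x \<in> G" using snoc P_G by auto
      have 1: "wd (u @ y # x # w) - wd (u @ x # tw p y # w) - wd (u @ br y x # w) \<in> Y"
        using snoc by (intro YI word_swap) auto
      have 2: "wd (u @ x # tw p y # w) \<in> Y" using snoc by (intro snoc.IH) auto
      have 3: "wd (u @ br y x # w) \<in> Y" using snoc xG by (intro IH) (auto intro: br_G)
      from Ya[OF Ya[OF 1 2] 3] show ?case by simp
    qed
    have M: "wd (u @ x # w) \<in> Y" if "length u + length w + 1 = n" "set u \<subseteq> G" "set w \<subseteq> G" "x \<in> m" "x \<in> P p" for u w x p
      using that
    proof (induction w arbitrary: u)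
      case Nil
      have "wd u * (gen x - fscale (\<xi> x) 1) \<in> Y" using Nil J_gen YJ by auto
      then have "wd (u @ [x]) - fscale (\<xi> x) (wd u) \<in> Y"
        by (simp add: algebra_simps gen_wd one_wd wd_mult fscale_mult_right del: fscale_single)
      moreover have "fscale (\<xi> x) (wd u) \<in> Y" using Nil by (intro Ys IH) auto
      ultimately show ?case using Ya by force
    next
      case (Cons y w)
      have xG: "x \<in> G" using Cons P_G by auto
      have yG: "y \<in> G" using Cons by auto
      \<comment> \<open>The relation for \<open>tw p y\<close> in place of \<open>y\<close>, as twisting twice is the identity.\<close>
      have 1: "wd (u @ tw p y # x # w) - wd (u @ x # tw p (tw p y) # w) - wd (u @ br (tw p y) x # w) \<in> Y"
        using Cons by (intro YI word_swap) auto
      have 2: "wd (u @ br (tw p y) x # w) \<in> Y" using Cons xG by (intro IH) (auto intro: br_G)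
      have 3: "wd ((u @ [tw p y]) @ x # w) \<in> Y" using Cons by (intro Cons.IH) auto
      have "tw p (tw p y) = y" using yG by (simp add: tw_tw)
      then show ?case using Yd[OF Yd[OF 3 1] 2] by simp
    qed
    have B': "wd (u @ x # w) \<in> Y" if A: "length u + length w + 1 = n" "set u \<subseteq> G" "set w \<subseteq> G" "x \<in> b" for u w x
    proof -
      have G: "pc 0 x \<in> G" "pc 1 x \<in> G" "x \<in> G" using A bG by auto
      have "wd (u @ (pc 0 x + pc 1 x) # w) - wd (u @ pc 0 x # w) - wd (u @ pc 1 x # w) \<in> Y"
        using A G by (intro YI word_add) auto
      moreover have "wd (u @ pc p x # w) \<in> Y" for p
        using A G graded_b pc_P by (intro B[where p = p]) auto
      ultimately have "wd (u @ (pc 0 x + pc 1 x) # w) \<in> Y" using Ya by (metis diff_add_cancel)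
      then show ?thesis using pc_sum[OF G(3)] by simp
    qed
    have M': "wd (u @ x # w) \<in> Y" if A: "length u + length w + 1 = n" "set u \<subseteq> G" "set w \<subseteq> G" "x \<in> m" for u w x
    proof -
      have G: "pc 0 x \<in> G" "pc 1 x \<in> G" "x \<in> G" using A mG by auto
      have "wd (u @ (pc 0 x + pc 1 x) # w) - wd (u @ pc 0 x # w) - wd (u @ pc 1 x # w) \<in> Y"
        using A G by (intro YI word_add) auto
      moreover have "wd (u @ pc p x # w) \<in> Y" for p
        using A G graded_m pc_P by (intro M[where p = p]) auto
      ultimately have "wd (u @ (pc 0 x + pc 1 x) # w) \<in> Y" using Ya by (metis diff_add_cancel)
      then show ?thesis using pc_sum[OF G(3)] by simp
    qed
    \<comment> \<open>From the left to the right, the letters are replaced by \<open>\<Theta>\<close>.\<close>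
    have "wd (replicate k \<Theta> @ w) \<in> Y" if "k + length w = n" "set w \<subseteq> G" for k w
      using that
    proof (induction w arbitrary: k)
      case Nil
      consider "k = 0" | "k = 1" | j where "k = Suc (Suc j)" by (cases k; cases "k - 1") auto
      then show ?case
      proof cases
        case 1 then show ?thesis using Y1 by (simp add: one_wd)
      next
        case 2 then show ?thesis using YT by (simp add: gen_wd)
      next
        case 3
        let ?w = "replicate j \<Theta>"
        have w: "set ?w \<subseteq> G" by auto
        have 1: "wd ([] @ \<Theta> # \<Theta> # ?w) - fscale (ksign 1 1) (wd ([] @ \<Theta> # \<Theta> # ?w)) - wd ([] @ br \<Theta> \<Theta> # ?w) \<in> Y"
          using w Theta_odd by (intro YI word_swap_hom) auto
        have 2: "wd ([] @ br \<Theta> \<Theta> # ?w) \<in> Y" using 3 Nil w by (intro IH) (auto intro: br_G)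
        have "fscale (1/2) (wd (\<Theta> # \<Theta> # ?w) + wd (\<Theta> # \<Theta> # ?w)) \<in> Y"
          using Ys[OF Ya[OF 1 2]] by (simp del: fscale_single)
        moreover have "fscale (1/2) (wd v + wd v) = wd v" for v :: "'a list"
          by (intro poly_mapping_eqI) (simp add: lookup_add)
        ultimately show ?thesis using 3 by (simp add: replicate_append_same)
      qed
    next
      case (Cons x w)
      let ?u = "replicate k \<Theta>" and ?t = "sc (\<theta> x) \<Theta>"
      have u: "set ?u \<subseteq> G" by auto
      have x: "x \<in> G" and w: "set w \<subseteq> G" using Cons by auto
      have G: "\<beta> x \<in> G" "?t \<in> G" "\<mu> x \<in> G" using x mG mu_m G_scale by auto
      have 1: "wd (?u @ (\<beta> x + ?t + \<mu> x) # w) - wd (?u @ (\<beta> x + ?t) # w) - wd (?u @ \<mu> x # w) \<in> Y"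
        by (intro YI word_add u w G G_add)
      have 2: "wd (?u @ (\<beta> x + ?t) # w) - wd (?u @ \<beta> x # w) - wd (?u @ ?t # w) \<in> Y"
        by (intro YI word_add u w G)
      have 3: "wd (?u @ ?t # w) - fscale (\<theta> x) (wd (?u @ \<Theta> # w)) \<in> Y"
        by (intro YI word_scale u w Theta_G)
      have "wd (replicate (Suc k) \<Theta> @ w) \<in> Y" using Cons by (intro Cons.IH) auto
      moreover have "replicate (Suc k) \<Theta> @ w = ?u @ \<Theta> # w" by (simp add: replicate_app_Cons_same)
      ultimately have 4: "fscale (\<theta> x) (wd (?u @ \<Theta> # w)) \<in> Y" using Ys by metis
      have 5: "wd (?u @ \<mu> x # w) \<in> Y" using Cons x u mu_m by (intro M') auto
      have 6: "wd (?u @ \<beta> x # w) \<in> Y" using Cons x u beta_b by (intro B') auto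
      have 7: "wd (?u @ ?t # w) \<in> Y" using Ya[OF 3 4] by simp
      have 8: "wd (?u @ (\<beta> x + ?t) # w) \<in> Y" using Ya[OF Ya[OF 2 6] 7] by simp
      have "wd (?u @ (\<beta> x + ?t + \<mu> x) # w) \<in> Y" using Ya[OF Ya[OF 1 8] 5] by simp
      then show ?case using split[of x] by simp
    qed
    from this[of 0 w0] show ?case using less by (simp add: n_def)
  qed
  with a show ?thesis
    by (induction a rule: FA_induct) (auto intro: Ya Ys fs.subspace_0[OF Y])
qed

end

section \<open>Cosets\<close>

lemma coset_eq_iff:
  assumes "fs.subspace N" shows "a +o N = c +o N \<longleftrightarrow> a - c \<in> N"
proof
  assume "a +o N = c +o N"
  moreover have "a \<in> a +o N" using fs.subspace_0[OF assms] by (auto simp: elt_set_plus_def)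
  ultimately show "a - c \<in> N" by (auto simp: elt_set_plus_def)
next
  assume *: "a - c \<in> N"
  have "a + n = c + ((a - c) + n)" "c + n = a + (n - (a - c))" for n by simp_all
  then show "a +o N = c +o N"
    using fs.subspace_add[OF assms *] fs.subspace_diff[OF assms _ *]
    unfolding elt_set_plus_def by blast
qed

lemma coset_add:
  assumes "fs.subspace N" shows "(a +o N) + (c +o N) = (a + c) +o N"
proof -
  have "N + N = N"
    using fs.subspace_add[OF assms] fs.subspace_0[OF assms]
    by (auto simp: set_plus_def) (metis add.right_neutral)
  then show ?thesis by (simp add: set_plus_rearrange)
qed

lemma coset_absorb:
  assumes "fs.subspace N" "N' \<subseteq> N" "0 \<in> N'" shows "(a +o N') + N = a +o N"
proof -
  have "N' + N = N"
    using fs.subspace_add[OF assms(1)] assms(2,3)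
    by (auto simp: set_plus_def) (metis add.left_neutral)
  then show ?thesis by (simp add: set_plus_rearrange3)
qed

lemma coset_scale:
  assumes "fs.subspace N" shows "fscale c ` (a +o N) + N = fscale c a +o N"
proof -
  have "fscale c ` (a +o N) = fscale c a +o fscale c ` N"
    by (auto simp: elt_set_plus_def fs.scale_right_distrib image_def)
  moreover have "fscale c ` N \<subseteq> N" "0 \<in> fscale c ` N"
    using fs.subspace_scale[OF assms] fs.subspace_0[OF assms] by (auto intro: image_eqI[of _ _ 0])
  ultimately show ?thesis using coset_absorb[OF assms] by simp
qed

lemma coset_image:
  assumes "fs.subspace N" "\<And>n. n \<in> N \<Longrightarrow> fextend g n \<in> N"
  shows "fextend g ` (a +o N) + N = fextend g a +o N"
proof -
  have "fextend g ` (a +o N) = fextend g a +o fextend g ` N"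
    by (auto simp: elt_set_plus_def fextend_add image_def)
  moreover have "fextend g ` N \<subseteq> N" "0 \<in> fextend g ` N"
    using assms fs.subspace_0[OF assms(1)] by (auto intro: image_eqI[of _ _ 0])
  ultimately show ?thesis using coset_absorb[OF assms(1)] by simp
qed

section \<open>A model of the Whittaker module\<close>

context lie_super
begin

lemma uea_simps:
  "scarrier (uea L) = (\<lambda>a. a +o I) ` FA" "sadd (uea L) = (+)"
  "sscale (uea L) = (\<lambda>c X. fscale c ` X + I)"
  "spart (uea L) = (\<lambda>p. (\<lambda>a. a +o I) ` fspan (homogeneous_words L p))"
  "smult (uea L) = (\<lambda>X Y. X * Y + I)"
  by (simp_all add: uea_def superspace.extend_def superalgebra.fields_def fquotient_def free_alg_def)

lemma coset_mult:
  assumes "a \<in> FA" "c \<in> FA" shows "(a +o I) * (c +o I) + I = (a * c) +o I"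
proof -
  have "(a + i) * (c + j) - a * c \<in> I" if "i \<in> I" "j \<in> I" for i j
    using I_add[OF I_add[OF I_left[OF assms(1) that(2)] I_right[OF assms(2) that(1)]]
        I_left[of i, OF _ that(2)]] that I_FA by (auto simp: algebra_simps)
  then have *: "\<exists>k\<in>I. (a + i) * (c + j) = a * c + k" if "i \<in> I" "j \<in> I" for i j
    using that by (metis add_diff_cancel_left' diff_add_cancel add.commute)
  show ?thesis
  proof (intro equalityI subsetI)
    fix z assume "z \<in> (a +o I) * (c +o I) + I"
    then obtain i j k where z: "z = (a + i) * (c + j) + k" "i \<in> I" "j \<in> I" "k \<in> I"
      by (auto simp: set_plus_def set_times_def elt_set_plus_def)
    with * obtain l where "l \<in> I" "(a + i) * (c + j) = a * c + l" by blast
    then show "z \<in> (a * c) +o I"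
      using z I_add by (auto simp: elt_set_plus_def add.assoc)
  next
    fix z assume "z \<in> (a * c) +o I"
    then obtain k where "z = (a + 0) * (c + 0) + k" "k \<in> I" by (auto simp: elt_set_plus_def)
    then show "z \<in> (a +o I) * (c +o I) + I"
      using I_zero unfolding set_plus_def set_times_def elt_set_plus_def by blast
  qed
qed

lemma uea_ops:
  "sadd (uea L) (a +o I) (c +o I) = (a + c) +o I"
  "sscale (uea L) d (a +o I) = fscale d a +o I"
  "a \<in> FA \<Longrightarrow> c \<in> FA \<Longrightarrow> smult (uea L) (a +o I) (c +o I) = (a * c) +o I"
  by (simp_all add: uea_simps coset_add coset_scale subspace_I coset_mult)

end

context split_lie_super
begin

abbreviation "L\<^sub>m \<equiv> lrestrict L m"

lemma lcarrier_Lm: "lcarrier L\<^sub>m = m"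
proof
  show "lcarrier L\<^sub>m \<subseteq> m"
    by (auto simp: lcarrier_def lrestrict_def set_plus_def intro: subspace_add[OF subspace_m])
  show "m \<subseteq> lcarrier L\<^sub>m"
  proof
    fix x assume x: "x \<in> m"
    then have "pc 0 x \<in> P 0 \<inter> m" "pc 1 x \<in> P 1 \<inter> m"
      using graded_m pc_P mG by auto
    then show "x \<in> lcarrier L\<^sub>m"
      using pc_sum[OF mG[OF x]] by (auto simp: lcarrier_def lrestrict_def set_plus_def)
  qed
qed

abbreviation "FAm \<equiv> free_alg L\<^sub>m"
abbreviation "I\<^sub>m \<equiv> uea_ideal L\<^sub>m"

lemma lscale_Lm: "lscale L\<^sub>m = sc"
  by (simp add: lrestrict_def)

lemma FAm_FA: "FAm \<subseteq> FA"
  using m_G unfolding free_alg_def lcarrier_Lm by (auto simp: lists_def intro: lists_mono[THEN subsetD])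

lemma relm_rel: "uea_relations L\<^sub>m \<subseteq> uea_relations L"
  using m_G unfolding uea_relations_def lcarrier_Lm
  by (auto simp: lrestrict_def)

lemma Im_I: "I\<^sub>m \<subseteq> I"
  unfolding uea_ideal_def
  by (rule fs.span_mono) (use FAm_FA relm_rel in blast)

lemma subspace_Im: "fs.subspace I\<^sub>m"
  by (simp add: uea_ideal_def fs.subspace_span)

lemma uea_m_carrier: "scarrier (uea L\<^sub>m) = (\<lambda>a. a +o I\<^sub>m) ` FAm"
  by (simp add: uea_def superspace.extend_def superalgebra.fields_def fquotient_def free_alg_def)

lemma uea_map_coset: "uea_map L (a +o I\<^sub>m) = a +o I"
  unfolding uea_map_def
  by (rule coset_absorb[OF subspace_I Im_I]) (rule fs.subspace_0[OF subspace_Im])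

abbreviation "ch \<equiv> free_char \<xi>"

lemma ch_fev: "ch = fev (\<lambda>xs. prod_list (map \<xi> xs))"
  by (intro ext) (simp add: free_char_def fev_def)

lemma FAm_induct [consumes 1, case_names zero add scale word]:
  assumes "a \<in> FAm" "Q 0" "\<And>a c. Q a \<Longrightarrow> Q c \<Longrightarrow> Q (a + c)" "\<And>c a. Q a \<Longrightarrow> Q (fscale c a)"
    "\<And>w. set w \<subseteq> m \<Longrightarrow> Q (wd w)"
  shows "Q a"
proof -
  have "Poly_Mapping.keys a \<subseteq> {w. set w \<subseteq> m}"
    using assms(1) by (auto simp: free_alg_def lcarrier_Lm in_lists_conv_set)
  then show ?thesis
  proof (induction a rule: keys_induct)
    case (single k c) then show ?case using assms(4)[OF assms(5), of k c] by simp
  qed (use assms in auto)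
qed

lemma ch_mult_right: "ch (wd u * a) = prod_list (map \<xi> u) * ch a"
proof -
  have "Poly_Mapping.keys a \<subseteq> UNIV" by simp
  then show ?thesis unfolding ch_fev
    by (induction a rule: keys_induct)
      (auto simp: distrib_left fev_add mult_single plus_list_def)
qed

lemma ch_mult: "ch (a * c) = ch a * ch c"
proof -
  have "Poly_Mapping.keys a \<subseteq> UNIV" by simp
  then show ?thesis
  proof (induction a rule: keys_induct)
    case (single k d)
    have "Poly_Mapping.single k d * c = fscale d (wd k * c)"
      by (subst fscale_wd) (simp add: fscale_mult_left del: fscale_single)
    then show ?case using ch_mult_right[of k c] by (simp add: ch_fev fev_fscale)
  qed (auto simp: ch_fev distrib_right fev_add)
qed

lemma ch_Im: assumes "a \<in> I\<^sub>m" shows "ch a = 0"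
  unfolding ch_fev
proof (rule fev_vanish_span)
  show "a \<in> fspan {a * r * b |a r b. a \<in> FAm \<and> r \<in> uea_relations L\<^sub>m \<and> b \<in> FAm}"
    using assms by (simp add: uea_ideal_def)
  fix z assume "z \<in> {a * r * b |a r b. a \<in> FAm \<and> r \<in> uea_relations L\<^sub>m \<and> b \<in> FAm}"
  then obtain a r b where z: "z = a * r * b" and r: "r \<in> uea_relations L\<^sub>m" by auto
  have "ch r = 0"
    using r unfolding uea_relations_def
  proof (elim UnE CollectE exE conjE)
    fix x y assume r: "r = gen (x + y) - gen x - gen y" and "x \<in> lcarrier L\<^sub>m" "y \<in> lcarrier L\<^sub>m"
    then show ?thesis unfolding r by (simp add: ch_fev fev_diff gen_wd lcarrier_Lm xi_add)
  next
    fix x c assume r: "r = gen (lscale L\<^sub>m c x) - fscale c (gen x)" and "x \<in> lcarrier L\<^sub>m"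
    then show ?thesis unfolding r
      using \<open>x \<in> lcarrier L\<^sub>m\<close>
      by (simp add: ch_fev fev_diff fev_fscale gen_wd xi_scale lscale_Lm lcarrier_Lm del: fscale_single)
  next
    fix x y p q assume r: "r = gen x * gen y - fscale (ksign p q) (gen y * gen x) - gen (lbracket L\<^sub>m x y)"
      and "x \<in> lpart L\<^sub>m p" "y \<in> lpart L\<^sub>m q"
    then have xy: "x \<in> m" "y \<in> m" "x \<in> P p" "y \<in> P q" by (auto simp: lrestrict_def)
    then have "ch r = \<xi> x * \<xi> y - ksign p q * (\<xi> y * \<xi> x)"
      unfolding r using m_bracket[OF xy(1,2)]
      by (simp add: ch_fev fev_diff fev_fscale gen_wd wd_mult lrestrict_def del: fscale_single)
    moreover have "ksign p q = 1 \<or> \<xi> x = 0" using xy xi_odd by (cases p; cases q) auto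
    ultimately show ?thesis by auto
  qed
  then show "fev (\<lambda>xs. prod_list (map \<xi> xs)) z = 0"
    unfolding ch_fev[symmetric] z by (simp add: ch_mult)
qed

lemma uea_char_coset: "uea_char \<xi> (a +o I\<^sub>m) = ch a"
  unfolding uea_char_def
proof (rule the_equality)
  show "\<exists>c\<in>a +o I\<^sub>m. ch a = ch c"
    using fs.subspace_0[OF subspace_Im] by (intro bexI[of _ a]) (auto simp: elt_set_plus_def)
  fix c assume "\<exists>d\<in>a +o I\<^sub>m. c = ch d"
  then obtain i where "i \<in> I\<^sub>m" "c = ch (a + i)" by (auto simp: elt_set_plus_def)
  then show "c = ch a" using ch_Im[of i] by (simp add: ch_fev fev_add)
qed

text \<open>
  The left ideal defining $Q_\chi$ is generated by the elements $x - \chi(x)$ with \<open>x\<close> in \<open>m\<close> itself: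
  the kernel of the character of $U(\mathfrak m)$ is reached by telescoping.
\<close>

lemma J_char: assumes "a \<in> FA" "y \<in> FAm" shows "a * y - fscale (ch y) a \<in> J"
proof -
  have "y - fscale (ch y) 1 \<in> J"
    using assms(2)
  proof (induction y rule: FAm_induct)
    case zero then show ?case by (simp add: ch_fev J_zero)
  next
    case (add a c)
    from J_add[OF add] show ?case by (simp add: ch_fev fev_add fs.scale_left_distrib algebra_simps)
  next
    case (scale c a)
    from J_fscale[OF scale, of c] show ?case by (simp add: ch_fev fev_fscale fs.scale_right_diff_distrib)
  next
    case (word w)
    then show ?case
    proof (induction w rule: rev_induct)
      case Nil then show ?case by (simp add: ch_fev one_wd J_zero)
    next
      case (snoc x w)
      then have "wd w \<in> FA" using mG by auto
      from J_gen[OF this, of x] snoc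
      have "wd w * (gen x - fscale (\<xi> x) 1) + fscale (\<xi> x) (wd w - fscale (ch (wd w)) 1) \<in> J"
        by (intro J_add J_fscale) auto
      moreover have "wd w * (gen x - fscale (\<xi> x) 1) + fscale (\<xi> x) (wd w - fscale (ch (wd w)) 1) =
         wd (w @ [x]) - fscale (ch (wd (w @ [x]))) 1"
        by (simp add: algebra_simps gen_wd wd_mult fscale_mult_right fs.scale_right_diff_distrib ch_fev
            del: fscale_single)
      ultimately show ?case by simp
    qed
  qed
  from J_left[OF assms(1) this] show ?thesis
    by (simp add: algebra_simps fscale_mult_right)
qed

lemma J_FA: "J \<subseteq> FA"
  unfolding J_def
  by (intro fs.span_minimal subspace_FA)
    (use I_FA in \<open>auto intro!: FA_mult FA_diff FA_fscale intro: mG\<close>)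

text \<open>
  The tensor product $Q_\chi$ is identified with the quotient of the free algebra by \<open>J\<close>. The
  class of \<open>a\<close> corresponds to \<open>cls a\<close>, the class of $a \otimes 1$.
\<close>

abbreviation "Q \<equiv> Q_module L m \<xi>"
abbreviation "N \<equiv> fspan (Q_relations L m \<xi>)"
abbreviation "act \<equiv> Q_action L m \<xi>"

definition dl :: "('a list \<Rightarrow>\<^sub>0 complex) \<Rightarrow> complex \<Rightarrow> (('a list \<Rightarrow>\<^sub>0 complex) set \<times> complex \<Rightarrow>\<^sub>0 complex)" where
  "dl a z = Poly_Mapping.single (a +o I, z) 1"

definition cls :: "('a list \<Rightarrow>\<^sub>0 complex) \<Rightarrow> (('a list \<Rightarrow>\<^sub>0 complex) set \<times> complex \<Rightarrow>\<^sub>0 complex) set" where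
  "cls a = dl a 1 +o N"

lemma Q_relations_eq:
  "Q_relations L m \<xi> =
     {dl (a + c) z - dl a z - dl c z | a c z. a \<in> FA \<and> c \<in> FA} \<union>
     {dl a (z + z') - dl a z - dl a z' | a z z'. a \<in> FA} \<union>
     {dl (fscale d a) z - fscale d (dl a z) | d a z. a \<in> FA} \<union>
     {dl a (d * z) - fscale d (dl a z) | d a z. a \<in> FA} \<union>
     {dl (a * y) z - dl a (ch y * z) | a y z. a \<in> FA \<and> y \<in> FAm}"
proof -
  have y: "y \<in> FAm \<Longrightarrow> y \<in> FA" for y using FAm_FA by auto
  have ev_line: "scarrier even_line = UNIV" "sadd even_line = (+)" "sscale even_line = (*)"
    by (simp_all add: even_line_def)
  have ops: "smult (uea L) (a +o I) (uea_map L (y +o I\<^sub>m)) = (a * y) +o I" if "a \<in> FA" "y \<in> FAm" for a y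
    using that y by (simp add: uea_map_coset uea_ops)
  have 1: "{Poly_Mapping.single (sadd (uea L) X X', z) 1 - Poly_Mapping.single (X, z) 1 - Poly_Mapping.single (X', z) 1 | X X' z.
      X \<in> scarrier (uea L) \<and> X' \<in> scarrier (uea L) \<and> z \<in> scarrier even_line} =
     {dl (a + c) z - dl a z - dl c z | a c z. a \<in> FA \<and> c \<in> FA}"
    unfolding uea_simps(1) ev_line dl_def uea_ops(1)[symmetric]
    by blast
  have 2: "{Poly_Mapping.single (X, sadd even_line z z') 1 - Poly_Mapping.single (X, z) 1 - Poly_Mapping.single (X, z') 1 | X z z'.
      X \<in> scarrier (uea L) \<and> z \<in> scarrier even_line \<and> z' \<in> scarrier even_line} =
     {dl a (z + z') - dl a z - dl a z' | a z z'. a \<in> FA}"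
    unfolding uea_simps(1) ev_line dl_def
    by blast
  have 3: "{Poly_Mapping.single (sscale (uea L) d X, z) 1 - fscale d (Poly_Mapping.single (X, z) 1) | d X z.
      X \<in> scarrier (uea L) \<and> z \<in> scarrier even_line} =
     {dl (fscale d a) z - fscale d (dl a z) | d a z. a \<in> FA}"
    unfolding uea_simps(1) ev_line dl_def uea_ops(2)[symmetric]
    by blast
  have 4: "{Poly_Mapping.single (X, sscale even_line d z) 1 - fscale d (Poly_Mapping.single (X, z) 1) | d X z.
      X \<in> scarrier (uea L) \<and> z \<in> scarrier even_line} =
     {dl a (d * z) - fscale d (dl a z) | d a z. a \<in> FA}"
    unfolding uea_simps(1) ev_line dl_def
    by blast
  have 5: "{Poly_Mapping.single (smult (uea L) X (uea_map L Y), z) 1 - Poly_Mapping.single (X, uea_char \<xi> Y * z) 1 | X Y z.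
      X \<in> scarrier (uea L) \<and> Y \<in> scarrier (uea L\<^sub>m) \<and> z \<in> scarrier even_line} =
     {dl (a * y) z - dl a (ch y * z) | a y z. a \<in> FA \<and> y \<in> FAm}"
  proof (intro set_eqI iffI)
    fix t :: "('a list \<Rightarrow>\<^sub>0 complex) set \<times> complex \<Rightarrow>\<^sub>0 complex" assume "t \<in> {Poly_Mapping.single (smult (uea L) X (uea_map L Y), z) 1 - Poly_Mapping.single (X, uea_char \<xi> Y * z) 1 | X Y z.
      X \<in> scarrier (uea L) \<and> Y \<in> scarrier (uea L\<^sub>m) \<and> z \<in> scarrier even_line}"
    then obtain a y z where "t = Poly_Mapping.single (smult (uea L) (a +o I) (uea_map L (y +o I\<^sub>m)), z) 1
       - Poly_Mapping.single (a +o I, uea_char \<xi> (y +o I\<^sub>m) * z) 1" "a \<in> FA" "y \<in> FAm"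
      unfolding uea_simps(1) uea_m_carrier by blast
    then show "t \<in> {dl (a * y) z - dl a (ch y * z) | a y z. a \<in> FA \<and> y \<in> FAm}"
      unfolding dl_def using ops uea_char_coset by auto
  next
    fix t :: "('a list \<Rightarrow>\<^sub>0 complex) set \<times> complex \<Rightarrow>\<^sub>0 complex" assume "t \<in> {dl (a * y) z - dl a (ch y * z) | a y z. a \<in> FA \<and> y \<in> FAm}"
    then obtain a y z where "t = Poly_Mapping.single (smult (uea L) (a +o I) (uea_map L (y +o I\<^sub>m)), z) 1
       - Poly_Mapping.single (a +o I, uea_char \<xi> (y +o I\<^sub>m) * z) 1" "a \<in> FA" "y \<in> FAm"
      unfolding dl_def using ops uea_char_coset by auto
    then show "t \<in> {Poly_Mapping.single (smult (uea L) X (uea_map L Y), z) 1 - Poly_Mapping.single (X, uea_char \<xi> Y * z) 1 | X Y z.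
      X \<in> scarrier (uea L) \<and> Y \<in> scarrier (uea L\<^sub>m) \<and> z \<in> scarrier even_line}"
      unfolding uea_simps(1) uea_m_carrier ev_line by blast
  qed
  show ?thesis
    unfolding Q_relations_def tensor_relations_def Let_def 1 2 3 4 5 ..
qed

lemma subspace_N: "fs.subspace N" by (rule fs.subspace_span)

lemma N_add: "s \<in> N \<Longrightarrow> t \<in> N \<Longrightarrow> s + t \<in> N" and N_diff: "s \<in> N \<Longrightarrow> t \<in> N \<Longrightarrow> s - t \<in> N"
  and N_zero: "0 \<in> N" and N_fscale: "t \<in> N \<Longrightarrow> fscale d t \<in> N"
  using subspace_N by (auto intro: fs.subspace_0 fs.subspace_add fs.subspace_scale fs.subspace_diff)

lemma N_rel:
  "a \<in> FA \<Longrightarrow> c \<in> FA \<Longrightarrow> dl (a + c) z - dl a z - dl c z \<in> N"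
  "a \<in> FA \<Longrightarrow> dl a (z + z') - dl a z - dl a z' \<in> N"
  "a \<in> FA \<Longrightarrow> dl (fscale d a) z - fscale d (dl a z) \<in> N"
  "a \<in> FA \<Longrightarrow> dl a (d * z) - fscale d (dl a z) \<in> N"
  "a \<in> FA \<Longrightarrow> y \<in> FAm \<Longrightarrow> dl (a * y) z - dl a (ch y * z) \<in> N"
  unfolding Q_relations_eq by (rule fs.span_base, blast)+

lemma dl_coset: "a - c \<in> I \<Longrightarrow> dl a z = dl c z"
  using coset_eq_iff[OF subspace_I, of a c] by (simp add: dl_def)

lemma dl_zero: "dl 0 z \<in> N"
  using N_rel(3)[of 0 0 z] by simp

lemma dl_scalar: "a \<in> FA \<Longrightarrow> dl a z - dl (fscale z a) 1 \<in> N"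
  using N_diff[OF N_rel(4)[of a z 1] N_rel(3)[of a z 1]] by simp

lemma cls_cong: "dl a 1 - dl c 1 \<in> N \<longleftrightarrow> cls a = cls c"
  unfolding cls_def by (simp add: coset_eq_iff[OF subspace_N])

lemma cls_diff: assumes "a \<in> FA" "c \<in> FA" shows "cls a = cls c \<longleftrightarrow> dl (a - c) 1 \<in> N"
proof -
  have "dl (a - c + c) 1 - dl (a - c) 1 - dl c 1 \<in> N" using assms by (intro N_rel FA_diff)
  then have 1: "(dl a 1 - dl c 1) - dl (a - c) 1 \<in> N" by (simp add: algebra_simps)
  have "dl a 1 - dl c 1 \<in> N \<longleftrightarrow> dl (a - c) 1 \<in> N"
    using N_add[OF 1] N_diff[OF _ 1] by force
  then show ?thesis by (simp add: cls_cong)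
qed

lemma J_N: assumes "a \<in> J" shows "dl a 1 \<in> N"
proof -
  have "a \<in> FA \<and> dl a 1 \<in> N"
    using assms unfolding J_def
  proof (induction a rule: fs.span_induct_alt)
    case base then show ?case by (simp add: dl_zero)
  next
    case (step c x y)
    have x: "x \<in> FA \<and> dl x 1 \<in> N"
      using step(1)
    proof
      assume "x \<in> I"
      then show ?thesis using I_FA dl_coset[of x 0 1] dl_zero[of 1] by auto
    next
      assume "x \<in> {a * (gen x - fscale (\<xi> x) 1) | a x. a \<in> FA \<and> x \<in> m}"
      then obtain a z where x: "x = a * (gen z - fscale (\<xi> z) 1)" and a: "a \<in> FA" "z \<in> m" by auto
      have z: "gen z \<in> FAm" using a by (auto simp: gen_wd free_alg_def lcarrier_Lm)
      then have zF: "gen z \<in> FA" using FAm_FA by auto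
      have ch: "ch (gen z) = \<xi> z" by (simp add: ch_fev gen_wd)
      have "dl (a * gen z) 1 - dl a (\<xi> z) \<in> N" using N_rel(5)[OF a(1) z, of 1] by (simp add: ch)
      from N_add[OF this dl_scalar[OF a(1), of "\<xi> z"]] have "cls (a * gen z) = cls (fscale (\<xi> z) a)"
        by (simp flip: cls_cong)
      then show ?thesis using a zF
        by (subst (asm) cls_diff) (auto simp: x right_diff_distrib fscale_mult_right intro!: FA_mult FA_fscale FA_diff)
    qed
    have 1: "dl (fscale c x + y) 1 - dl (fscale c x) 1 - dl y 1 \<in> N"
      using x step(2) by (intro N_rel FA_fscale) auto
    have 2: "dl (fscale c x) 1 - fscale c (dl x 1) \<in> N" using x by (intro N_rel) auto
    have 3: "fscale c (dl x 1) \<in> N" using x N_fscale by auto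
    have "dl (fscale c x + y) 1 \<in> N"
      using N_add[OF N_add[OF 1 N_add[OF 2 3]] conjunct2[OF step(2)]] by simp
    then show ?case using x step(2) by (auto intro: FA_add FA_fscale)
  qed
  then show ?thesis ..
qed

text \<open>
  The map in the other direction, $a \otimes z \mapsto za$, which is linear and well defined modulo
  \<open>J\<close> whatever representatives of the cosets are chosen.
\<close>

definition rep :: "('a list \<Rightarrow>\<^sub>0 complex) set \<Rightarrow> ('a list \<Rightarrow>\<^sub>0 complex)" where
  "rep X = (SOME a. a \<in> X)"

lemma rep_coset: "rep (a +o I) - a \<in> I"
proof -
  have "\<exists>z. z \<in> a +o I" using I_zero by (auto simp: elt_set_plus_def)
  then have "rep (a +o I) \<in> a +o I" unfolding rep_def by (rule someI_ex)
  then show ?thesis by (auto simp: elt_set_plus_def)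
qed

definition contract :: "(('a list \<Rightarrow>\<^sub>0 complex) set \<times> complex \<Rightarrow>\<^sub>0 complex) \<Rightarrow> ('a list \<Rightarrow>\<^sub>0 complex)"
  where "contract = flin (\<lambda>(X, z). fscale z (rep X))"

lemma contract_dl: "contract (dl a z) - fscale z a \<in> J"
  using J_fscale[OF I_J[OF rep_coset[of a]], of z]
  by (simp add: contract_def dl_def fs.scale_right_diff_distrib)

lemma contract_simps: "contract (s + t) = contract s + contract t" "contract (s - t) = contract s - contract t"
   "contract (fscale d t) = fscale d (contract t)" "contract 0 = 0"
  by (simp_all add: contract_def flin_add flin_diff flin_fscale)

lemma J_triv: "a \<in> J \<Longrightarrow> a = c \<Longrightarrow> c \<in> J" by simp

lemma contract_N: assumes "t \<in> N" shows "contract t \<in> J"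
  using assms
proof (induction t rule: fs.span_induct_alt)
  case base then show ?case by (simp add: contract_simps J_zero)
next
  case (step e x y)
  have "contract x \<in> J"
    using step(1) unfolding Q_relations_eq
  proof (elim UnE CollectE exE conjE)
    fix a c z assume x: "x = dl (a + c) z - dl a z - dl c z"
    show ?thesis unfolding x
      by (rule J_triv[OF J_diff[OF J_diff[OF contract_dl[of "a + c" z] contract_dl[of a z]] contract_dl[of c z]]])
        (simp add: contract_simps fs.scale_right_distrib)
  next
    fix a z z' assume x: "x = dl a (z + z') - dl a z - dl a z'"
    show ?thesis unfolding x
      by (rule J_triv[OF J_diff[OF J_diff[OF contract_dl[of a "z + z'"] contract_dl[of a z]] contract_dl[of a z']]])
        (simp add: contract_simps fs.scale_left_distrib)
  next
    fix d a z assume x: "x = dl (fscale d a) z - fscale d (dl a z)"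
    show ?thesis unfolding x
      by (rule J_triv[OF J_diff[OF contract_dl[of "fscale d a" z] J_fscale[OF contract_dl[of a z], of d]]])
        (simp add: contract_simps fs.scale_right_diff_distrib mult.commute)
  next
    fix d a z assume x: "x = dl a (d * z) - fscale d (dl a z)"
    show ?thesis unfolding x
      by (rule J_triv[OF J_diff[OF contract_dl[of a "d * z"] J_fscale[OF contract_dl[of a z], of d]]])
        (simp add: contract_simps fs.scale_right_diff_distrib)
  next
    fix a y' z assume x: "x = dl (a * y') z - dl a (ch y' * z)" and a: "a \<in> FA" "y' \<in> FAm"
    show ?thesis unfolding x
      by (rule J_triv[OF J_add[OF J_diff[OF contract_dl[of "a * y'" z] contract_dl[of a "ch y' * z"]]
           J_fscale[OF J_char[OF a], of z]]])
        (simp add: contract_simps fs.scale_right_diff_distrib mult.commute)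
  qed
  then show ?case using step(2) by (auto simp: contract_simps intro: J_add J_fscale)
qed

lemma cls_eq: assumes "a \<in> FA" "c \<in> FA" shows "cls a = cls c \<longleftrightarrow> a - c \<in> J"
proof
  assume "cls a = cls c"
  then have "contract (dl (a - c) 1) \<in> J" using contract_N cls_diff[OF assms] by auto
  from J_diff[OF this contract_dl[of "a - c" 1]] show "a - c \<in> J" by simp
next
  assume "a - c \<in> J"
  then show "cls a = cls c" using J_N cls_diff[OF assms] by auto
qed

lemma Q_simps:
  "scarrier Q = (\<lambda>t. t +o N) ` {t. Poly_Mapping.keys t \<subseteq> scarrier (uea L) \<times> UNIV}"
  "sadd Q = (+)" "sscale Q = (\<lambda>c X. fscale c ` X + N)"
  "spart Q = (\<lambda>p. (\<lambda>t. t +o N) ` fspan {Poly_Mapping.single (X, z) 1 | X z q r.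
     X \<in> spart (uea L) q \<and> z \<in> spart even_line r \<and> q + r = p})"
  by (simp_all add: Q_module_def tensor_def fquotient_def Q_relations_def even_line_def)

lemma cls_add: assumes "a \<in> FA" "c \<in> FA" shows "sadd Q (cls a) (cls c) = cls (a + c)"
proof -
  have "(dl a 1 + dl c 1) +o N = dl (a + c) 1 +o N"
    unfolding coset_eq_iff[OF subspace_N]
    using N_fscale[OF N_rel(1)[OF assms, of 1], of "-1"] by (simp add: algebra_simps)
  then show ?thesis by (simp add: Q_simps cls_def coset_add[OF subspace_N])
qed

lemma cls_scale: assumes "a \<in> FA" shows "sscale Q d (cls a) = cls (fscale d a)"
proof -
  have "fscale d (dl a 1) +o N = dl (fscale d a) 1 +o N"
    unfolding coset_eq_iff[OF subspace_N]
    using N_fscale[OF N_rel(3)[OF assms, of d 1], of "-1"] by (simp add: algebra_simps)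
  then show ?thesis by (simp add: Q_simps cls_def coset_scale[OF subspace_N])
qed

lemma cls_combine:
  assumes "a \<in> FA" "c \<in> FA" "s +o N = cls a" "t +o N = cls c"
  shows "(s + t) +o N = cls (a + c)" "fscale d s +o N = cls (fscale d a)"
  using cls_add[OF assms(1,2)] cls_scale[OF assms(1), of d]
  unfolding assms(3,4)[symmetric] Q_simps(2,3) coset_add[OF subspace_N] coset_scale[OF subspace_N] .

lemma Q_carrier: "scarrier Q = cls ` FA"
proof
  show "cls ` FA \<subseteq> scarrier Q"
    unfolding Q_simps cls_def dl_def by (auto simp: uea_simps)
  have "\<exists>a\<in>FA. t +o N = cls a" if "Poly_Mapping.keys t \<subseteq> scarrier (uea L) \<times> UNIV" for t
    using that
  proof (induction t rule: keys_induct)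
    case zero
    have "0 +o N = cls 0" unfolding cls_def coset_eq_iff[OF subspace_N]
      using N_diff[OF N_zero dl_zero] by simp
    then show ?case using FA_zero by blast
  next
    case (add s t)
    then show ?case using cls_combine(1) FA_add by metis
  next
    case (single k e)
    then obtain a z where k: "k = (a +o I, z)" and a: "a \<in> FA" by (auto simp: uea_simps)
    have "dl a z +o N = cls (fscale z a)"
      unfolding cls_def coset_eq_iff[OF subspace_N] by (rule dl_scalar[OF a])
    then have "fscale e (dl a z) +o N = cls (fscale e (fscale z a))"
      using cls_combine(2) FA_fscale[OF a] by blast
    then show ?case using FA_fscale a unfolding k dl_def by (metis fscale_single mult.right_neutral)
  qed
  then show "scarrier Q \<subseteq> cls ` FA" unfolding Q_simps by blast
qed

lemma Q_part: "spart Q p = cls ` fspan (homogeneous_words L p)"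
proof
  show "cls ` fspan (homogeneous_words L p) \<subseteq> spart Q p"
  proof safe
    fix a assume "a \<in> fspan (homogeneous_words L p)"
    then have "dl a 1 \<in> fspan {Poly_Mapping.single (X, z) 1 | X z q r.
        X \<in> spart (uea L) q \<and> z \<in> spart even_line r \<and> q + r = p}"
      unfolding dl_def uea_simps even_line_def
      by (intro fs.span_base CollectI exI[of _ "a +o I"] exI[of _ "1::complex"] exI[of _ p] exI[of _ "0::bit"]) auto
    then show "cls a \<in> spart Q p" unfolding Q_simps cls_def by blast
  qed
  let ?H = "fspan (homogeneous_words L p)"
  have H: "a \<in> ?H \<Longrightarrow> a \<in> FA" for a using Sg_hom by blast
  have "\<exists>a\<in>?H. t +o N = cls a" if "t \<in> fspan {Poly_Mapping.single (X, z) 1 | X z q r.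
        X \<in> spart (uea L) q \<and> z \<in> spart even_line r \<and> q + r = p}" for t
    using that
  proof (induction t rule: fs.span_induct_alt)
    case base
    have "0 +o N = cls 0" unfolding cls_def coset_eq_iff[OF subspace_N]
      using N_diff[OF N_zero dl_zero] by simp
    then show ?case using fs.span_zero by blast
  next
    case (step e x y)
    then obtain X z q r a' where x: "x = Poly_Mapping.single (X, z) 1" "X \<in> spart (uea L) q"
      "z \<in> spart even_line r" "q + r = p" and a': "a' \<in> ?H" "y +o N = cls a'" by blast
    then obtain a where X: "X = a +o I" "a \<in> fspan (homogeneous_words L q)" by (auto simp: uea_simps)
    then have a: "a \<in> FA" using Sg_hom by blast
    have eq: "x +o N = cls (fscale z a)"
      unfolding x X(1) dl_def[symmetric] cls_def coset_eq_iff[OF subspace_N] by (rule dl_scalar[OF a])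
    have h: "fscale z a \<in> ?H"
      using x(3,4) X(2) by (cases r) (auto simp: even_line_def fs.span_zero fs.span_scale)
    have "fscale e (fscale z a) + a' \<in> ?H"
      by (rule fs.span_add[OF fs.span_scale[OF h] a'(1)])
    moreover have "(fscale e x + y) +o N = cls (fscale e (fscale z a) + a')"
      using cls_combine(2)[OF FA_fscale[OF a] FA_fscale[OF a] eq eq] a'
      by (intro cls_combine(1) FA_fscale a H)
    ultimately show ?case by blast
  qed
  then show "spart Q p \<subseteq> cls ` ?H" unfolding Q_simps by blast
qed

lemma Q_act: assumes "x \<in> G" "a \<in> FA" shows "act x (cls a) = cls (gen x * a)"
proof -
  let ?g = "\<lambda>(X, z). (smult (uea L) (uea_gen L x) X, z)"
  have g: "fextend ?g (dl a z) = dl (gen x * a) z" if "a \<in> FA" for a z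
    using that assms uea_ops(3)[of "gen x" a] by (simp add: dl_def uea_gen_def)
  have "fextend ?g t \<in> N" if "t \<in> N" for t
    using that
  proof (induction t rule: fs.span_induct_alt)
    case base then show ?case by (simp add: N_zero)
  next
    case (step e r y)
    have gF: "gen x * a \<in> FA" if "a \<in> FA" for a using that assms by (auto intro: FA_mult)
    have "fextend ?g r \<in> N"
      using step(1)[unfolded Q_relations_eq]
    proof (elim UnE CollectE exE conjE)
      fix a c z assume "r = dl (a + c) z - dl a z - dl c z" "a \<in> FA" "c \<in> FA"
      then show ?thesis using N_rel(1)[OF gF gF, of a c z]
        by (simp add: fextend_diff g FA_add distrib_left)
    next
      fix a z z' assume "r = dl a (z + z') - dl a z - dl a z'" "a \<in> FA"
      then show ?thesis using N_rel(2)[OF gF, of a z z'] by (simp add: fextend_diff g)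
    next
      fix d a z assume "r = dl (fscale d a) z - fscale d (dl a z)" "a \<in> FA"
      then show ?thesis using N_rel(3)[OF gF, of a d z]
        by (simp add: fextend_diff fextend_fscale g FA_fscale fscale_mult_right)
    next
      fix d a z assume "r = dl a (d * z) - fscale d (dl a z)" "a \<in> FA"
      then show ?thesis using N_rel(4)[OF gF, of a d z]
        by (simp add: fextend_diff fextend_fscale g)
    next
      fix a y' z assume "r = dl (a * y') z - dl a (ch y' * z)" "a \<in> FA" "y' \<in> FAm"
      then show ?thesis using N_rel(5)[OF gF, of a y' z] FAm_FA
        by (auto simp: fextend_diff g FA_mult mult.assoc subset_iff)
    qed
    then show ?case using step(2) by (auto simp: fextend_add fextend_fscale intro: N_add N_fscale)
  qed
  from coset_image[OF subspace_N this] show ?thesis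
    unfolding Q_action_def cls_def using g[OF assms(2)] by simp
qed

end

section \<open>The two-dimensional representation\<close>

context split_lie_super
begin

abbreviation "H p \<equiv> fspan (homogeneous_words L p)"

lemma H_FA: "a \<in> H p \<Longrightarrow> a \<in> FA"
  using Sg_hom by blast

lemma H_Cons: assumes "x \<in> P p" "a \<in> H q" shows "gen x * a \<in> H (p + q)"
  using assms(2)
proof (induction a rule: fs.span_induct_alt)
  case base then show ?case by (simp add: fs.span_zero)
next
  case (step c y z)
  then obtain w ps where "y = wd w" "list_all2 (\<lambda>x q. x \<in> P q) w ps" "sum_list ps = q"
    by (auto simp: homogeneous_words_def)
  then have "gen x * y \<in> homogeneous_words L (p + q)"
    unfolding homogeneous_words_def using assms(1)
    by (auto simp: gen_wd wd_mult intro!: exI[of _ "x # w"] exI[of _ "p # ps"])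
  from fs.span_add[OF fs.span_scale[OF fs.span_base[OF this]] step(2)] show ?case
    by (simp add: distrib_left fscale_mult_right)
qed

lemma H_decompose: assumes "a \<in> FA" shows "\<exists>a0\<in>H 0. \<exists>a1\<in>H 1. a - (a0 + a1) \<in> I"
  using assms
proof (induction a rule: FA_induct)
  case zero show ?case using I_zero fs.span_zero by (intro bexI[of _ 0]) auto
next
  case (add a c)
  then obtain a0 a1 c0 c1 where "a0 \<in> H 0" "c0 \<in> H 0" "a1 \<in> H 1" "c1 \<in> H 1"
    "a - (a0 + a1) \<in> I" "c - (c0 + c1) \<in> I" by blast
  then show ?case using I_add[of "a - (a0 + a1)" "c - (c0 + c1)"]
    by (intro bexI[of _ "a0 + c0"] bexI[of _ "a1 + c1"] fs.span_add) (auto simp: algebra_simps)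
next
  case (scale d a)
  then obtain a0 a1 where "a0 \<in> H 0" "a1 \<in> H 1" "a - (a0 + a1) \<in> I" by blast
  then show ?case using I_fscale[of "a - (a0 + a1)" d]
    by (intro bexI[of _ "fscale d a0"] bexI[of _ "fscale d a1"] fs.span_scale)
      (auto simp: fs.scale_right_diff_distrib fs.scale_right_distrib)
next
  case (word w)
  then show ?case
  proof (induction w)
    case Nil
    have "wd [] \<in> H 0" by (intro fs.span_base) (auto simp: homogeneous_words_def)
    then show ?case using I_zero fs.span_zero by (intro bexI[of _ "wd []"] bexI[of _ 0]) auto
  next
    case (Cons x w)
    then obtain a0 a1 where a: "a0 \<in> H 0" "a1 \<in> H 1" "wd w - (a0 + a1) \<in> I" by auto
    have x: "x \<in> G" "set w \<subseteq> G" using Cons by auto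
    have "wd ([] @ (pc 0 x + pc 1 x) # w) - wd ([] @ pc 0 x # w) - wd ([] @ pc 1 x # w) \<in> I"
      using x by (intro word_add) auto
    then have 1: "wd (x # w) - gen (pc 0 x) * wd w - gen (pc 1 x) * wd w \<in> I"
      using pc_sum[OF x(1)] by (simp add: gen_wd wd_mult)
    have 2: "gen (pc p x) * (wd w - (a0 + a1)) \<in> I" for p using x a by (intro I_left) auto
    let ?b0 = "gen (pc 0 x) * a0 + gen (pc 1 x) * a1" and ?b1 = "gen (pc 0 x) * a1 + gen (pc 1 x) * a0"
    have "wd (x # w) - (?b0 + ?b1) \<in> I"
      using I_add[OF I_add[OF 1 2[of 0]] 2[of 1]] by (simp add: algebra_simps)
    moreover have "?b0 \<in> H 0" "?b1 \<in> H 1"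
      using H_Cons[OF pc_P[OF x(1)] a(1), of 0] H_Cons[OF pc_P[OF x(1)] a(2), of 0]
         H_Cons[OF pc_P[OF x(1)] a(1), of 1] H_Cons[OF pc_P[OF x(1)] a(2), of 1]
      by (auto intro: fs.span_add)
    ultimately show ?case by blast
  qed
qed

text \<open>
  The value of a functional on a class in $Q_\chi$. The choice of the representative does not matter
  for functionals vanishing on \<open>J\<close>.
\<close>

definition ph :: "('a list \<Rightarrow> complex) \<Rightarrow> (('a list \<Rightarrow>\<^sub>0 complex) set \<times> complex \<Rightarrow>\<^sub>0 complex) set \<Rightarrow> complex"
  where "ph f T = ev f (SOME a. a \<in> FA \<and> cls a = T)"

lemma ph_cls: assumes "whittaker f" "a \<in> FA" shows "ph f (cls a) = ev f a"
proof -
  let ?c = "SOME c. c \<in> FA \<and> cls c = cls a"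
  have c: "?c \<in> FA \<and> cls ?c = cls a" by (rule someI[of _ a]) (use assms in auto)
  then have "?c - a \<in> J" using cls_eq assms by auto
  then have "ev f (?c - a) = 0" by (rule ev_J[OF assms(1)])
  then show ?thesis by (simp add: ph_def ev_simps)
qed

abbreviation "C \<equiv> scarrier Q"
abbreviation "En \<equiv> endo_part L Q act"
abbreviation "EA \<equiv> endo_algebra L Q act"

lemma ph_add: "whittaker f \<Longrightarrow> S \<in> C \<Longrightarrow> T \<in> C \<Longrightarrow> ph f (sadd Q S T) = ph f S + ph f T"
  and ph_scale: "whittaker f \<Longrightarrow> S \<in> C \<Longrightarrow> ph f (sscale Q d S) = d * ph f S"
  unfolding Q_carrier by (auto simp: cls_add cls_scale ph_cls FA_add FA_fscale ev_simps)

lemma C_add: "S \<in> C \<Longrightarrow> T \<in> C \<Longrightarrow> sadd Q S T \<in> C"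
  and C_scale: "S \<in> C \<Longrightarrow> sscale Q d S \<in> C"
  unfolding Q_carrier by (auto simp: cls_add cls_scale FA_add FA_fscale)

lemma EnD:
  assumes "F \<in> En p"
  shows "S \<in> C \<Longrightarrow> F S \<in> C" "S \<in> C \<Longrightarrow> T \<in> C \<Longrightarrow> F (sadd Q S T) = sadd Q (F S) (F T)"
    "S \<in> C \<Longrightarrow> F (sscale Q d S) = sscale Q d (F S)"
    "S \<in> spart Q q \<Longrightarrow> F S \<in> spart Q (p + q)"
    "x \<in> P q \<Longrightarrow> S \<in> C \<Longrightarrow> F (act x S) = sscale Q (ksign p q) (act x (F S))"
    "F \<in> extensional C"
proof -
  have "F \<in> C \<rightarrow>\<^sub>E C" and lin: "slinear Q Q F" and p: "\<And>q. F ` spart Q q \<subseteq> spart Q (p + q)"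
    and a: "\<And>q x w. x \<in> P q \<Longrightarrow> w \<in> C \<Longrightarrow> F (act x w) = sscale Q (ksign p q) (act x (F w))"
    using assms unfolding endo_part_def by simp_all
  then show "S \<in> C \<Longrightarrow> F S \<in> C" "F \<in> extensional C"
    "x \<in> P q \<Longrightarrow> S \<in> C \<Longrightarrow> F (act x S) = sscale Q (ksign p q) (act x (F S))"
    by (auto simp: PiE_def)
  show "S \<in> C \<Longrightarrow> T \<in> C \<Longrightarrow> F (sadd Q S T) = sadd Q (F S) (F T)"
    "S \<in> C \<Longrightarrow> F (sscale Q d S) = sscale Q d (F S)"
    using lin unfolding slinear_def by simp_all
  show "S \<in> spart Q q \<Longrightarrow> F S \<in> spart Q (p + q)" using p[of q] by blast
qed

abbreviation "q0 \<equiv> cls 1"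
abbreviation "q1 \<equiv> cls (gen \<Theta>)"

lemma q_C: "q0 \<in> C" "q1 \<in> C" unfolding Q_carrier by auto

lemma q_part: "q0 \<in> spart Q 0" "q1 \<in> spart Q 1"
proof -
  have "1 \<in> H 0" unfolding one_wd by (intro fs.span_base) (auto simp: homogeneous_words_def)
  moreover have "gen \<Theta> \<in> H 1" unfolding gen_wd using Theta_odd
    by (intro fs.span_base) (auto simp: homogeneous_words_def intro!: exI[of _ "[\<Theta>]"] exI[of _ "[1]"])
  ultimately show "q0 \<in> spart Q 0" "q1 \<in> spart Q 1" unfolding Q_part by auto
qed

text \<open>
  The map \<open>F\<close> acts on the coinvariants, in the dual bases given by \<open>q0\<close>, \<open>q1\<close> and \<open>phi0\<close>, \<open>phi1\<close>.
  Its matrix is then multiplicative.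
\<close>

definition coinv :: "_ \<Rightarrow> bool" where
  "coinv F \<longleftrightarrow> (\<forall>S\<in>C. F S \<in> C) \<and> (\<forall>f\<in>{phi0, phi1}. \<forall>S\<in>C.
     ph f (F S) = ph phi0 S * ph f (F q0) + ph phi1 S * ph f (F q1))"

lemma coinvD:
  assumes "coinv F"
  shows "S \<in> C \<Longrightarrow> F S \<in> C"
    "f \<in> {phi0, phi1} \<Longrightarrow> S \<in> C \<Longrightarrow> ph f (F S) = ph phi0 S * ph f (F q0) + ph phi1 S * ph f (F q1)"
  using assms unfolding coinv_def by blast+

text \<open>
  The equation in question is linear, and it holds at \<open>1\<close>, at \<open>\<Theta>\<close> and on \<open>b U\<close>, because \<open>F\<close>
  supercommutes with \<open>b\<close>; these elements exhaust the module.
\<close>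

lemma coinv_En: assumes "F \<in> En p" shows "coinv F"
proof -
  note F = EnD[OF assms]
  have main: "ph f (F (cls a)) = ev phi0 a * ph f (F q0) + ev phi1 a * ph f (F q1)"
    if f: "whittaker f" and a: "a \<in> FA" for f a
  proof -
    let ?Y = "{a \<in> FA. ph f (F (cls a)) = ev phi0 a * ph f (F q0) + ev phi1 a * ph f (F q1)}"
    have cl: "cls a \<in> C" if "a \<in> FA" for a using that Q_carrier by auto
    have z: "ph f (F (cls a)) = 0" if "a \<in> J" for a
    proof -
      have "cls a = cls (fscale 0 1)" using that J_FA by (subst cls_eq) auto
      also have "\<dots> = sscale Q 0 (cls 1)" by (subst cls_scale) auto
      finally show ?thesis using F(1,3) q_C by (simp add: ph_scale[OF f])
    qed
    have "a \<in> ?Y"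
    proof (rule FA_reduce[OF _ _ _ _ _ a])
      show "fs.subspace ?Y"
      proof (rule fs.subspaceI)
        show "0 \<in> ?Y" using z[OF J_zero] by (simp add: ev_simps)
      next
        fix a c assume "a \<in> ?Y" "c \<in> ?Y"
        then show "a + c \<in> ?Y"
          using F(2)[OF cl cl, of a c] F(1)
          by (auto simp: FA_add ev_simps ph_add[OF f] cl algebra_simps simp flip: cls_add)
      next
        fix a c assume "a \<in> ?Y"
        then show "fscale c a \<in> ?Y"
          using F(3)[OF cl, of a c] F(1)
          by (auto simp: FA_fscale ev_simps ph_scale[OF f] cl algebra_simps simp flip: cls_scale)
      qed
      show "J \<subseteq> ?Y" using z J_FA ev_J whittaker_phi by auto
      show "1 \<in> ?Y" by (simp add: one_wd ev_simps phi_values)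
      show "gen \<Theta> \<in> ?Y" by (simp add: gen_wd ev_simps phi_values)
      fix x a q assume x: "x \<in> b" "x \<in> P q" and a: "a \<in> FA"
      obtain c where c: "c \<in> FA" "F (cls a) = cls c" using F(1)[OF cl[OF a]] Q_carrier by auto
      have G: "x \<in> G" using x P_G by auto
      have ga: "gen x * a \<in> FA" "gen x * c \<in> FA" using a c G by (auto intro: FA_mult)
      have "F (cls (gen x * a)) = sscale Q (ksign p q) (cls (gen x * c))"
        using F(5)[OF x(2) cl[OF a]] c a G by (simp add: Q_act)
      then have "ph f (F (cls (gen x * a))) = 0"
        using ga cl by (simp add: ph_scale[OF f] ph_cls[OF f] ev_b[OF f x(1) c(1)])
      then show "gen x * a \<in> ?Y" using ga ev_b whittaker_phi x a by simp
    qed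
    then show ?thesis by simp
  qed
  show ?thesis unfolding coinv_def
  proof (intro conjI ballI)
    fix f S assume "f \<in> {phi0, phi1}" and S: "S \<in> C"
    then have f: "whittaker f" using whittaker_phi by auto
    obtain a where a: "a \<in> FA" "S = cls a" using S Q_carrier by auto
    show "ph f (F S) = ph phi0 S * ph f (F q0) + ph phi1 S * ph f (F q1)"
      using main[OF f a(1)] unfolding a(2) ph_cls[OF whittaker_phi(1) a(1)] ph_cls[OF whittaker_phi(2) a(1)] .
  qed (rule F(1))
qed

lemma EA_simps:
  "spart EA = En" "sadd EA = (\<lambda>F G. \<lambda>w\<in>C. sadd Q (F w) (G w))"
  "sscale EA = (\<lambda>c F. \<lambda>w\<in>C. sscale Q c (F w))" "smult EA = compose C" "sone EA = (\<lambda>w\<in>C. w)"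
  "scarrier EA = {\<lambda>w\<in>C. sadd Q (F w) (G w) | F G. F \<in> En 0 \<and> G \<in> En 1}"
  by (simp_all add: endo_algebra_def)

lemma coinv_add: assumes "coinv F" "coinv F'" shows "coinv (\<lambda>w\<in>C. sadd Q (F w) (F' w))"
proof -
  note F = coinvD[OF assms(1)] and K = coinvD[OF assms(2)]
  show ?thesis unfolding coinv_def
  proof (intro conjI ballI)
    fix f S assume f: "f \<in> {phi0, phi1}" and S: "S \<in> C"
    then have w: "whittaker f" using whittaker_phi by auto
    show "ph f ((\<lambda>w\<in>C. sadd Q (F w) (F' w)) S) =
      ph phi0 S * ph f ((\<lambda>w\<in>C. sadd Q (F w) (F' w)) q0) + ph phi1 S * ph f ((\<lambda>w\<in>C. sadd Q (F w) (F' w)) q1)"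
      unfolding restrict_apply'[OF S] restrict_apply'[OF q_C(1)] restrict_apply'[OF q_C(2)]
        ph_add[OF w F(1)[OF S] K(1)[OF S]] ph_add[OF w F(1)[OF q_C(1)] K(1)[OF q_C(1)]]
        ph_add[OF w F(1)[OF q_C(2)] K(1)[OF q_C(2)]] F(2)[OF f S] K(2)[OF f S]
      by (simp add: distrib_left)
  qed (use F(1) K(1) in \<open>auto intro: C_add\<close>)
qed

lemma coinv_EA: "F \<in> scarrier EA \<Longrightarrow> coinv F"
  unfolding EA_simps by (auto intro: coinv_add coinv_En)

lemma cls_H_eq:
  assumes "a \<in> H p" "a' \<in> H p" "c \<in> H (p + 1)" "c' \<in> H (p + 1)"
    "sadd Q (cls a) (cls c) = sadd Q (cls a') (cls c')"
  shows "cls a = cls a'"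
proof -
  note FA = assms(1-4)[THEN H_FA]
  have "(a + c) - (a' + c') \<in> J" using assms(5) FA by (simp add: cls_add cls_eq FA_add)
  then have "(a - a') - (c' - c) \<in> J" by (simp add: algebra_simps)
  then have "a - a' \<in> J" by (rule J_graded[OF fs.span_diff[OF assms(1,2)] fs.span_diff[OF assms(4,3)]])
  then show ?thesis using cls_eq[OF FA(1,2)] by simp
qed

text \<open>
  An endomorphism is determined by its values at homogeneous elements, and there the two components
  have values in different parts of $Q_\chi$, which meet in zero.
\<close>

lemma En_unique:
  assumes "F \<in> En p" "F' \<in> En p" "K \<in> En (p + 1)" "K' \<in> En (p + 1)"
    "\<And>S. S \<in> C \<Longrightarrow> sadd Q (F S) (K S) = sadd Q (F' S) (K' S)"
  shows "F = F'"
proof (rule extensionalityI[OF EnD(6)[OF assms(1)] EnD(6)[OF assms(2)]])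
  fix S assume "S \<in> C"
  then obtain a where a: "a \<in> FA" "S = cls a" using Q_carrier by auto
  obtain a0 a1 where h: "a0 \<in> H 0" "a1 \<in> H 1" "a - (a0 + a1) \<in> I" using H_decompose[OF a(1)] by blast
  have S: "S = sadd Q (cls a0) (cls a1)"
    using a h H_FA[OF h(1)] H_FA[OF h(2)] I_J by (auto simp: cls_add cls_eq FA_add)
  have eq: "F (cls c) = F' (cls c)" if "c \<in> H t" for c t
  proof -
    have cC: "cls c \<in> C" and cp: "cls c \<in> spart Q t" using that H_FA Q_carrier Q_part by auto
    obtain f f' k k' where "f \<in> H (p + t)" "f' \<in> H (p + t)" "k \<in> H (p + t + 1)" "k' \<in> H (p + t + 1)"
      "F (cls c) = cls f" "F' (cls c) = cls f'" "K (cls c) = cls k" "K' (cls c) = cls k'"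
      using EnD(4)[OF assms(1) cp] EnD(4)[OF assms(2) cp] EnD(4)[OF assms(3) cp] EnD(4)[OF assms(4) cp]
      unfolding Q_part by (auto simp: add.commute add.left_commute)
    then show ?thesis using cls_H_eq[of f "p + t" f' k k'] assms(5)[OF cC] by simp
  qed
  show "F S = F' S" unfolding S
    using EnD(2)[OF assms(1), of "cls a0" "cls a1"] EnD(2)[OF assms(2), of "cls a0" "cls a1"]
      eq[OF h(1)] eq[OF h(2)] H_FA[OF h(1)] H_FA[OF h(2)] Q_carrier by auto
qed

lemma scomponent_EA:
  assumes "F \<in> En 0" "K \<in> En 1"
  shows "scomponent EA 0 (\<lambda>w\<in>C. sadd Q (F w) (K w)) = F"
    "scomponent EA 1 (\<lambda>w\<in>C. sadd Q (F w) (K w)) = K"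
proof -
  have comm: "sadd Q S T = sadd Q T S" for S T by (simp add: Q_simps add.commute)
  have eqD: "sadd Q (A S) (A' S) = sadd Q (D S) (D' S)"
    if "(\<lambda>w\<in>C. sadd Q (A w) (A' w)) = (\<lambda>w\<in>C. sadd Q (D w) (D' w))" "S \<in> C" for A A' D D' S
    using fun_cong[OF that(1), of S] that(2) by simp
  show "scomponent EA 0 (\<lambda>w\<in>C. sadd Q (F w) (K w)) = F"
    unfolding scomponent_def EA_simps
  proof (rule the_equality)
    show "F \<in> En 0 \<and> (\<exists>w'\<in>En (0 + 1). (\<lambda>w\<in>C. sadd Q (F w) (K w)) = (\<lambda>w\<in>C. sadd Q (F w) (w' w)))"
      using assms by auto
    fix F' assume "F' \<in> En 0 \<and> (\<exists>w'\<in>En (0 + 1). (\<lambda>w\<in>C. sadd Q (F w) (K w)) = (\<lambda>w\<in>C. sadd Q (F' w) (w' w)))"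
    then obtain K' where F': "F' \<in> En 0" "K' \<in> En (0 + 1)"
      "(\<lambda>w\<in>C. sadd Q (F w) (K w)) = (\<lambda>w\<in>C. sadd Q (F' w) (K' w))" by blast
    have "K \<in> En (0 + 1)" using assms by simp
    then show "F' = F"
      by (rule En_unique[OF F'(1) assms(1) F'(2) _ eqD[OF F'(3)[symmetric]]])
  qed
  show "scomponent EA 1 (\<lambda>w\<in>C. sadd Q (F w) (K w)) = K"
    unfolding scomponent_def EA_simps
  proof (rule the_equality)
    show "K \<in> En 1 \<and> (\<exists>w'\<in>En (1 + 1). (\<lambda>w\<in>C. sadd Q (F w) (K w)) = (\<lambda>w\<in>C. sadd Q (K w) (w' w)))"
      using assms comm by auto
    fix K' assume "K' \<in> En 1 \<and> (\<exists>w'\<in>En (1 + 1). (\<lambda>w\<in>C. sadd Q (F w) (K w)) = (\<lambda>w\<in>C. sadd Q (K' w) (w' w)))"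
    then obtain F' where F': "K' \<in> En 1" "F' \<in> En (1 + 1)"
      "(\<lambda>w\<in>C. sadd Q (F w) (K w)) = (\<lambda>w\<in>C. sadd Q (K' w) (F' w))" by blast
    have "sadd Q (K' S) (F' S) = sadd Q (K S) (F S)" if "S \<in> C" for S
      using eqD[OF F'(3) that] comm by simp
    moreover have "F \<in> En (1 + 1)" using assms by simp
    ultimately show "K' = K" using En_unique[OF F'(1) assms(2) F'(2)] by blast
  qed
qed

text \<open>
  The action on the dual of the coinvariants is $a \cdot \phi = (-1)^{|a||\phi|} \phi \circ a$. In the
  basis \<open>phi0\<close>, \<open>phi1\<close> it is the transpose of the matrix of \<open>a\<close>, with the sign reversed where an
  odd map is applied to the odd functional.
\<close>

definition m00 where "m00 F = ph phi0 (F q0)"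
definition m01 where "m01 F = ph phi0 (F q1)"
definition m10 where "m10 F = ph phi1 (F q0)"
definition m11 where "m11 F = ph phi1 (F q1)"

definition wact :: "_ \<Rightarrow> complex ^ 2 \<Rightarrow> complex ^ 2" where
  "wact F v = vector [m00 F * v $ 1 - m10 F * v $ 2, m01 F * v $ 1 + m11 F * v $ 2]"

definition wpart :: "bit \<Rightarrow> (complex ^ 2) set" where
  "wpart p = (if p = 0 then {v. v $ 2 = 0} else {v. v $ 1 = 0})"

lemmas mdefs = m00_def m01_def m10_def m11_def

lemma m_add:
  assumes "coinv F" "coinv K"
  shows "m00 (sadd EA F K) = m00 F + m00 K" "m01 (sadd EA F K) = m01 F + m01 K"
    "m10 (sadd EA F K) = m10 F + m10 K" "m11 (sadd EA F K) = m11 F + m11 K"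
  using q_C whittaker_phi coinvD(1)[OF assms(1)] coinvD(1)[OF assms(2)]
  by (simp_all add: EA_simps mdefs ph_add)

lemma m_scale:
  assumes "coinv F"
  shows "m00 (sscale EA d F) = d * m00 F" "m01 (sscale EA d F) = d * m01 F"
    "m10 (sscale EA d F) = d * m10 F" "m11 (sscale EA d F) = d * m11 F"
  using q_C whittaker_phi coinvD(1)[OF assms(1)] by (simp_all add: EA_simps mdefs ph_scale)

lemma m_mult:
  assumes "coinv F" "coinv K"
  shows "m00 (smult EA F K) = m00 F * m00 K + m01 F * m10 K"
    "m01 (smult EA F K) = m00 F * m01 K + m01 F * m11 K"
    "m10 (smult EA F K) = m10 F * m00 K + m11 F * m10 K"
    "m11 (smult EA F K) = m10 F * m01 K + m11 F * m11 K"
  using q_C coinvD(2)[OF assms(1) _ coinvD(1)[OF assms(2) q_C(1)]]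
    coinvD(2)[OF assms(1) _ coinvD(1)[OF assms(2) q_C(2)]]
  unfolding EA_simps mdefs compose_def by (simp_all add: mult.commute)

lemma coinv_mult: assumes "coinv F" "coinv K" shows "coinv (smult EA F K)"
proof -
  note F = coinvD[OF assms(1)] and K = coinvD[OF assms(2)]
  show ?thesis
    unfolding coinv_def EA_simps
  proof (intro conjI ballI)
    fix S assume "S \<in> C" then show "compose C F K S \<in> C" using F(1) K(1) by (simp add: compose_def)
  next
    fix f S assume f: "f \<in> {phi0, phi1}" and S: "S \<in> C"
    show "ph f (compose C F K S) = ph phi0 S * ph f (compose C F K q0) + ph phi1 S * ph f (compose C F K q1)"
      using S q_C F(2)[OF f K(1)[OF S]] F(2)[OF f K(1)[OF q_C(1)]] F(2)[OF f K(1)[OF q_C(2)]]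
        K(2)[OF _ S, of phi0] K(2)[OF _ S, of phi1]
      by (simp add: compose_def algebra_simps)
  qed
qed

lemma coinv_scale: assumes "coinv F" shows "coinv (sscale EA d F)"
proof -
  note F = coinvD[OF assms]
  show ?thesis unfolding coinv_def EA_simps
  proof (intro conjI ballI)
    fix f S assume f: "f \<in> {phi0, phi1}" and S: "S \<in> C"
    then have w: "whittaker f" using whittaker_phi by auto
    show "ph f ((\<lambda>w\<in>C. sscale Q d (F w)) S) =
      ph phi0 S * ph f ((\<lambda>w\<in>C. sscale Q d (F w)) q0) + ph phi1 S * ph f ((\<lambda>w\<in>C. sscale Q d (F w)) q1)"
      unfolding restrict_apply'[OF S] restrict_apply'[OF q_C(1)] restrict_apply'[OF q_C(2)]
        ph_scale[OF w F(1)[OF S]] ph_scale[OF w F(1)[OF q_C(1)]]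
        ph_scale[OF w F(1)[OF q_C(2)]] F(2)[OF f S]
      by (simp add: distrib_left mult.left_commute)
  qed (use F(1) in \<open>auto intro: C_scale\<close>)
qed

lemma ph_part: assumes "S \<in> spart Q p" shows "p = 1 \<Longrightarrow> ph phi0 S = 0" "p = 0 \<Longrightarrow> ph phi1 S = 0"
  using assms phi_hom whittaker_phi H_FA unfolding Q_part by (auto simp: ph_cls)

lemma m_even: assumes "F \<in> En 0" shows "m01 F = 0" "m10 F = 0"
  using EnD(4)[OF assms q_part(1)] EnD(4)[OF assms q_part(2)] ph_part by (auto simp: mdefs)

lemma m_odd: assumes "F \<in> En 1" shows "m00 F = 0" "m11 F = 0"
  using EnD(4)[OF assms q_part(1)] EnD(4)[OF assms q_part(2)] ph_part by (auto simp: mdefs)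

lemma m_one: "m00 (sone EA) = 1" "m01 (sone EA) = 0" "m10 (sone EA) = 0" "m11 (sone EA) = 1"
  using q_C whittaker_phi by (auto simp: mdefs EA_simps ph_cls one_wd gen_wd ev_simps phi_values)

lemma vec2_eq: "(v :: complex ^ 2) = w \<longleftrightarrow> v $ 1 = w $ 1 \<and> v $ 2 = w $ 2"
  by (auto simp: vec_eq_iff forall_2)

lemma wact_nth [simp]: "wact F v $ 1 = m00 F * v $ 1 - m10 F * v $ 2"
  "wact F v $ 2 = m01 F * v $ 1 + m11 F * v $ 2"
  by (simp_all add: wact_def)

text \<open>
  The opposite product carries a sign for pairs of odd elements. Together with the sign in the action
  it makes the transposed matrices multiplicative in the right order.
\<close>

lemma wact_op_mult:
  assumes "F \<in> scarrier EA" "K \<in> scarrier EA"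
  shows "wact (smult (opposite EA) F K) v = wact F (wact K v)"
proof -
  obtain F0 F1 where F: "F = sadd EA F0 F1" "F0 \<in> En 0" "F1 \<in> En 1"
    using assms(1) unfolding EA_simps by auto
  obtain K0 K1 where K: "K = sadd EA K0 K1" "K0 \<in> En 0" "K1 \<in> En 1"
    using assms(2) unfolding EA_simps by auto
  have comp: "scomponent EA 0 F = F0" "scomponent EA 1 F = F1" "scomponent EA 0 K = K0" "scomponent EA 1 K = K1"
    using scomponent_EA[OF F(2,3)] scomponent_EA[OF K(2,3)] F(1) K(1) by (simp_all add: EA_simps)
  have co: "coinv F0" "coinv F1" "coinv K0" "coinv K1" "coinv F" "coinv K"
    using F K coinv_En coinv_EA assms by auto
  have op: "smult (opposite EA) F K = sadd EA (smult EA K F0) (sadd EA (smult EA K0 F1) (sscale EA (- 1) (smult EA K1 F1)))"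
    by (simp add: opposite_def comp)
  have ca: "coinv (sadd EA A D)" if "coinv A" "coinv D" for A D
    using coinv_add[OF that] by (simp add: EA_simps)
  note ms = m_add m_scale m_mult m_even[OF F(2)] m_odd[OF F(3)] m_even[OF K(2)] m_odd[OF K(3)]
    co ca coinv_mult coinv_scale
  have mF: "m00 F = m00 F0" "m01 F = m01 F1" "m10 F = m10 F1" "m11 F = m11 F0"
    and mK: "m00 K = m00 K0" "m01 K = m01 K1" "m10 K = m10 K1" "m11 K = m11 K0"
    unfolding F(1) K(1) by (simp_all add: ms)
  show ?thesis
    unfolding vec2_eq wact_nth op
    by (simp add: ms mF mK algebra_simps)
qed

lemma wpart_sum: "wpart 0 + wpart 1 = UNIV"
proof -
  have "v \<in> wpart 0 + wpart 1" for v
  proof -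
    have "v = vector [v $ 1, 0] + vector [0, v $ 2]" by (simp add: vec2_eq)
    moreover have "vector [v $ 1, 0] \<in> wpart 0" "vector [0, v $ 2] \<in> wpart 1" by (auto simp: wpart_def)
    ultimately show ?thesis by (metis set_plus_intro)
  qed
  then show ?thesis by auto
qed

lemma wpart_dim: "vec.dim (wpart 0) + vec.dim (wpart 1) = 2"
proof -
  have "wpart 0 = vec.span {axis 1 1}" "wpart 1 = vec.span {axis 2 1}"
    by (auto simp: wpart_def vec.span_singleton vec2_eq axis_def intro: exI[of _ "_ $ 1"] exI[of _ "_ $ 2"])
  moreover have "axis 1 1 \<noteq> (0 :: complex ^ 2)" "axis 2 1 \<noteq> (0 :: complex ^ 2)"
    by (auto simp: axis_eq_0_iff)
  ultimately show ?thesis by simp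
qed

theorem two_dimensional_representation:
  "superrepresentation (finite_W L m \<xi>) wpart wact \<and> vec.dim (wpart 0) + vec.dim (wpart 1) = 2"
proof -
  have op: "scarrier (opposite EA) = scarrier EA" "spart (opposite EA) = spart EA"
    "sadd (opposite EA) = sadd EA" "sscale (opposite EA) = sscale EA" "sone (opposite EA) = sone EA"
    by (simp_all add: opposite_def)
  have "superrepresentation (opposite EA) wpart wact"
    unfolding superrepresentation_def op wpart_sum
  proof (intro conjI allI ballI)
    fix p show "vec.subspace (wpart p)" by (auto simp: wpart_def vec.subspace_def)
  next
    show "wpart 0 \<inter> wpart 1 = {0}" by (auto simp: wpart_def vec2_eq)
  next
    fix p q F v assume "F \<in> spart EA p" "v \<in> wpart q"
    then show "wact F v \<in> wpart (p + q)"
      using m_even[of F] m_odd[of F] by (cases p; cases q) (auto simp: wpart_def EA_simps)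
  next
    fix F K v assume "F \<in> scarrier EA" "K \<in> scarrier EA"
    then show "wact (smult (opposite EA) F K) v = wact F (wact K v)" by (rule wact_op_mult)
    show "wact (sadd EA F K) v = wact F v + wact K v"
      using m_add[of F K] coinv_EA \<open>F \<in> scarrier EA\<close> \<open>K \<in> scarrier EA\<close>
      by (simp add: vec2_eq algebra_simps)
  next
    fix F c v assume "F \<in> scarrier EA"
    then show "wact (sscale EA c F) v = c *s wact F v"
      using m_scale[of F c] coinv_EA by (simp add: vec2_eq algebra_simps)
  qed (simp_all add: vec2_eq m_one algebra_simps)
  then show ?thesis using wpart_dim by (simp add: finite_W_def)
qed

end

section \<open>Weight decompositions of sl2-modules\<close>

text \<open>
  The operator is the identity up to terms of a higher order in \<open>A\<close>, so a preimage is built up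
  along the kernels of the powers of \<open>A\<close>.
\<close>

lemma (in module) unipotent_surj:
  assumes add: "\<And>x y. A (x + y) = A x + A y" and scal: "\<And>c x. A (scale c x) = scale c (A x)"
    and nil: "\<And>x. (A ^^ M) x = 0"
    and V: "subspace V" "\<And>x. x \<in> V \<Longrightarrow> A x \<in> V" and c0: "c 0 = 1" and x: "x \<in> V"
  shows "\<exists>y\<in>V. (\<Sum>a\<le>M. scale (c a) ((A ^^ a) y)) = x"
proof -
  define T where "T y = (\<Sum>a\<le>M. scale (c a) ((A ^^ a) y))" for y
  have pow: "(A ^^ a) (y + z) = (A ^^ a) y + (A ^^ a) z" "(A ^^ a) (scale d y) = scale d ((A ^^ a) y)" for a d y z
    by (induction a) (auto simp: add scal)
  have pow0: "(A ^^ a) 0 = 0" for a using pow(2)[of a 0 0] by simp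
  have pow_sum: "(A ^^ j) (sum g S) = (\<Sum>i\<in>S. (A ^^ j) (g i))" if "finite S" for g :: "nat \<Rightarrow> 'b" and S j
    using that by (induction S) (auto simp: pow pow0)
  have TV: "T y \<in> V" if "y \<in> V" for y
  proof -
    have "(A ^^ a) y \<in> V" for a using that V(2) by (induction a) auto
    then show ?thesis unfolding T_def using V(1) by (intro subspace_sum subspace_scale)
  qed
  have Tadd: "T (y + z) = T y + T z" for y z
    by (simp add: T_def pow scale_right_distrib sum.distrib)
  \<comment> \<open>\<open>T\<close> is the identity on the associated graded space of the filtration by the kernels of the powers of \<open>A\<close>.\<close>
  have gr: "(A ^^ j) (y - T y) = 0" if "(A ^^ Suc j) y = 0" for j y
  proof -
    have z: "(A ^^ j) ((A ^^ a) y) = 0" if "a > 0" for a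
    proof -
      have "(A ^^ j) ((A ^^ a) y) = (A ^^ (a - 1)) ((A ^^ Suc j) y)"
        using that by (metis (no_types) Suc_pred' add_Suc_shift add.commute comp_apply funpow_add)
      then show ?thesis using \<open>(A ^^ Suc j) y = 0\<close> pow0 by simp
    qed
    have "(A ^^ j) (T y) = (\<Sum>a\<le>M. scale (c a) ((A ^^ j) ((A ^^ a) y)))"
      unfolding T_def by (subst pow_sum) (auto simp: pow)
    also have "\<dots> = (\<Sum>a\<le>M. if a = 0 then (A ^^ j) y else 0)"
      using z c0 by (intro sum.cong) auto
    finally have "(A ^^ j) (T y) = (A ^^ j) y" by simp
    then show ?thesis using pow(1)[of j "y - T y" "T y"] by simp
  qed
  have "\<exists>y\<in>V. T y = x" if "x \<in> V" "(A ^^ j) x = 0" for j x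
    using that
  proof (induction j arbitrary: x)
    case 0
    have "T 0 = 0" using Tadd[of 0 0] by simp
    then show ?case using 0 by auto
  next
    case (Suc j)
    then obtain y where "y \<in> V" "T y = x - T x"
      using Suc.IH[OF _ gr] subspace_diff[OF V(1) Suc.prems(1) TV[OF Suc.prems(1)]] by blast
    then show ?case using Suc.prems by (intro bexI[of _ "x + y"]) (auto simp: Tadd intro: subspace_add[OF V(1)])
  qed
  then show ?thesis using x nil unfolding T_def by blast
qed

locale sl2_module = module scale for scale :: "complex \<Rightarrow> 'a::ab_group_add \<Rightarrow> 'a" +
  fixes E F H :: "'a \<Rightarrow> 'a" and M :: nat
  assumes E_add: "E (x + y) = E x + E y" and E_scale: "E (scale c x) = scale c (E x)"
    and F_add: "F (x + y) = F x + F y" and F_scale: "F (scale c x) = scale c (F x)"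
    and H_add: "H (x + y) = H x + H y" and H_scale: "H (scale c x) = scale c (H x)"
    and HE: "H (E x) = E (H x) + scale 2 (E x)"
    and HF: "H (F x) = F (H x) - scale 2 (F x)"
    and EF: "E (F x) = F (E x) + H x"
    and E_nil: "(E ^^ M) x = 0" and F_nil: "(F ^^ M) x = 0"
begin

lemma E_zero [simp]: "E 0 = 0" using E_scale[of 0 0] by simp
lemma H_zero [simp]: "H 0 = 0" using H_scale[of 0 0] by simp

lemma E_diff: "E (x - y) = E x - E y" using E_add[of "x - y" y] by (simp add: algebra_simps)
lemma F_diff: "F (x - y) = F x - F y" using F_add[of "x - y" y] by (simp add: algebra_simps)

text \<open>The divided powers of \<open>E\<close> and \<open>- F\<close>, the coefficients of their exponentials.\<close>

definition Ed :: "nat \<Rightarrow> 'a \<Rightarrow> 'a" where "Ed a x = scale (1 / fact a) ((E ^^ a) x)"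
definition Fd :: "nat \<Rightarrow> 'a \<Rightarrow> 'a" where "Fd b x = scale ((-1) ^ b / fact b) ((F ^^ b) x)"

lemma Epow: "(E ^^ a) (x + y) = (E ^^ a) x + (E ^^ a) y" "(E ^^ a) (scale c x) = scale c ((E ^^ a) x)"
  "(E ^^ a) (E x) = E ((E ^^ a) x)"
  by (induction a) (auto simp: E_add E_scale)

lemma Fpow: "(F ^^ a) (x + y) = (F ^^ a) x + (F ^^ a) y" "(F ^^ a) (scale c x) = scale c ((F ^^ a) x)"
  by (induction a) (auto simp: F_add F_scale)

lemma Ed_add: "Ed a (x + y) = Ed a x + Ed a y" by (simp add: Ed_def Epow scale_right_distrib)
lemma Ed_scale: "Ed a (scale c x) = scale c (Ed a x)" by (simp add: Ed_def Epow mult.commute)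
lemma Ed_E: "Ed a (E x) = E (Ed a x)" by (simp add: Ed_def Epow E_scale)
lemma Fd_add: "Fd a (x + y) = Fd a x + Fd a y" by (simp add: Fd_def Fpow scale_right_distrib)
lemma Fd_scale: "Fd a (scale c x) = scale c (Fd a x)" by (simp add: Fd_def Fpow mult.commute)
lemma Ed_M: "Ed M x = 0" by (simp add: Ed_def E_nil)
lemma Fd_M: "Fd M x = 0" by (simp add: Fd_def F_nil)
lemma Ed_zero [simp]: "Ed a 0 = 0" using Ed_scale[of a 0 0] by simp
lemma Fd_zero [simp]: "Fd a 0 = 0" using Fd_scale[of a 0 0] by simp

lemma Ed_Suc: "scale (of_nat (Suc a)) (Ed (Suc a) x) = E (Ed a x)"
proof -
  have "of_nat (Suc a) * (1 / fact (Suc a)) = (1 / fact a :: complex)"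
    by (simp add: fact_Suc del: of_nat_Suc)
  then show ?thesis by (simp add: Ed_def E_scale del: of_nat_Suc)
qed

lemma Ed_H: "Ed a (H x) = H (Ed a x) - scale (2 * of_nat a) (Ed a x)"
proof -
  have "(E ^^ a) (H x) = H ((E ^^ a) x) - scale (2 * of_nat a) ((E ^^ a) x)"
  proof (induction a)
    case (Suc a)
    have "(E ^^ Suc a) (H x) = E (H ((E ^^ a) x)) - scale (2 * of_nat a) (E ((E ^^ a) x))"
      by (simp add: Suc E_diff E_scale)
    moreover have "2 * of_nat (Suc a) = 2 * of_nat a + (2 :: complex)" by simp
    ultimately show ?case by (simp only: funpow.simps comp_apply HE scale_left_distrib) simp
  qed simp
  then show ?thesis by (simp add: Ed_def H_scale scale_right_diff_distrib mult.commute)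
qed

lemma Fpow_E: "(F ^^ Suc b) (E x) = E ((F ^^ Suc b) x) - scale (of_nat (Suc b)) (H ((F ^^ b) x))
    - scale (of_nat (Suc b) * of_nat b) ((F ^^ b) x)"
proof (induction b)
  case 0 show ?case using EF[of x] by (simp add: algebra_simps)
next
  case (Suc b)
  let ?y = "(F ^^ b) x"
  have "(F ^^ Suc (Suc b)) (E x) = F ((F ^^ Suc b) (E x))" by simp
  also have "\<dots> = F (E (F ?y)) - scale (of_nat (Suc b)) (F (H ?y)) - scale (of_nat (Suc b) * of_nat b) (F ?y)"
    unfolding Suc by (simp add: F_diff F_scale)
  also have "F (E (F ?y)) = E (F (F ?y)) - H (F ?y)" using EF[of "F ?y"] by (simp add: algebra_simps)
  also have "F (H ?y) = H (F ?y) + scale 2 (F ?y)" using HF[of ?y] by (simp add: algebra_simps)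
  finally have eq: "(F ^^ Suc (Suc b)) (E x) = E (F (F ?y)) - H (F ?y)
      - scale (of_nat (Suc b)) (H (F ?y) + scale 2 (F ?y)) - scale (of_nat (Suc b) * of_nat b) (F ?y)" .
  have "of_nat (Suc (Suc b)) * of_nat (Suc b) = of_nat (Suc b) * 2 + of_nat (Suc b) * (of_nat b :: complex)"
    by (simp add: algebra_simps)
  moreover have "of_nat (Suc (Suc b)) = of_nat (Suc b) + (1 :: complex)" by simp
  ultimately have "scale (of_nat (Suc (Suc b)) * of_nat (Suc b)) z = scale (of_nat (Suc b)) (scale 2 z) + scale (of_nat (Suc b) * of_nat b) z"
    "scale (of_nat (Suc (Suc b))) z = scale (of_nat (Suc b)) z + z" for z
    by (simp_all only: scale_left_distrib scale_scale scale_one)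
  then show ?case unfolding eq by (simp add: scale_right_distrib del: of_nat_Suc scale_scale)
qed

lemma Fd_E: "Fd (Suc b) (E x) = E (Fd (Suc b) x) + H (Fd b x) + scale (of_nat b) (Fd b x)"
proof -
  let ?c = "(-1) ^ Suc b / fact (Suc b) :: complex" and ?d = "(-1) ^ b / fact b :: complex"
  have c: "?c * of_nat (Suc b) = - ?d"
    by (simp add: fact_Suc del: of_nat_Suc)
  have "Fd (Suc b) (E x) = E (Fd (Suc b) x) - scale (?c * of_nat (Suc b)) (H ((F ^^ b) x))
      - scale (?c * of_nat (Suc b) * of_nat b) ((F ^^ b) x)"
    unfolding Fd_def Fpow_E by (simp only: scale_right_diff_distrib scale_scale E_scale mult.assoc)
  then show ?thesis unfolding c by (simp add: Fd_def H_scale mult.commute)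
qed

text \<open>
  \<open>S k\<close> is the coefficient of $t^k$ in $\exp(tE)\exp(-t^{-1}F)\exp(tE)$. All sums run up to \<open>M\<close>,
  where the divided powers vanish, so that shifting an index costs no boundary terms.
\<close>

definition tm :: "'a \<Rightarrow> nat \<Rightarrow> nat \<Rightarrow> nat \<Rightarrow> 'a" where "tm y a b c = Ed a (Fd b (Ed c y))"

definition SS :: "(nat \<Rightarrow> nat \<Rightarrow> nat \<Rightarrow> 'a) \<Rightarrow> 'a" where
  "SS g = (\<Sum>a\<le>M. \<Sum>b\<le>M. \<Sum>c\<le>M. g a b c)"

definition wt :: "int \<Rightarrow> (nat \<Rightarrow> nat \<Rightarrow> nat \<Rightarrow> 'a) \<Rightarrow> nat \<Rightarrow> nat \<Rightarrow> nat \<Rightarrow> 'a" where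
  "wt k g a b c = (if int a - int b + int c = k then g a b c else 0)"

definition S :: "int \<Rightarrow> 'a \<Rightarrow> 'a" where "S k y = SS (wt k (tm y))"

lemma SS_add: "SS (\<lambda>a b c. g a b c + g' a b c) = SS g + SS g'"
  by (simp add: SS_def sum.distrib)

lemma SS_cong: "(\<And>a b c. g a b c = g' a b c) \<Longrightarrow> SS g = SS g'"
  by (simp add: SS_def)

lemma SS_linear:
  assumes "\<And>x y. f (x + y) = f x + f y" "f 0 = 0"
  shows "f (SS g) = SS (\<lambda>a b c. f (g a b c))"
proof -
  have "f (sum h A) = (\<Sum>i\<in>A. f (h i))" if "finite A" for h :: "nat \<Rightarrow> 'a" and A
    using that by (induction A) (auto simp: assms)
  then show ?thesis by (simp add: SS_def)
qed

lemma SS_swap_a: "SS g = (\<Sum>b\<le>M. \<Sum>c\<le>M. \<Sum>a\<le>M. g a b c)"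
  unfolding SS_def by (subst sum.swap) (intro sum.cong refl sum.swap)

lemma SS_swap_b: "SS g = (\<Sum>a\<le>M. \<Sum>c\<le>M. \<Sum>b\<le>M. g a b c)"
  unfolding SS_def by (intro sum.cong refl sum.swap)

lemma sum_shift:
  fixes g G :: "nat \<Rightarrow> 'a"
  assumes "g 0 = P 0" "\<And>a. g (Suc a) = P (Suc a) + G a" "G M = 0"
  shows "(\<Sum>a\<le>M. g a) = (\<Sum>a\<le>M. P a) + (\<Sum>a\<le>M. G a)"
proof -
  have "(\<Sum>a\<le>n. g a) = (\<Sum>a\<le>n. P a) + (\<Sum>a<n. G a)" for n
    by (induction n) (auto simp: assms algebra_simps)
  moreover have "(\<Sum>a\<le>M. G a) = (\<Sum>a<M. G a)"
    using assms(3) by (simp add: lessThan_Suc_atMost[symmetric])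
  ultimately show ?thesis by simp
qed

text \<open>
  On the level of $\theta(t) = \exp(tE)\exp(-t^{-1}F)\exp(tE)$ the claim is
  $t \theta'(t) = H \theta(t)$. The three factors contribute \<open>A\<close>, \<open>- B\<close> and \<open>C\<close> to the left hand side;
  in \<open>C\<close> a factor \<open>E\<close> is moved to the front, which produces \<open>A\<close> and a commutator that contains \<open>H\<close>.
\<close>

lemma S_weight: "H (S k y) = scale (of_int k) (S k y)"
proof -
  define A where "A = SS (wt k (\<lambda>a b c. scale (of_nat a) (tm y a b c)))"
  define B where "B = SS (wt k (\<lambda>a b c. scale (of_nat b) (tm y a b c)))"
  define C where "C = SS (wt k (\<lambda>a b c. scale (of_nat c) (tm y a b c)))"
  have kS: "scale (of_int k) (S k y) + B = A + C"
  proof -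
    have e: "scale (of_int k) (S k y) = SS (wt k (\<lambda>a b c. scale (of_int k) (tm y a b c)))"
      unfolding S_def by (subst SS_linear[where f = "scale (of_int k)"])
        (auto simp: wt_def scale_right_distrib intro!: SS_cong)
    show ?thesis
      unfolding e A_def B_def C_def SS_add[symmetric]
      by (auto intro!: SS_cong simp: wt_def scale_left_distrib[symmetric])
  qed
  have A: "A = E (S (k - 1) y)"
  proof -
    have "A = SS (wt (k - 1) (\<lambda>a b c. E (tm y a b c)))"
      unfolding A_def SS_swap_a
    proof (rule sum.cong[OF refl], rule sum.cong[OF refl])
      fix b c
      have "(\<Sum>a\<le>M. wt k (\<lambda>a b c. scale (of_nat a) (tm y a b c)) a b c) = (\<Sum>a\<le>M. 0) +
          (\<Sum>a\<le>M. wt (k - 1) (\<lambda>a b c. E (tm y a b c)) a b c)"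
        by (rule sum_shift) (auto simp: wt_def tm_def Ed_Suc Ed_M simp del: of_nat_Suc)
      then show "(\<Sum>a\<le>M. wt k (\<lambda>a b c. scale (of_nat a) (tm y a b c)) a b c) =
          (\<Sum>a\<le>M. wt (k - 1) (\<lambda>a b c. E (tm y a b c)) a b c)" by simp
    qed
    then show ?thesis unfolding S_def
      by (subst SS_linear[where f = E]) (auto simp: E_add wt_def intro!: SS_cong)
  qed
  have t: "scale (of_nat c) (tm y a b c) = Ed a (Fd b (scale (of_nat c) (Ed c y)))" for a b c
    by (simp add: tm_def Ed_scale Fd_scale)
  have "C = SS (wt (k - 1) (\<lambda>a b c. Ed a (Fd b (E (Ed c y)))))"
    unfolding C_def SS_def
  proof (rule sum.cong[OF refl], rule sum.cong[OF refl])
    fix a b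
    have "(\<Sum>c\<le>M. wt k (\<lambda>a b c. scale (of_nat c) (tm y a b c)) a b c) = (\<Sum>c\<le>M. 0) +
        (\<Sum>c\<le>M. wt (k - 1) (\<lambda>a b c. Ed a (Fd b (E (Ed c y)))) a b c)"
      by (rule sum_shift)
        (auto simp: wt_def t Ed_Suc Ed_M simp del: of_nat_Suc)
    then show "(\<Sum>c\<le>M. wt k (\<lambda>a b c. scale (of_nat c) (tm y a b c)) a b c) =
        (\<Sum>c\<le>M. wt (k - 1) (\<lambda>a b c. Ed a (Fd b (E (Ed c y)))) a b c)" by simp
  qed
  also have "\<dots> = SS (wt (k - 1) (\<lambda>a b c. E (tm y a b c))) +
     SS (wt k (\<lambda>a b c. Ed a (H (Fd b (Ed c y))) + scale (of_nat b) (tm y a b c)))"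
    unfolding SS_swap_b sum.distrib[symmetric]
  proof (rule sum.cong[OF refl], rule sum.cong[OF refl])
    fix a c
    show "(\<Sum>b\<le>M. wt (k - 1) (\<lambda>a b c. Ed a (Fd b (E (Ed c y)))) a b c) =
       (\<Sum>b\<le>M. wt (k - 1) (\<lambda>a b c. E (tm y a b c)) a b c + wt k (\<lambda>a b c. Ed a (H (Fd b (Ed c y))) + scale (of_nat b) (tm y a b c)) a b c)"
      unfolding sum.distrib
    proof (rule sum_shift)
      show "wt (k - 1) (\<lambda>a b c. Ed a (Fd b (E (Ed c y)))) a 0 c = wt (k - 1) (\<lambda>a b c. E (tm y a b c)) a 0 c"
        by (simp add: wt_def tm_def Fd_def Ed_E)
      show "wt k (\<lambda>a b c. Ed a (H (Fd b (Ed c y))) + scale (of_nat b) (tm y a b c)) a M c = 0"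
        by (simp add: wt_def tm_def Fd_M)
      fix b
      show "wt (k - 1) (\<lambda>a b c. Ed a (Fd b (E (Ed c y)))) a (Suc b) c = wt (k - 1) (\<lambda>a b c. E (tm y a b c)) a (Suc b) c +
         wt k (\<lambda>a b c. Ed a (H (Fd b (Ed c y))) + scale (of_nat b) (tm y a b c)) a b c"
        by (auto simp: wt_def tm_def Fd_E Ed_add Ed_E Ed_scale algebra_simps)
    qed
  qed
  also have "SS (wt (k - 1) (\<lambda>a b c. E (tm y a b c))) = E (S (k - 1) y)"
    unfolding S_def by (subst SS_linear[where f = E]) (auto simp: E_add wt_def intro!: SS_cong)
  finally have C: "C = A + SS (wt k (\<lambda>a b c. Ed a (H (Fd b (Ed c y))) + scale (of_nat b) (tm y a b c)))"
    by (simp add: A)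
  have "SS (wt k (\<lambda>a b c. Ed a (H (Fd b (Ed c y))) + scale (of_nat b) (tm y a b c))) + A + A = H (S k y) + B"
  proof -
    have e: "H (S k y) = SS (wt k (\<lambda>a b c. H (tm y a b c)))"
      unfolding S_def by (subst SS_linear[where f = H]) (auto simp: H_add wt_def intro!: SS_cong)
    have d: "Ed a (H z) = H (Ed a z) - (scale (of_nat a) (Ed a z) + scale (of_nat a) (Ed a z))" for a z
      unfolding Ed_H mult_2 scale_left_distrib ..
    show ?thesis
      unfolding e A_def B_def SS_add[symmetric]
      by (rule SS_cong) (simp add: wt_def tm_def d)
  qed
  then have "H (S k y) + B = A + C" unfolding C by (simp only: ac_simps)
  with kS have "H (S k y) + B = scale (of_int k) (S k y) + B" by (simp only:)
  then show ?thesis by simp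
qed

definition X where "X x = (\<Sum>a\<le>M. Ed a x)"
definition Y where "Y x = (\<Sum>a\<le>M. Fd a x)"

lemma sum_S: "(\<Sum>k\<in>{- int (2 * M)..int (2 * M)}. S k y) = X (Y (X y))"
proof -
  let ?K = "{- int (2 * M)..int (2 * M)}"
  have "(\<Sum>k\<in>?K. S k y) = (\<Sum>a\<le>M. \<Sum>b\<le>M. \<Sum>c\<le>M. \<Sum>k\<in>?K. wt k (tm y) a b c)"
    unfolding S_def SS_def
    by (subst sum.swap, intro sum.cong refl, subst sum.swap, intro sum.cong refl, rule sum.swap)
  also have "\<dots> = (\<Sum>a\<le>M. \<Sum>b\<le>M. \<Sum>c\<le>M. tm y a b c)"
    by (intro sum.cong refl) (simp add: wt_def)
  also have "\<dots> = X (Y (X y))"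
  proof -
    have F: "Fd b (sum h {..M}) = (\<Sum>i\<le>M. Fd b (h i))" and E: "Ed b (sum h {..M}) = (\<Sum>i\<le>M. Ed b (h i))" for b h
      by (induction M) (auto simp: Fd_add Ed_add)
    show ?thesis by (simp add: X_def Y_def tm_def F E)
  qed
  finally show ?thesis .
qed

lemma XY_surj:
  assumes V: "subspace V" "\<And>x. x \<in> V \<Longrightarrow> E x \<in> V" "\<And>x. x \<in> V \<Longrightarrow> F x \<in> V"
    and x: "x \<in> V"
  shows "\<exists>y\<in>V. X y = x" "\<exists>y\<in>V. Y y = x"
  using unipotent_surj[OF E_add E_scale E_nil V(1,2) _ x, of "\<lambda>a. 1 / fact a"]
    unipotent_surj[OF F_add F_scale F_nil V(1,3) _ x, of "\<lambda>b. (-1) ^ b / fact b"]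
  by (simp_all add: X_def Y_def Ed_def Fd_def)

text \<open>
  A vector is the value of $\theta(1)$ at another vector, hence the sum of the coefficients there.
\<close>

theorem weight_decomposition:
  assumes V: "subspace V" "\<And>x. x \<in> V \<Longrightarrow> E x \<in> V" "\<And>x. x \<in> V \<Longrightarrow> F x \<in> V"
    and x: "x \<in> V"
  shows "\<exists>y. (\<forall>k. y k \<in> V \<and> H (y k) = scale (of_int k) (y k)) \<and> x = (\<Sum>k\<in>{- int (2 * M)..int (2 * M)}. y k)"
proof -
  obtain x3 where "x3 \<in> V" "x = X (Y (X x3))" using XY_surj[OF V] x by metis
  moreover have "S k x3 \<in> V" if "x3 \<in> V" for k
  proof -
    have "(E ^^ a) z \<in> V" "(F ^^ a) z \<in> V" if "z \<in> V" for a z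
      using that V by (induction a) auto
    then have "Ed a z \<in> V" "Fd a z \<in> V" if "z \<in> V" for a z
      using that V(1) unfolding Ed_def Fd_def by (auto intro: subspace_scale)
    then show ?thesis using that V(1)
      unfolding S_def SS_def wt_def tm_def
      by (auto intro!: subspace_sum subspace_0)
  qed
  ultimately show ?thesis using sum_S[of x3] S_weight by (intro exI[of _ "\<lambda>k. S k x3"]) auto
qed

end

text \<open>
  Since $[H, E^n] = nrE^n$, the operator norms satisfy $n|r|\,\|E^n\| \le 2\|H\|\,\|E^n\|$.
\<close>

lemma eigen_nilpotent:
  fixes E H :: "'a::euclidean_space \<Rightarrow> 'a"
  assumes "linear E" "linear H" "\<And>x. H (E x) = E (H x) + r *\<^sub>R E x" "r \<noteq> 0"
  shows "\<exists>N. \<forall>n\<ge>N. \<forall>x. (E ^^ n) x = 0"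
proof -
  obtain K where K: "K > 0" "\<And>x. norm (H x) \<le> norm x * K"
    using bounded_linear.pos_bounded[OF linear_conv_bounded_linear[THEN iffD1, OF assms(2)]] by blast
  have lin: "linear (E ^^ n)" for n
  proof (induction n)
    case (Suc n) then show ?case using linear_compose[OF Suc assms(1)] by (simp add: o_def)
  qed (simp add: linear_ident)
  have comm: "H ((E ^^ n) x) = (E ^^ n) (H x) + (real n * r) *\<^sub>R (E ^^ n) x" for n x
    by (induction n) (auto simp: assms(3) linear_add[OF assms(1)] linear_scale[OF assms(1)] algebra_simps)
  have "(E ^^ n) x = 0" if n: "real n * \<bar>r\<bar> > 2 * K" for n x
  proof -
    let ?c = "onorm (E ^^ n)"
    have bl: "bounded_linear (E ^^ n)" using lin linear_conv_bounded_linear by blast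
    have c: "norm ((E ^^ n) x) \<le> ?c * norm x" for x by (rule onorm[OF bl])
    have c0: "?c \<ge> 0" by (rule onorm_pos_le[OF bl])
    have n0: "real n * \<bar>r\<bar> > 0" using n K by linarith
    have "norm ((E ^^ n) x) \<le> (2 * K * ?c / (real n * \<bar>r\<bar>)) * norm x" for x
    proof -
      have "(real n * r) *\<^sub>R (E ^^ n) x = H ((E ^^ n) x) - (E ^^ n) (H x)" using comm by simp
      then have "real n * \<bar>r\<bar> * norm ((E ^^ n) x) = norm (H ((E ^^ n) x) - (E ^^ n) (H x))"
        by (metis abs_mult abs_of_nat norm_scaleR)
      also have "\<dots> \<le> norm ((E ^^ n) x) * K + ?c * norm (H x)"
        using norm_triangle_ineq4[of "H ((E ^^ n) x)" "(E ^^ n) (H x)"] K(2)[of "(E ^^ n) x"] c[of "H x"] by linarith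
      also have "\<dots> \<le> (?c * norm x) * K + ?c * (norm x * K)"
        using c[of x] K c0 by (intro add_mono mult_right_mono mult_left_mono) auto
      finally show ?thesis using n0 by (simp add: field_simps)
    qed
    then have "?c \<le> 2 * K * ?c / (real n * \<bar>r\<bar>)"
      using n0 c0 K by (intro onorm_bound) auto
    then have "?c * (real n * \<bar>r\<bar>) \<le> 2 * K * ?c" using n0 by (simp add: field_simps)
    then have "?c \<le> 0" using mult_strict_left_mono[OF n, of ?c] by (cases "?c > 0") (auto simp: mult.commute)
    then show ?thesis using c[of x] c0 by simp
  qed
  moreover obtain N :: nat where "2 * K / \<bar>r\<bar> < real N" using reals_Archimedean2 by blast
  then have "real n * \<bar>r\<bar> > 2 * K" if "n \<ge> N" for n
  proof -
    have "2 * K / \<bar>r\<bar> < real n" using that \<open>2 * K / \<bar>r\<bar> < real N\<close> by linarith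
    then show ?thesis using assms(4) by (simp add: pos_divide_less_eq)
  qed
  ultimately show ?thesis by blast
qed

section \<open>The Lie superalgebra \<open>osp(1|2n)\<close>\<close>

abbreviation "sb \<equiv> supercommutator"

lemma mat_scale_nth [simp]: "mat_scale c X $ i $ j = c * X $ i $ j"
  by (simp add: mat_scale_def)

lemma mat_comp_nth [simp]: "mat_comp p X $ i $ j = (if idx_parity i + idx_parity j = p then X $ i $ j else 0)"
  by (simp add: mat_comp_def)

lemma mat_eq_iff: "X = Y \<longleftrightarrow> (\<forall>i j. X $ i $ j = Y $ i $ j)" for X Y :: "('n::finite) smat"
  by (auto simp: vec_eq_iff)

interpretation ms: vector_space mat_scale
  by standard (auto simp: mat_eq_iff algebra_simps)

lemma mat_scale_mult [simp]: "mat_scale c X ** Y = mat_scale c (X ** Y)" "X ** mat_scale c Y = mat_scale c (X ** Y)"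
  by (auto simp: mat_eq_iff matrix_matrix_mult_def sum_distrib_left algebra_simps)

lemma mat_diff_mult: "(X - Y) ** Z = X ** Z - Y ** Z" "Z ** (X - Y) = Z ** X - Z ** Y" for X Y Z :: "('n::finite) smat"
  by (auto simp: mat_eq_iff matrix_matrix_mult_def sum_subtractf algebra_simps)

lemma mat_add_mult: "(X + Y) ** Z = X ** Z + Y ** Z" "Z ** (X + Y) = Z ** X + Z ** Y" for X Y Z :: "('n::finite) smat"
  by (auto simp: mat_eq_iff matrix_matrix_mult_def sum.distrib algebra_simps)

lemma mat_scale_vec: "mat_scale c X *v v = c *s (X *v v)"
  by (auto simp: vec_eq_iff matrix_vector_mult_def sum_distrib_left algebra_simps)

lemma mat_comp_add: "mat_comp p (X + Y) = mat_comp p X + mat_comp p Y"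
  and mat_comp_scale: "mat_comp p (mat_scale c X) = mat_scale c (mat_comp p X)"
  by (auto simp: mat_eq_iff)

lemma mat_comp_hom: "mat_comp p X = X \<longleftrightarrow> (\<forall>i j. X $ i $ j \<noteq> 0 \<longrightarrow> idx_parity i + idx_parity j = p)"
  by (auto simp: mat_eq_iff)

lemma mat_comp_other: "mat_comp p X = X \<Longrightarrow> q \<noteq> p \<Longrightarrow> mat_comp q X = 0"
  unfolding mat_comp_hom by (auto simp: mat_eq_iff)

lemma mat_comp_sum: "X = mat_comp 0 X + mat_comp 1 X"
proof -
  have "idx_parity i + idx_parity j = 0 \<or> idx_parity i + idx_parity j = 1" for i j :: "'a idx"
    by (metis bit.exhaust)
  then show ?thesis by (auto simp: mat_eq_iff)
qed

lemma mat_comp_mult: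
  assumes "mat_comp p X = X" "mat_comp q Y = Y" shows "mat_comp (p + q) (X ** Y) = X ** Y"
  unfolding mat_comp_hom
proof (intro allI impI)
  fix i j assume "(X ** Y) $ i $ j \<noteq> 0"
  then have "(\<Sum>k\<in>UNIV. X $ i $ k * Y $ k $ j) \<noteq> 0" by (simp add: matrix_matrix_mult_def)
  then obtain k where "X $ i $ k * Y $ k $ j \<noteq> 0" by (rule sum.not_neutral_contains_not_neutral)
  then have "idx_parity i + idx_parity k = p" "idx_parity k + idx_parity j = q"
    using assms unfolding mat_comp_hom by auto
  then show "idx_parity i + idx_parity j = p + q"
    by (cases "idx_parity i"; cases "idx_parity k"; cases "idx_parity j"; simp)
qed

lemma mat_mult_vec_part:
  assumes "mat_comp p X = X" "v \<in> vec_part q" shows "X *v v \<in> vec_part (p + q)"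
  unfolding vec_part_def
proof safe
  fix i assume "(X *v v) $ i \<noteq> 0"
  then have "(\<Sum>k\<in>UNIV. X $ i $ k * v $ k) \<noteq> 0" by (simp add: matrix_vector_mult_def)
  then obtain k where "X $ i $ k * v $ k \<noteq> 0" by (rule sum.not_neutral_contains_not_neutral)
  then have "idx_parity i + idx_parity k = p" "idx_parity k = q"
    using assms unfolding mat_comp_hom vec_part_def by auto
  then show "idx_parity i = p + q" by (cases "idx_parity i"; cases "idx_parity k"; simp)
qed

lemma sb_expand: "sb X Y = (\<Sum>p\<in>{0, 1}. \<Sum>q\<in>{0, 1}.
    mat_comp p X ** mat_comp q Y - mat_scale (ksign p q) (mat_comp q Y ** mat_comp p X))"
  by (simp add: supercommutator_def)

lemma sb_hom:
  assumes "mat_comp p X = X" "mat_comp q Y = Y"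
  shows "sb X Y = X ** Y - mat_scale (ksign p q) (Y ** X)"
proof -
  have "mat_comp p' X = (if p' = p then X else 0)" "mat_comp p' Y = (if p' = q then Y else 0)" for p'
    using assms mat_comp_other by auto
  then show ?thesis unfolding sb_expand by (cases p; cases q) auto
qed

lemma sb_add_left: "sb (X + X') Y = sb X Y + sb X' Y"
  and sb_add_right: "sb X (Y + Y') = sb X Y + sb X Y'"
  and sb_scale_left: "sb (mat_scale c X) Y = mat_scale c (sb X Y)"
  and sb_scale_right: "sb X (mat_scale c Y) = mat_scale c (sb X Y)"
  by (simp_all add: sb_expand mat_comp_add mat_comp_scale mat_add_mult
      ms.scale_right_distrib ms.scale_right_diff_distrib algebra_simps)

lemma sb_even: assumes "mat_comp 0 X = X" shows "sb X Y = X ** Y - Y ** X"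
proof -
  have "mat_comp p (mat_comp p Y) = mat_comp p Y" for p by (auto simp: mat_eq_iff)
  then have "sb X (mat_comp 0 Y + mat_comp 1 Y) = X ** (mat_comp 0 Y + mat_comp 1 Y) - (mat_comp 0 Y + mat_comp 1 Y) ** X"
    unfolding sb_add_right
    by (simp add: sb_hom[OF assms, of 0] sb_hom[OF assms, of 1] mat_add_mult)
  then show ?thesis using mat_comp_sum[of Y] by simp
qed

lemma sb_parity:
  assumes "mat_comp p X = X" "mat_comp q Y = Y" shows "mat_comp (p + q) (sb X Y) = sb X Y"
proof -
  have "mat_comp (p + q) (Y ** X) = Y ** X" using mat_comp_mult[OF assms(2,1)] by (simp add: add.commute)
  moreover have "mat_comp r (A - B) = mat_comp r A - mat_comp r B" for r and A B :: "'a smat"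
    by (auto simp: mat_eq_iff)
  ultimately show ?thesis using mat_comp_mult[OF assms]
    by (simp add: sb_hom[OF assms] mat_comp_scale)
qed

lemma sb_jacobi:
  assumes "mat_comp p X = X" "mat_comp q Y = Y" "mat_comp t Z = Z"
  shows "sb X (sb Y Z) = sb (sb X Y) Z + mat_scale (ksign p q) (sb Y (sb X Z))"
proof -
  have outer: "sb X (sb Y Z) = X ** sb Y Z - mat_scale (ksign p (q + t)) (sb Y Z ** X)"
       "sb (sb X Y) Z = sb X Y ** Z - mat_scale (ksign (p + q) t) (Z ** sb X Y)"
       "sb Y (sb X Z) = Y ** sb X Z - mat_scale (ksign q (p + t)) (sb X Z ** Y)"
    by (intro sb_hom assms sb_parity)+
  have inner: "sb Y Z = Y ** Z - mat_scale (ksign q t) (Z ** Y)"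
     "sb X Y = X ** Y - mat_scale (ksign p q) (Y ** X)" "sb X Z = X ** Z - mat_scale (ksign p t) (Z ** X)"
    by (intro sb_hom assms)+
  show ?thesis
    unfolding outer unfolding inner
    by (cases p; cases q; cases t)
      (simp_all add: mat_diff_mult mat_add_mult matrix_mul_assoc algebra_simps)
qed

lemma std_add: "std_form (v + v') w = std_form v w + std_form v' w" "std_form v (w + w') = std_form v w + std_form v w'"
  and std_scale: "std_form (c *s v) w = c * std_form v w" "std_form v (c *s w) = c * std_form v w"
  by (simp_all add: std_form_def algebra_simps sum.distrib sum_distrib_left)

lemma std_zero [simp]: "std_form 0 w = 0" "std_form v 0 = 0" by (simp_all add: std_form_def)

lemma std_diff: "std_form (v - v') w = std_form v w - std_form v' w" "std_form v (w - w') = std_form v w - std_form v w'"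
  by (simp_all add: std_form_def algebra_simps sum_subtractf)

lemma ospD:
  assumes "X \<in> osp_part p"
  shows "mat_comp p X = X" "v \<in> vec_part q \<Longrightarrow> std_form (X *v v) w = - ksign p q * std_form v (X *v w)"
  using assms by (auto simp: osp_part_def add_eq_0_iff)

lemma ospI:
  assumes "mat_comp p X = X" "\<And>q v w. v \<in> vec_part q \<Longrightarrow> std_form (X *v v) w = - ksign p q * std_form v (X *v w)"
  shows "X \<in> osp_part p"
  using assms by (auto simp: osp_part_def)

lemma osp_bracket:
  fixes X Y :: "('n::finite) smat"
  assumes X: "X \<in> osp_part p" and Y: "Y \<in> osp_part q" shows "sb X Y \<in> osp_part (p + q)"
proof (rule ospI)
  note x = ospD[OF X] and y = ospD[OF Y]
  show "mat_comp (p + q) (sb X Y) = sb X Y" by (rule sb_parity[OF x(1) y(1)])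
  fix t and v w :: "complex ^ 'n idx" assume v: "v \<in> vec_part t"
  have Xv: "X *v v \<in> vec_part (p + t)" and Yv: "Y *v v \<in> vec_part (q + t)"
    using mat_mult_vec_part x y v by auto
  have sv: "sb X Y *v u = X *v (Y *v u) - ksign p q *s (Y *v (X *v u))" for u
    by (simp add: sb_hom[OF x(1) y(1)] matrix_vector_mult_diff_rdistrib mat_scale_vec matrix_vector_mul_assoc)
  show "std_form (sb X Y *v v) w = - ksign (p + q) t * std_form v (sb X Y *v w)"
    unfolding sv std_diff std_scale x(2)[OF Yv] y(2)[OF Xv] x(2)[OF v] y(2)[OF v]
    by (cases p; cases q; cases t) (simp_all add: algebra_simps)
qed

lemma osp_simps [simp]: "lscale osp = mat_scale" "lpart osp = osp_part" "lbracket osp = supercommutator"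
  by (simp_all add: osp_def)

lemma osp_part_subspace: "ms.subspace (osp_part p)"
proof (rule ms.subspaceI)
  show "0 \<in> osp_part p" by (rule ospI) (auto simp: mat_eq_iff)
  fix X Y :: "'a smat" assume "X \<in> osp_part p" "Y \<in> osp_part p"
  then show "X + Y \<in> osp_part p"
    by (intro ospI) (auto simp: mat_comp_add ospD matrix_vector_mult_add_rdistrib std_add algebra_simps)
next
  fix c and X :: "'a smat" assume "X \<in> osp_part p"
  then show "mat_scale c X \<in> osp_part p"
    by (intro ospI) (auto simp: mat_comp_scale ospD mat_scale_vec std_scale algebra_simps)
qed

interpretation osp: lie_super osp
proof
  show "lscale osp a (x + y) = lscale osp a x + lscale osp a y"
    "lscale osp (a + b) x = lscale osp a x + lscale osp b x"
    "lscale osp a (lscale osp b x) = lscale osp (a * b) x" "lscale osp 1 x = x" for a b and x y :: "'a smat"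
    by (simp_all add: ms.scale_right_distrib ms.scale_left_distrib)
  show "module.subspace (lscale osp) (lpart (osp :: 'a smat lie_superalgebra) p)" for p
    by (simp add: osp_part_subspace)
  fix X Y Z X' :: "'a smat"
  show "X \<in> lpart osp 0 \<Longrightarrow> X \<in> lpart osp 1 \<Longrightarrow> X = 0"
    using mat_comp_other[OF ospD(1), of X 0 1] ospD(1)[of X 1] by simp
  show "X \<in> lpart osp p \<Longrightarrow> Y \<in> lpart osp q \<Longrightarrow> lbracket osp X Y \<in> lpart osp (p + q)" for p q
    by (simp add: osp_bracket)
  show "lbracket osp (X + X') Y = lbracket osp X Y + lbracket osp X' Y"
    "lbracket osp X (Y + X') = lbracket osp X Y + lbracket osp X X'"
    "lbracket osp (lscale osp c X) Y = lscale osp c (lbracket osp X Y)"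
    "lbracket osp X (lscale osp c Y) = lscale osp c (lbracket osp X Y)" for c
    by (simp_all add: sb_add_left sb_add_right sb_scale_left sb_scale_right)
  show "X \<in> lpart osp p \<Longrightarrow> Y \<in> lpart osp q \<Longrightarrow> lbracket osp X Y = lscale osp (- ksign p q) (lbracket osp Y X)" for p q
  proof -
    assume "X \<in> lpart osp p" "Y \<in> lpart osp q"
    then have XY: "mat_comp p X = X" "mat_comp q Y = Y" using ospD(1) by auto
    show ?thesis unfolding osp_simps sb_hom[OF XY] sb_hom[OF XY(2,1)]
      by (cases p; cases q) (simp_all add: ms.scale_right_diff_distrib)
  qed
  show "X \<in> lpart osp p \<Longrightarrow> Y \<in> lpart osp q \<Longrightarrow> Z \<in> lpart osp t \<Longrightarrow>
      lbracket osp X (lbracket osp Y Z) =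
      lbracket osp (lbracket osp X Y) Z + lscale osp (ksign p q) (lbracket osp Y (lbracket osp X Z))" for p q t
    unfolding osp_simps by (intro sb_jacobi ospD(1))
qed

subsection \<open>The odd part\<close>

text \<open>
  An odd element \<open>X\<close> is determined by its value \<open>colN X\<close> at the even basis vector \<open>eN\<close>, and every
  vector in the odd part of $\mathbb C^{1|2n}$ is such a value. In this way the standard form gives
  the invariant symplectic form \<open>om\<close> on the odd part of the algebra.
\<close>

definition eN :: "complex ^ ('n::finite) idx" where "eN = axis None 1"

definition colN :: "('n::finite) smat \<Rightarrow> complex ^ 'n idx" where "colN X = X *v eN"

definition om :: "('n::finite) smat \<Rightarrow> 'n smat \<Rightarrow> complex" where "om X Y = std_form (colN X) (colN Y)"

lemma idx_parity_simps [simp]: "idx_parity None = 0" "idx_parity (Some i) = 1"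
  by (simp_all add: idx_parity_def)

lemma idx_parity_0: "idx_parity i = 0 \<longleftrightarrow> i = None"
  by (cases i) auto

lemma gram_None [simp]: "gram None j = (if j = None then 1 else 0)" "gram j None = (if j = None then 1 else 0)"
  by (cases j; simp)+

lemma eN_part: "eN \<in> vec_part 0"
  by (auto simp: eN_def vec_part_def axis_def)

lemma eN_nth: "eN $ i = (if i = None then 1 else 0)"
  by (simp add: eN_def axis_def)

lemma sum_delta_mult: "(\<Sum>j\<in>(UNIV :: 'b::finite set). (if j = i then c else 0) * (g j :: complex)) = c * g i"
  by (simp add: if_distrib[where f = "\<lambda>x. x * _"] cong: if_cong)

lemma std_eN:
  fixes v w :: "complex ^ ('n::finite) idx"
  shows "std_form eN w = w $ None" "std_form v eN = v $ None"
proof -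
  have "std_form eN w = (\<Sum>i\<in>(UNIV :: 'n idx set). \<Sum>j\<in>UNIV. (if i = None then (if j = None then w $ j else 0) else 0))"
    unfolding std_form_def by (rule sum.cong[OF refl], rule sum.cong[OF refl]) (auto simp: eN_nth)
  also have "\<dots> = (\<Sum>i\<in>(UNIV :: 'n idx set). if i = None then w $ None else 0)"
    by (rule sum.cong[OF refl]) (auto intro: sum.neutral)
  finally show "std_form eN w = w $ None" by simp
  have "std_form v eN = (\<Sum>i\<in>(UNIV :: 'n idx set). \<Sum>j\<in>(UNIV :: 'n idx set). (if j = None then (if i = None then v $ i else 0) else 0))"
    unfolding std_form_def by (rule sum.cong[OF refl], rule sum.cong[OF refl]) (auto simp: eN_nth)
  also have "\<dots> = (\<Sum>i\<in>(UNIV :: 'n idx set). if i = None then v $ i else 0)"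
    by (rule sum.cong[OF refl]) (auto intro: sum.neutral)
  finally show "std_form v eN = v $ None" by simp
qed

lemma vec_part_0: "v \<in> vec_part 0 \<Longrightarrow> v = v $ None *s eN"
  by (auto simp: vec_part_def vec_eq_iff eN_nth idx_parity_0)

lemma vec_part_1: "v \<in> vec_part 1 \<longleftrightarrow> v $ None = 0"
  by (auto simp: vec_part_def) (metis idx_parity_simps(2) not_None_eq)

lemma gram_skew: "i \<noteq> None \<Longrightarrow> gram j i = - gram i j"
  by (cases "(i, j)" rule: gram.cases) auto

lemma std_skew: assumes "v \<in> vec_part 1" shows "std_form w v = - std_form v w"
proof -
  have "w $ j * gram j i * v $ i = - (v $ i * gram i j * w $ j)" for i j
    using assms gram_skew[of i j] by (cases "i = None") (auto simp: vec_part_1)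
  then show ?thesis unfolding std_form_def
    by (subst sum.swap) (simp add: sum_negf)
qed

lemma even_eN: assumes "Z \<in> osp_part 0" shows "Z *v eN = 0"
proof -
  have "Z *v eN \<in> vec_part (0 + 0)" by (rule mat_mult_vec_part[OF ospD(1)[OF assms] eN_part])
  then have Z: "Z *v eN = (Z *v eN) $ None *s eN" using vec_part_0 by auto
  have "std_form (Z *v eN) eN = - std_form eN (Z *v eN)"
    using ospD(2)[OF assms eN_part, of eN] by simp
  then have "(Z *v eN) $ None = 0" by (simp add: std_eN)
  then show ?thesis using Z by simp
qed

lemma colN_part: "X \<in> osp_part 1 \<Longrightarrow> colN X \<in> vec_part 1"
  using mat_mult_vec_part[OF ospD(1) eN_part, of X 1] by (simp add: colN_def)

lemma odd_vec: assumes "X \<in> osp_part 1" "v \<in> vec_part 1" shows "X *v v = std_form v (colN X) *s eN"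
proof -
  have "X *v v \<in> vec_part (1 + 1)" by (rule mat_mult_vec_part[OF ospD(1)[OF assms(1)] assms(2)])
  then have "X *v v = (X *v v) $ None *s eN" using vec_part_0 by simp
  moreover have "(X *v v) $ None = std_form v (colN X)"
    using ospD(2)[OF assms, of eN] by (simp add: std_eN colN_def)
  ultimately show ?thesis by simp
qed

lemma mat_vec_zero: assumes "\<And>i. X *v axis i 1 = 0" shows "X = (0 :: ('n::finite) smat)"
proof -
  have "(X *v axis j 1) $ i = X $ i $ j" for i j
    by (simp add: matrix_vector_mult_def axis_def if_distrib cong: if_cong)
  then show ?thesis using assms by (auto simp: mat_eq_iff)
qed

lemma axis_part: "axis (Some i) 1 \<in> vec_part 1"
  by (auto simp: vec_part_1 axis_def)

lemma colN_inj: assumes "X \<in> osp_part 1" "colN X = 0" shows "X = 0"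
proof (rule mat_vec_zero)
  fix i show "X *v axis i 1 = 0"
  proof (cases i)
    case None then show ?thesis using assms(2) by (simp add: colN_def eN_def)
  next
    case (Some j) then show ?thesis using odd_vec[OF assms(1) axis_part, of j] assms(2) by simp
  qed
qed

lemma colN_simps: "colN (X + Y) = colN X + colN Y" "colN (mat_scale c X) = c *s colN X" "colN (X - Y) = colN X - colN Y"
  by (simp_all add: colN_def matrix_vector_mult_add_rdistrib mat_scale_vec matrix_vector_mult_diff_rdistrib)

lemma colN_even: assumes "Z \<in> osp_part 0" shows "colN (sb Z X) = Z *v colN X"
  by (simp add: colN_def sb_even[OF ospD(1)[OF assms]] matrix_vector_mult_diff_rdistrib even_eN[OF assms]
      flip: matrix_vector_mul_assoc)

lemma odd_bracket_vec:
  assumes "X \<in> osp_part 1" "Y \<in> osp_part 1" "v \<in> vec_part 1"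
  shows "sb X Y *v v = std_form v (colN Y) *s colN X + std_form v (colN X) *s colN Y"
proof -
  have "X *v (c *s eN) = c *s colN X" for X :: "'a smat" and c
    by (simp add: colN_def vec.scale)
  then show ?thesis
    using sb_hom[OF ospD(1)[OF assms(1)] ospD(1)[OF assms(2)]] odd_vec[OF assms(1,3)] odd_vec[OF assms(2,3)]
    by (simp add: matrix_vector_mult_add_rdistrib flip: matrix_vector_mul_assoc)
qed

text \<open>
  Both sides are odd, so it suffices to compare them at the even basis vector. There the even element
  \<open>sb X Y\<close> vanishes, and on odd vectors it is the symplectic map that \<open>odd_bracket_vec\<close> describes.
\<close>

lemma odd_triple_bracket:
  assumes X: "X \<in> osp_part 1" and Y: "Y \<in> osp_part 1" and W: "W \<in> osp_part 1"
  shows "sb (sb X Y) W = mat_scale (om W Y) X + mat_scale (om W X) Y"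
proof -
  have Z: "sb X Y \<in> osp_part 0" using osp_bracket[OF X Y] by simp
  let ?D = "sb (sb X Y) W - (mat_scale (om W Y) X + mat_scale (om W X) Y)"
  have "sb (sb X Y) W \<in> osp_part 1" using osp_bracket[OF Z W] by simp
  then have "?D \<in> osp_part 1"
    using X Y osp_part_subspace by (intro ms.subspace_diff ms.subspace_add ms.subspace_scale) auto
  moreover have "colN ?D = 0"
    by (simp add: colN_simps colN_even[OF Z] odd_bracket_vec[OF X Y colN_part[OF W]] om_def)
  ultimately have "?D = 0" by (rule colN_inj)
  then show ?thesis by simp
qed

lemma om_simps: "om (X + X') Y = om X Y + om X' Y" "om X (Y + Y') = om X Y + om X Y'"
   "om (mat_scale c X) Y = c * om X Y" "om X (mat_scale c Y) = c * om X Y"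
  by (simp_all add: om_def colN_simps std_add std_scale)

lemma om_skew: "X \<in> osp_part 1 \<Longrightarrow> om Y X = - om X Y"
  unfolding om_def by (rule std_skew[OF colN_part])

lemma om_invariant:
  assumes "Z \<in> osp_part 0" "X \<in> osp_part 1" shows "om (sb Z X) Y = - om X (sb Z Y)"
  unfolding om_def colN_even[OF assms(1)] using ospD(2)[OF assms(1) colN_part[OF assms(2)]] by simp

text \<open>The odd element with value \<open>v\<close> at the even basis vector.\<close>

definition odd_mat :: "complex ^ ('n::finite) idx \<Rightarrow> 'n smat" where
  "odd_mat v = (\<chi> i j. if j = None then v $ i else if i = None then std_form (axis j 1) v else 0)"

lemma std_expand: "std_form u v = (\<Sum>j\<in>UNIV. u $ j * std_form (axis j 1) v)"
proof -
  have "std_form (axis j 1) v = (\<Sum>k\<in>UNIV. gram j k * v $ k)" for j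
  proof -
    have "std_form (axis j 1) v = (\<Sum>i\<in>UNIV. if i = j then (\<Sum>k\<in>UNIV. gram j k * v $ k) else 0)"
      unfolding std_form_def by (intro sum.cong refl) (auto simp: axis_def)
    then show ?thesis by simp
  qed
  then show ?thesis by (simp add: std_form_def sum_distrib_left mult.assoc)
qed

lemma odd_mat_vec: assumes "v \<in> vec_part 1" shows "odd_mat v *v u = u $ None *s v + std_form u v *s eN"
proof -
  have "(odd_mat v *v u) $ i = u $ None * v $ i + (if i = None then std_form u v else 0)" for i
  proof -
    have z: "std_form (axis None 1) v = 0" using assms std_eN(1)[of v] by (simp add: eN_def vec_part_1)
    have "(odd_mat v *v u) $ i = (\<Sum>j\<in>UNIV. (if j = None then u $ j * v $ i else 0)
        + (if i = None then u $ j * std_form (axis j 1) v else 0))"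
      unfolding matrix_vector_mult_def odd_mat_def using z assms
      by (auto intro!: sum.cong simp: vec_part_1)
    then show ?thesis by (auto simp: sum.distrib std_expand[of u v])
  qed
  then show ?thesis by (simp add: vec_eq_iff eN_nth)
qed

lemma odd_mat_osp: fixes v :: "complex ^ ('n::finite) idx" assumes "v \<in> vec_part 1" shows "odd_mat v \<in> osp_part 1"
proof (rule ospI)
  show "mat_comp 1 (odd_mat v) = odd_mat v"
    unfolding mat_comp_hom
  proof (intro allI impI)
    fix i j assume *: "odd_mat v $ i $ j \<noteq> 0"
    show "idx_parity i + idx_parity j = 1"
    proof (cases j)
      case None then show ?thesis using * assms by (cases i) (auto simp: odd_mat_def vec_part_1)
    next
      case (Some k) then show ?thesis using * by (cases i) (auto simp: odd_mat_def)
    qed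
  qed
  fix q and u w :: "complex ^ 'n idx" assume u: "u \<in> vec_part q"
  have 1: "std_form (odd_mat v *v u) w = u $ None * std_form v w + std_form u v * w $ None"
    by (simp add: odd_mat_vec[OF assms] std_add std_scale std_eN)
  have 2: "std_form u (odd_mat v *v w) = w $ None * std_form u v + std_form w v * u $ None"
    by (simp add: odd_mat_vec[OF assms] std_add std_scale std_eN)
  have w: "std_form w v = - std_form v w" by (rule std_skew[OF assms])
  show "std_form (odd_mat v *v u) w = - ksign 1 q * std_form u (odd_mat v *v w)"
  proof (cases "q = 0")
    case True
    then have "u = u $ None *s eN" using u vec_part_0 by auto
    then have "std_form u v = u $ None * std_form eN v" using std_scale(1)[of "u $ None" eN v] by simp
    then have "std_form u v = 0" using assms by (simp add: std_eN vec_part_1)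
    then show ?thesis unfolding 1 2 w using True by simp
  next
    case False
    then have q: "q = 1" by simp
    then have "u $ None = 0" using u by (simp add: vec_part_1)
    then show ?thesis unfolding 1 2 w q by simp
  qed
qed

lemma colN_odd_mat: assumes "v \<in> vec_part 1" shows "colN (odd_mat v) = v"
  using assms by (simp add: colN_def odd_mat_vec std_eN vec_part_1 eN_nth)

lemma std_nondegenerate: fixes v :: "complex ^ ('n::finite) idx" assumes "v \<in> vec_part 1" "v \<noteq> 0" shows "\<exists>w\<in>vec_part 1. std_form v w \<noteq> 0"
proof -
  from assms obtain i where i: "v $ i \<noteq> 0" by (auto simp: vec_eq_iff)
  then obtain k :: "'n + 'n" where k: "i = Some k" using assms by (cases i) (auto simp: vec_part_1)
  have ax: "std_form (axis j 1) v = (\<Sum>l\<in>UNIV. gram j l * v $ l)" for j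
  proof -
    have "std_form (axis j 1) v = (\<Sum>i\<in>UNIV. if i = j then (\<Sum>k\<in>UNIV. gram j k * v $ k) else 0)"
      unfolding std_form_def by (intro sum.cong refl) (auto simp: axis_def)
    then show ?thesis by simp
  qed
  obtain j :: "'n + 'n" and c where "c \<noteq> 0" and g: "\<And>l. gram (Some j) l = (if l = i then c else 0)"
  proof (cases k)
    case (Inl a)
    have gr: "gram (Some (Inr a)) l = (if l = i then -1 else 0)" for l :: "'n idx"
      by (cases "(Some (Inr a) :: 'n idx, l)" rule: gram.cases) (auto simp: k Inl)
    show ?thesis by (rule that[of "-1" "Inr a"]) (simp, rule gr)
  next
    case (Inr a)
    have gr: "gram (Some (Inl a)) l = (if l = i then 1 else 0)" for l :: "'n idx"
      by (cases "(Some (Inl a) :: 'n idx, l)" rule: gram.cases) (auto simp: k Inr)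
    show ?thesis by (rule that[of 1 "Inl a"]) (simp, rule gr)
  qed
  have "std_form (axis (Some j) 1) v = c * v $ i" unfolding ax g by (rule sum_delta_mult)
  then have "std_form v (axis (Some j) 1) \<noteq> 0" using std_skew[OF axis_part, of v j] i \<open>c \<noteq> 0\<close> by auto
  then show ?thesis using axis_part by blast
qed

lemma om_nondegenerate: assumes "X \<in> osp_part 1" "X \<noteq> 0" shows "\<exists>Y\<in>osp_part 1. om X Y \<noteq> 0"
proof -
  have "colN X \<noteq> 0" using colN_inj assms by blast
  then obtain w where "w \<in> vec_part 1" "std_form (colN X) w \<noteq> 0"
    using std_nondegenerate colN_part[OF assms(1)] by blast
  then show ?thesis using odd_mat_osp[of w] colN_odd_mat[of w] by (intro bexI[of _ "odd_mat w"]) (auto simp: om_def)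
qed

lemma osp_odd_nonzero: "\<exists>X \<in> (osp_part 1 :: ('n::finite) smat set). X \<noteq> 0"
proof -
  let ?v = "axis (Some (Inl undefined)) 1 :: complex ^ 'n idx"
  have "colN (odd_mat ?v) \<noteq> 0" unfolding colN_odd_mat[OF axis_part] by (simp add: axis_eq_0_iff)
  then have "odd_mat ?v \<noteq> 0" by (auto simp: colN_def)
  then show ?thesis using odd_mat_osp[OF axis_part] by blast
qed

section \<open>Kernels and dimensions\<close>

context finite_dimensional_vector_space
begin

lemma dim_le_kernel_image:
  assumes g: "\<And>x y. g (x + y) = g x + g y" "\<And>c x. g (scale c x) = scale c (g x)"
    and S: "subspace S" and gS: "g ` S \<subseteq> S'"
  shows "dim S \<le> dim {x \<in> S. g x = 0} + dim S'"
proof -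
  have g0: "g 0 = 0" using g(2)[of 0 0] by simp
  have gd: "g (x - y) = g x - g y" for x y using g(1)[of "x - y" y] by (simp add: algebra_simps)
  let ?K = "{x \<in> S. g x = 0}"
  obtain BK where BK: "BK \<subseteq> ?K" "independent BK" "?K \<subseteq> span BK" "card BK = dim ?K"
    using basis_exists by blast
  obtain E where E: "E \<subseteq> g ` S" "independent E" "g ` S \<subseteq> span E" "card E = dim (g ` S)"
    using basis_exists by blast
  obtain D where D: "D \<subseteq> S" "E = g ` D" "inj_on g D" using E(1) by (auto simp: subset_image_inj)
  have fin: "finite BK" "finite D"
    using BK(2) E(2) D finiteI_independent finite_image_iff by auto
  have "S \<subseteq> span (BK \<union> D)"
  proof
    fix x assume x: "x \<in> S"
    have "subspace {y. \<exists>d\<in>span D. g d = y}"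
    proof (rule subspaceI)
      show "0 \<in> {y. \<exists>d\<in>span D. g d = y}" using g0 span_zero by blast
    next
      fix y z assume "y \<in> {y. \<exists>d\<in>span D. g d = y}" "z \<in> {y. \<exists>d\<in>span D. g d = y}"
      then show "y + z \<in> {y. \<exists>d\<in>span D. g d = y}" using g(1) span_add by blast
    next
      fix c y assume "y \<in> {y. \<exists>d\<in>span D. g d = y}"
      then show "scale c y \<in> {y. \<exists>d\<in>span D. g d = y}" using g(2) span_scale by blast
    qed
    moreover have "g ` D \<subseteq> {y. \<exists>d\<in>span D. g d = y}" using span_base by auto
    ultimately have "span E \<subseteq> {y. \<exists>d\<in>span D. g d = y}" unfolding D(2) by (rule span_minimal[rotated])
    then obtain d where d: "d \<in> span D" "g d = g x" using E(3) x by blast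
    have "d \<in> S" using d(1) span_minimal[OF D(1) S] by auto
    then have "x - d \<in> ?K" using x d gd subspace_diff[OF S] by auto
    then have "x - d \<in> span (BK \<union> D)" using BK(3) span_mono[of BK "BK \<union> D"] by auto
    moreover have "d \<in> span (BK \<union> D)" using d span_mono[of D "BK \<union> D"] by auto
    ultimately show "x \<in> span (BK \<union> D)" using span_add by force
  qed
  then have "dim S \<le> card (BK \<union> D)" using fin by (intro dim_le_card) auto
  also have "\<dots> \<le> card BK + card D" by (rule card_Un_le)
  also have "card D = dim (g ` S)" using D E card_image by metis
  also have "dim (g ` S) \<le> dim S'" by (rule dim_subset[OF gS])
  finally show ?thesis using BK(4) by simp
qed

end

text \<open>
  Any basis will do, so one is extracted from the matrix units.
\<close>

lemma smat_finite_dimensional: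
  "\<exists>B :: ('n::finite) smat set. finite_dimensional_vector_space mat_scale B"
proof -
  define U :: "'n idx \<Rightarrow> 'n idx \<Rightarrow> 'n smat" where "U i j = (\<chi> k l. if k = i \<and> l = j then 1 else 0)" for i j
  let ?A = "range (\<lambda>(i, j). U i j)"
  have "X \<in> ms.span ?A" for X
  proof -
    have entry: "X $ k $ l = (\<Sum>i\<in>UNIV. \<Sum>j\<in>UNIV. X $ i $ j * (if k = i \<and> l = j then 1 else 0))" for k l
    proof -
      have "(\<Sum>j\<in>UNIV. X $ i $ j * (if k = i \<and> l = j then 1 else 0)) = (if k = i then X $ i $ l else 0)" for i
        by (cases "k = i") (auto simp: if_distrib cong: if_cong)
      then show ?thesis by simp
    qed
    have "X = (\<Sum>i\<in>UNIV. \<Sum>j\<in>UNIV. mat_scale (X $ i $ j) (U i j))"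
      unfolding mat_eq_iff sum_component mat_scale_nth U_def vec_lambda_beta
      by (intro allI entry)
    also have "\<dots> \<in> ms.span ?A" by (intro ms.span_sum ms.span_scale ms.span_base) auto
    finally show ?thesis .
  qed
  then have A: "ms.span ?A = UNIV" by auto
  obtain B where B: "B \<subseteq> ?A" "ms.independent B" "?A \<subseteq> ms.span B"
    using ms.maximal_independent_subset by blast
  have "ms.span B = UNIV" using A B(3) ms.span_minimal[OF B(3) ms.subspace_span] by auto
  moreover have "finite B" by (rule finite_subset[OF B(1)]) simp
  ultimately show ?thesis using B(2) by (intro exI[of _ B]) unfold_locales
qed

section \<open>The grading of \<open>osp(1|2n)\<close>\<close>

locale osp_sl2 =
  fixes e h f :: "('n::finite) smat"
  assumes sl2: "sl2_triple osp e h f"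
begin

abbreviation "G \<equiv> lcarrier (osp :: 'n smat lie_superalgebra)"

lemma triple: "e \<in> osp_part 0" "h \<in> osp_part 0" "f \<in> osp_part 0"
    "sb h e = mat_scale 2 e" "sb h f = mat_scale (- 2) f" "sb e f = h"
  using sl2 by (auto simp: sl2_triple_def)

lemma sb_derivation:
  assumes "A \<in> osp_part 0" "A' \<in> osp_part 0"
  shows "sb A (sb A' X) = sb (sb A A') X + sb A' (sb A X)"
proof -
  have e: "mat_comp 0 A = A" "mat_comp 0 A' = A'" "mat_comp 0 (sb A A') = sb A A'"
    using ospD(1)[OF assms(1)] ospD(1)[OF assms(2)] sb_parity[of 0 A 0 A'] by auto
  show ?thesis
    unfolding sb_even[OF e(3)] unfolding sb_even[OF e(1)] sb_even[OF e(2)]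
    by (simp add: mat_diff_mult matrix_mul_assoc algebra_simps)
qed

lemma linear_sb: "linear (sb (A :: 'n smat))"
proof (rule linearI)
  fix r X
  have "r *\<^sub>R X = mat_scale (complex_of_real r) X" for X :: "'n smat" by (simp add: mat_eq_iff) (simp add: scaleR_conv_of_real)
  then show "sb A (r *\<^sub>R X) = r *\<^sub>R sb A X" by (simp add: sb_scale_right)
qed (rule sb_add_right)

lemma sb_zero [simp]: "sb A 0 = 0" "sb 0 A = 0"
  using sb_scale_right[of A 0 0] sb_scale_left[of 0 0 A] by simp_all

lemma sb_diff: "sb A (X - Y) = sb A X - sb A Y" "sb (X - Y) A = sb X A - sb Y A"
  using sb_add_right[of A "X - Y" Y] sb_add_left[of "X - Y" Y A] by (simp_all add: algebra_simps)

lemma sb_sum: "sb A (sum y S) = (\<Sum>k\<in>S. sb A (y k))" "sb (sum y S) A = (\<Sum>k\<in>S. sb (y k) A)"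
  by (induction S rule: infinite_finite_induct) (auto simp: sb_add_right sb_add_left)

lemma he: "sb h (sb e X) = sb e (sb h X) + mat_scale 2 (sb e X)"
  using sb_derivation[OF triple(2,1)] by (simp add: triple sb_scale_left add.commute)

lemma hf: "sb h (sb f X) = sb f (sb h X) - mat_scale 2 (sb f X)"
  using sb_derivation[OF triple(2,3)] sb_diff(2)[of 0 "mat_scale 2 f"]
  by (simp add: triple sb_scale_left)

text \<open>A bound for the absolute values of the weights.\<close>

definition wmax :: int where
  "wmax = (SOME K. \<exists>M. K = int (2 * M) \<and> sl2_module mat_scale (sb e) (sb f) (sb h) M)"

lemma wmax: "\<exists>M. wmax = int (2 * M) \<and> sl2_module mat_scale (sb e) (sb f) (sb h) M"
proof -
  have r2: "mat_scale 2 X = 2 *\<^sub>R X" for X :: "'n smat" by (simp add: mat_eq_iff scaleR_conv_of_real)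
  obtain N1 where N1: "\<And>n x. n \<ge> N1 \<Longrightarrow> (sb e ^^ n) x = 0"
    using eigen_nilpotent[OF linear_sb linear_sb, of h e 2] he unfolding r2 by auto
  obtain N2 where N2: "\<And>n x. n \<ge> N2 \<Longrightarrow> (sb f ^^ n) x = 0"
    using eigen_nilpotent[OF linear_sb linear_sb, of h f "-2"] hf unfolding r2 by auto
  have "sb e (sb f X) = sb f (sb e X) + sb h X" for X
    using sb_derivation[OF triple(1,3)] by (simp add: triple)
  then have "sl2_module mat_scale (sb e) (sb f) (sb h) (max N1 N2)"
    by unfold_locales (auto simp: sb_add_right sb_scale_right he hf N1 N2)
  then have "\<exists>K M. K = int (2 * M) \<and> sl2_module mat_scale (sb e) (sb f) (sb h) M" by blast
  then show ?thesis unfolding wmax_def by (rule someI_ex)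
qed

abbreviation "wrange \<equiv> {- wmax..wmax}"

definition weight :: "int \<Rightarrow> 'n smat \<Rightarrow> bool" where
  "weight k X \<longleftrightarrow> sb h X = mat_scale (of_int k) X"

lemma weight_simps: "weight k 0" "weight k X \<Longrightarrow> weight k Y \<Longrightarrow> weight k (X + Y)"
  "weight k X \<Longrightarrow> weight k (mat_scale c X)"
  by (simp_all add: weight_def sb_add_right sb_scale_right ms.scale_right_distrib ms.scale_left_commute)

lemma weight_diff: "weight k X \<Longrightarrow> weight k Y \<Longrightarrow> weight k (X - Y)"
  by (simp add: weight_def sb_diff ms.scale_right_diff_distrib)

lemma weight_bracket:
  assumes "weight k X" "weight l Y" "X \<in> G" "Y \<in> G" shows "weight (k + l) (sb X Y)"
proof -
  have "sb h (sb X Y) = sb (sb h X) Y + sb X (sb h Y)"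
  proof -
    have "sb h (sb X Y) = sb (sb h X) Y + mat_scale (ksign 0 p) (sb X (sb h Y))"
      if "X \<in> osp_part p" "Y \<in> osp_part q" for X Y p q
      by (rule sb_jacobi[OF ospD(1)[OF triple(2)] ospD(1)[OF that(1)] ospD(1)[OF that(2)]])
    then have *: "sb h (sb (osp.pc p X) (osp.pc q Y)) = sb (sb h (osp.pc p X)) (osp.pc q Y) + sb (osp.pc p X) (sb h (osp.pc q Y))" for p q
      using osp.pc_P[OF assms(3), of p] osp.pc_P[OF assms(4), of q] by auto
    have X: "X = osp.pc 0 X + osp.pc 1 X" and Y: "Y = osp.pc 0 Y + osp.pc 1 Y"
      using osp.pc_sum[OF assms(3)] osp.pc_sum[OF assms(4)] .
    show ?thesis
      by (subst (1 2 3) X, subst (1 2 3) Y) (simp add: sb_add_left sb_add_right *)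
  qed
  then show ?thesis using assms
    by (simp add: weight_def sb_scale_left sb_scale_right ms.scale_left_distrib)
qed

lemma weight_independent:
  assumes "finite A" "\<And>k. k \<in> A \<Longrightarrow> weight k (y k)" "(\<Sum>k\<in>A. y k) = 0"
  shows "\<forall>k\<in>A. y k = 0"
  using assms
proof (induction A arbitrary: y)
  case (insert a A)
  have w: "sb h (y k) = mat_scale (of_int k) (y k)" if "k \<in> insert a A" for k
    using insert.prems(1)[OF that] by (simp add: weight_def)
  have s: "y a + (\<Sum>k\<in>A. y k) = 0" using insert.prems(2) insert.hyps by simp
  have "sb h (y a + (\<Sum>k\<in>A. y k)) - mat_scale (of_int a) (y a + (\<Sum>k\<in>A. y k)) = 0"
    unfolding s by simp
  then have "(\<Sum>k\<in>A. mat_scale (of_int k - of_int a) (y k)) = 0"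
    by (simp add: sb_add_right sb_sum w ms.scale_right_distrib ms.scale_sum_right sum_subtractf
        ms.scale_left_diff_distrib algebra_simps)
  then have "\<forall>k\<in>A. mat_scale (of_int k - of_int a) (y k) = 0"
    using insert.prems(1) by (intro insert.IH) (auto intro: weight_simps)
  then have "\<forall>k\<in>A. y k = 0" using insert.hyps by auto
  then show ?case using s by simp
qed simp

text \<open>
  \<open>dec X y\<close>: the element \<open>X\<close> is the sum of the weight vectors \<open>y k\<close>. Components outside of the range
  of weights are required to vanish, so that \<open>y\<close> is unique as a function.
\<close>

definition dec :: "'n smat \<Rightarrow> (int \<Rightarrow> 'n smat) \<Rightarrow> bool" where
  "dec X y \<longleftrightarrow> (\<forall>k. weight k (y k)) \<and> (\<forall>k. k \<notin> wrange \<longrightarrow> y k = 0) \<and> X = (\<Sum>k\<in>wrange. y k)"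

lemma dec_unique: assumes "dec X y" "dec X y'" shows "y = y'"
proof
  fix k
  have "\<forall>k\<in>wrange. y k - y' k = 0"
    using assms by (intro weight_independent) (auto simp: dec_def sum_subtractf intro: weight_diff)
  then show "y k = y' k" using assms by (cases "k \<in> wrange") (auto simp: dec_def)
qed

lemma dec_part: assumes "X \<in> osp_part p" shows "\<exists>y. dec X y \<and> (\<forall>k. y k \<in> osp_part p)"
proof -
  obtain M where M: "wmax = int (2 * M)" "sl2_module mat_scale (sb e) (sb f) (sb h) M" using wmax by blast
  have "\<exists>y. (\<forall>k. y k \<in> osp_part p \<and> sb h (y k) = mat_scale (of_int k) (y k)) \<and> X = (\<Sum>k\<in>{- int (2 * M)..int (2 * M)}. y k)"
    using osp_bracket[OF triple(1), of _ p] osp_bracket[OF triple(3), of _ p]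
    by (intro sl2_module.weight_decomposition[OF M(2)] osp_part_subspace assms) auto
  then obtain y where y: "\<And>k. y k \<in> osp_part p" "\<And>k. weight k (y k)" "X = (\<Sum>k\<in>wrange. y k)"
    unfolding weight_def M(1) by blast
  then show ?thesis using ms.subspace_0[OF osp_part_subspace]
    by (intro exI[of _ "\<lambda>k. if k \<in> wrange then y k else 0"]) (auto simp: dec_def weight_simps)
qed

definition pr :: "int \<Rightarrow> 'n smat \<Rightarrow> 'n smat" where "pr k X = (THE y. dec X y) k"

lemma pr_dec: "dec X y \<Longrightarrow> pr k X = y k"
  unfolding pr_def using dec_unique by (subst the_equality[of "dec X" y]) auto

lemma dec_add: "dec X y \<Longrightarrow> dec X' y' \<Longrightarrow> dec (X + X') (\<lambda>k. y k + y' k)"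
  by (simp add: dec_def weight_simps sum.distrib)

lemma dec_scale: "dec X y \<Longrightarrow> dec (mat_scale c X) (\<lambda>k. mat_scale c (y k))"
  by (simp add: dec_def weight_simps ms.scale_sum_right)

lemma dec_pr: assumes "X \<in> G" shows "dec X (\<lambda>k. pr k X)" "pr k X \<in> G"
proof -
  obtain X0 X1 where X: "X0 \<in> osp_part 0" "X1 \<in> osp_part 1" "X = X0 + X1"
    using assms osp.G_iff[of X] by auto
  obtain y0 y1 where y: "dec X0 y0" "dec X1 y1" "\<And>k. y0 k \<in> osp_part 0" "\<And>k. y1 k \<in> osp_part 1"
    using dec_part[OF X(1)] dec_part[OF X(2)] by blast
  have d: "dec X (\<lambda>k. y0 k + y1 k)" unfolding X(3) by (rule dec_add[OF y(1,2)])
  then have p: "pr k X = y0 k + y1 k" for k by (rule pr_dec)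
  show "dec X (\<lambda>k. pr k X)" using d by (simp add: p)
  show "pr k X \<in> G" unfolding p using y osp.P_G[of "y0 k" 0] osp.P_G[of "y1 k" 1] osp.G_add by auto
qed

lemma pr_weight: "X \<in> G \<Longrightarrow> weight k (pr k X)"
  and pr_outside: "X \<in> G \<Longrightarrow> k \<notin> wrange \<Longrightarrow> pr k X = 0"
  and pr_sum: "X \<in> G \<Longrightarrow> X = (\<Sum>k\<in>wrange. pr k X)"
  using dec_pr(1)[of X] unfolding dec_def by blast+

lemma pr_add: "X \<in> G \<Longrightarrow> Y \<in> G \<Longrightarrow> pr k (X + Y) = pr k X + pr k Y"
  using pr_dec[OF dec_add[OF dec_pr(1) dec_pr(1)]] by auto

lemma pr_scale: "X \<in> G \<Longrightarrow> pr k (mat_scale c X) = mat_scale c (pr k X)"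
  using pr_dec[OF dec_scale[OF dec_pr(1)]] by auto

lemma pr_part: "X \<in> osp_part p \<Longrightarrow> pr k X \<in> osp_part p"
  using dec_part[of X p] pr_dec by metis

lemma pr_zero [simp]: "pr k 0 = 0"
  using pr_dec[of 0 "\<lambda>_. 0"] by (simp add: dec_def weight_simps)

lemma pr_G_sum: "finite A \<Longrightarrow> (\<And>i. i \<in> A \<Longrightarrow> y i \<in> G) \<Longrightarrow> (\<Sum>i\<in>A. y i) \<in> G"
  using ms.subspace_sum[of G A y] osp.subspace_G by simp

lemma pr_sum_dist: "finite A \<Longrightarrow> (\<And>i. i \<in> A \<Longrightarrow> y i \<in> G) \<Longrightarrow> pr k (\<Sum>i\<in>A. y i) = (\<Sum>i\<in>A. pr k (y i))"
  by (induction A rule: finite_induct) (auto simp: pr_add pr_G_sum)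

lemma pr_of_weight: assumes "X \<in> G" "weight k X" shows "pr j X = (if j = k then X else 0)"
proof -
  have "X = 0" if "k \<notin> wrange"
  proof -
    define y where "y = (\<lambda>j. if j = k then 0 - X else pr j X)"
    have "(\<Sum>j\<in>wrange. y j) = (\<Sum>j\<in>wrange. pr j X)"
      using that by (intro sum.cong) (auto simp: y_def)
    then have "(\<Sum>j\<in>insert k wrange. y j) = 0"
      using pr_sum[OF assms(1)] that by (subst sum.insert) (auto simp: y_def)
    then have "\<forall>j\<in>insert k wrange. y j = 0"
      using assms pr_weight by (intro weight_independent) (auto simp only: y_def finite_insert finite_atLeastAtMost_int split: if_split intro!: weight_diff weight_simps(1))
    then show ?thesis by (simp add: y_def)
  qed
  then have "dec X (\<lambda>j. if j = k then X else 0)"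
    using assms by (auto simp: dec_def weight_simps)
  then show ?thesis using pr_dec by simp
qed

lemma pr_bracket_zero:
  assumes "X \<in> G" "Y \<in> G" "\<And>k l. pr k X \<noteq> 0 \<Longrightarrow> pr l Y \<noteq> 0 \<Longrightarrow> k + l \<noteq> j"
  shows "pr j (sb X Y) = 0"
proof -
  have br: "sb A A' \<in> G" if "A \<in> G" "A' \<in> G" for A A' using osp.br_G[OF that] by simp
  have "sb X Y = sb (\<Sum>k\<in>wrange. pr k X) (\<Sum>l\<in>wrange. pr l Y)"
    using pr_sum assms by metis
  also have "\<dots> = (\<Sum>k\<in>wrange. \<Sum>l\<in>wrange. sb (pr k X) (pr l Y))"
    by (simp add: sb_sum) (rule sum.swap)
  finally have "pr j (sb X Y) = (\<Sum>k\<in>wrange. \<Sum>l\<in>wrange. pr j (sb (pr k X) (pr l Y)))"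
    using assms dec_pr(2) br by (simp add: pr_sum_dist pr_G_sum)
  also have "\<dots> = 0"
  proof (intro sum.neutral ballI)
    fix k l
    show "pr j (sb (pr k X) (pr l Y)) = 0"
    proof (cases "pr k X = 0 \<or> pr l Y = 0")
      case False
      then show ?thesis
        using assms(3)[of k l] dec_pr(2)[OF assms(1)] dec_pr(2)[OF assms(2)]
          weight_bracket[OF pr_weight[OF assms(1)] pr_weight[OF assms(2)]]
        by (subst pr_of_weight[of _ "k + l"]) (auto intro: br)
    qed auto
  qed
  finally show ?thesis .
qed

lemma pr_pr: "X \<in> G \<Longrightarrow> pr j (pr k X) = (if j = k then pr k X else 0)"
  by (rule pr_of_weight[OF dec_pr(2) pr_weight])

lemma pr_eqI: assumes "X \<in> G" "Y \<in> G" "\<And>k. pr k X = pr k Y" shows "X = Y"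
  using pr_sum[OF assms(1)] pr_sum[OF assms(2)] assms(3) by simp

end

section \<open>Regular elements\<close>

context osp_sl2
begin

lemma weight_unique: "weight k X \<Longrightarrow> weight l X \<Longrightarrow> k \<noteq> l \<Longrightarrow> X = 0"
proof -
  assume "weight k X" "weight l X" "k \<noteq> l"
  then have "mat_scale (of_int k - of_int l) X = 0" by (simp add: weight_def ms.scale_left_diff_distrib)
  then show ?thesis using \<open>k \<noteq> l\<close> by simp
qed

lemma weight_triple: "weight 2 e" "weight 0 h" "weight (- 2) f"
  using triple sb_even[OF ospD(1)[OF triple(2)], of h] by (auto simp: weight_def)

lemma part_G: "X \<in> osp_part p \<Longrightarrow> X \<in> G"
  using osp.P_G[of X p] by simp

text \<open>
  Highest weights are not negative: for a highest weight vector of negative weight \<open>k\<close> the factors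
  $(j+1)(k-j)$ by which \<open>e\<close> takes back the action of \<open>f\<close> never vanish, but \<open>f\<close> is nilpotent.
\<close>

lemma negative_weight_lowering:
  assumes "weight k X" "k < 0" "sb e X = 0" "X \<in> G" shows "X = 0"
proof (rule ccontr)
  assume X: "X \<noteq> 0"
  obtain M where M: "sl2_module mat_scale (sb e) (sb f) (sb h) M" using wmax by blast
  let ?F = "\<lambda>j. (sb f ^^ j) X"
  have F: "weight (k - 2 * int j) (?F j) \<and> ?F j \<in> G" for j
  proof (induction j)
    case (Suc j)
    have "weight (- 2 + (k - 2 * int j)) (sb f (?F j))"
      using Suc weight_triple part_G[OF triple(3)] by (intro weight_bracket) auto
    moreover have "sb f (?F j) \<in> G" using Suc osp.br_G[OF part_G[OF triple(3)]] by simp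
    ultimately show ?case by (simp add: algebra_simps)
  qed (use assms in simp)
  have ef: "sb e (sb f Y) = sb f (sb e Y) + sb h Y" for Y
    using sb_derivation[OF triple(1,3)] by (simp add: triple)
  have step: "sb e (?F (Suc j)) = mat_scale ((of_nat j + 1) * (of_int k - of_nat j)) (?F j)" for j
  proof (induction j)
    case 0
    show ?case using ef[of X] assms by (simp add: weight_def)
  next
    case (Suc j)
    have "sb e (?F (Suc (Suc j))) = sb f (sb e (?F (Suc j))) + sb h (?F (Suc j))"
      using ef[of "?F (Suc j)"] by simp
    also have "sb f (sb e (?F (Suc j))) = mat_scale ((of_nat j + 1) * (of_int k - of_nat j)) (?F (Suc j))"
      unfolding Suc by (simp add: sb_scale_right)
    also have "sb h (?F (Suc j)) = mat_scale (of_int (k - 2 * int (Suc j))) (?F (Suc j))"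
      using F[of "Suc j"] by (simp only: weight_def)
    also have "mat_scale ((of_nat j + 1) * (of_int k - of_nat j)) (?F (Suc j)) + mat_scale (of_int (k - 2 * int (Suc j))) (?F (Suc j))
       = mat_scale ((of_nat (Suc j) + 1) * (of_int k - of_nat (Suc j))) (?F (Suc j))"
      unfolding ms.scale_left_distrib[symmetric] by (rule arg_cong2[where f = mat_scale]) (auto simp: algebra_simps)
    finally show ?case .
  qed
  have "?F j \<noteq> 0" for j
  proof (induction j)
    case (Suc j)
    have "(of_nat j + 1) * (of_int k - of_nat j) = (of_int ((int j + 1) * (k - int j)) :: complex)" by simp
    also have "\<dots> \<noteq> 0" unfolding of_int_eq_0_iff using assms(2) by auto
    finally have "sb e (?F (Suc j)) \<noteq> 0" unfolding step using Suc by simp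
    then show ?case by (metis sb_zero(1))
  qed (use X in simp)
  moreover have "?F M = 0" by (rule sl2_module.F_nil[OF M])
  ultimately show False by blast
qed

text \<open>
  For small \<open>t\<close> the perturbation by \<open>t z\<close> does not annihilate a vector of weight different from
  zero, because weights are integers and \<open>sb z\<close> is bounded.
\<close>

lemma small_perturbation:
  fixes z :: "'n smat"
  obtains t :: real where "t > 0"
    "\<And>k X. k \<noteq> 0 \<Longrightarrow> mat_scale (of_int k) X + mat_scale (of_real t) (sb z X) = 0 \<Longrightarrow> X = 0"
proof -
  obtain K where K: "K > 0" "\<And>X. norm (sb z X) \<le> norm X * K"
    using bounded_linear.pos_bounded[OF linear_conv_bounded_linear[THEN iffD1, OF linear_sb]] by blast
  have r: "mat_scale (complex_of_real r) X = r *\<^sub>R X" for r and X :: "'n smat"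
    by (simp add: mat_eq_iff) (simp add: scaleR_conv_of_real)
  define t where "t = 1 / (2 * K)"
  have "X = 0" if k: "k \<noteq> 0" and X: "mat_scale (of_int k) X + mat_scale (of_real t) (sb z X) = 0" for k :: int and X
  proof -
    have "real_of_int k *\<^sub>R X = - (t *\<^sub>R sb z X)"
      using X r[of "real_of_int k" X] r[of t "sb z X"] by (simp add: eq_neg_iff_add_eq_0)
    then have "norm (real_of_int k *\<^sub>R X) = norm (t *\<^sub>R sb z X)" by (simp only: norm_minus_cancel)
    then have "\<bar>real_of_int k\<bar> * norm X = t * norm (sb z X)" using K(1) by (simp add: t_def)
    also have "\<dots> \<le> t * (norm X * K)" using K by (intro mult_left_mono) (auto simp: t_def)
    also have "\<dots> = norm X / 2" using K(1) by (simp add: t_def)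
    finally have "\<bar>real_of_int k\<bar> * norm X \<le> norm X / 2" .
    moreover have "1 * norm X \<le> \<bar>real_of_int k\<bar> * norm X" using k by (intro mult_right_mono) auto
    ultimately have "norm X \<le> 0" by linarith
    then show ?thesis by simp
  qed
  moreover have "t > 0" using K(1) by (simp add: t_def)
  ultimately show thesis by (rule that[rotated])
qed

lemma pr_e: "pr k e = (if k = 2 then e else 0)"
  using pr_of_weight[OF part_G[OF triple(1)] weight_triple(1)] .

text \<open>
  The centralizer of \<open>e\<close> has at least the dimension of $\mathfrak g(0)_{\bar0} \oplus \mathfrak g(1)_{\bar0}$,
  because \<open>e\<close> maps the part of nonnegative degree to the part of degree at least two. The centralizer
  of $h + tz$, for small \<open>t\<close>, is the centralizer of \<open>z\<close> in $\mathfrak g(0)_{\bar0}$. If \<open>e\<close> is regular,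
  the second dimension is not smaller than the first one, so the two subspaces coincide.
\<close>

lemma regular_degree_0:
  assumes reg: "regular_even osp e" and z: "z \<in> osp_part 0" "weight 0 z"
    and X: "X \<in> osp_part 0" "weight 0 X \<or> weight 1 X"
  shows "weight 0 X \<and> sb z X = 0"
proof -
  obtain B :: "'n smat set" where "finite_dimensional_vector_space mat_scale B"
    using smat_finite_dimensional by blast
  then interpret fd: finite_dimensional_vector_space mat_scale B .
  obtain t :: real where t: "t > 0"
    "\<And>k X. k \<noteq> 0 \<Longrightarrow> mat_scale (of_int k) X + mat_scale (of_real t) (sb z X) = 0 \<Longrightarrow> X = 0"
    using small_perturbation by blast
  note sub0 = osp_part_subspace[of 0]
  define y where "y = h + mat_scale (of_real t) z"
  have y: "y \<in> osp_part 0"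
    using z triple sub0 by (auto simp: y_def intro: ms.subspace_add ms.subspace_scale)
  let ?Z = "{X \<in> osp_part 0. weight 0 X \<and> sb z X = 0}"
  have cent_y: "even_centralizer osp y \<subseteq> ?Z"
  proof
    fix X assume "X \<in> even_centralizer osp y"
    then have X: "X \<in> osp_part 0" "sb y X = 0" by (auto simp: even_centralizer_def)
    have XG: "X \<in> G" using part_G X by auto
    let ?w = "\<lambda>k. mat_scale (of_int k) (pr k X) + mat_scale (of_real t) (sb z (pr k X))"
    have w: "sb y (pr k X) = ?w k" for k
      using pr_weight[OF XG, of k] by (simp add: y_def sb_add_left sb_scale_left weight_def)
    have "(\<Sum>k\<in>wrange. ?w k) = sb y (\<Sum>k\<in>wrange. pr k X)" by (simp add: sb_sum w)
    also have "\<dots> = 0" using pr_sum[OF XG] X(2) by simp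
    finally have sum0: "(\<Sum>k\<in>wrange. ?w k) = 0" .
    have wt: "weight k (?w k)" for k
      using weight_bracket[OF z(2) pr_weight[OF XG] part_G[OF z(1)] dec_pr(2)[OF XG], of k]
      by (intro weight_simps(2,3) pr_weight[OF XG]) simp
    have "\<forall>k\<in>wrange. ?w k = 0" by (rule weight_independent[OF finite_atLeastAtMost_int wt sum0])
    then have zero: "?w k = 0" for k using pr_outside[OF XG, of k] by (cases "k \<in> wrange") auto
    have pr0: "pr k X = 0" if "k \<noteq> 0" for k using t(2)[OF that zero] .
    have "X = pr 0 X" by (rule pr_eqI[OF XG dec_pr(2)[OF XG]]) (auto simp: pr_pr[OF XG] pr0)
    moreover have "sb z (pr 0 X) = 0" using zero[of 0] t(1) by simp
    ultimately show "X \<in> ?Z" using X pr_weight[OF XG, of 0] by auto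
  qed
  let ?T = "{X \<in> osp_part 0. \<forall>k. k \<noteq> 0 \<longrightarrow> k \<noteq> 1 \<longrightarrow> pr k X = 0}"
  let ?S = "{X \<in> osp_part 0. \<forall>k<0. pr k X = 0}" and ?S' = "{X \<in> osp_part 0. \<forall>k<2. pr k X = 0}"
  have sub: "ms.subspace {X \<in> osp_part 0. \<forall>k. C k \<longrightarrow> pr k X = 0}" for C
    using sub0 by (intro ms.subspaceI)
      (auto simp: pr_add pr_scale part_G intro: ms.subspace_add ms.subspace_scale ms.subspace_0)
  have "sb e ` ?S \<subseteq> ?S'"
  proof safe
    fix X assume X: "X \<in> osp_part 0" "\<forall>k<0. pr k X = 0"
    show "sb e X \<in> osp_part 0" using osp_bracket[OF triple(1) X(1)] by simp
    fix k :: int assume "k < 2"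
    then show "pr k (sb e X) = 0"
      using X part_G[OF X(1)] part_G[OF triple(1)] pr_e
      by (intro pr_bracket_zero) (auto split: if_splits)
  qed
  then have "ms.dim ?S \<le> ms.dim {X \<in> ?S. sb e X = 0} + ms.dim ?S'"
    by (intro fd.dim_le_kernel_image sub sb_add_right sb_scale_right)
  also have "ms.dim {X \<in> ?S. sb e X = 0} \<le> ms.dim (even_centralizer osp e)"
    by (intro fd.dim_subset) (auto simp: even_centralizer_def)
  also have "ms.dim (even_centralizer osp e) \<le> ms.dim (even_centralizer osp y)"
    using reg y by (auto simp: regular_even_def)
  also have "\<dots> \<le> ms.dim ?Z" by (rule fd.dim_subset[OF cent_y])
  finally have le: "ms.dim ?S \<le> ms.dim ?Z + ms.dim ?S'" by simp
  have subT: "ms.subspace ?T"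
    using sub[of "\<lambda>k. k \<noteq> 0 \<and> k \<noteq> 1"] by (simp only: imp_conjL)
  have "ms.dim {x + y |x y. x \<in> ?T \<and> y \<in> ?S'} + ms.dim (?T \<inter> ?S') = ms.dim ?T + ms.dim ?S'"
    by (intro fd.dim_sums_Int subT sub)
  moreover have "?T \<inter> ?S' = {0}"
  proof -
    have z: "X = 0" if "X \<in> ?T \<inter> ?S'" for X
    proof (rule pr_eqI)
      fix k show "pr k X = pr k 0" using that by (cases "k < 2") auto
    qed (use that part_G in auto)
    have "0 \<in> ?T \<inter> ?S'" using ms.subspace_0[OF sub0] by simp
    then have "{0} \<subseteq> ?T \<inter> ?S'" by (simp only: insert_subset empty_subsetI simp_thms)
    moreover have "?T \<inter> ?S' \<subseteq> {0}" by (rule subsetI, drule z) (simp only: singleton_iff)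
    ultimately show ?thesis by (rule equalityI[rotated])
  qed
  moreover have "{x + y |x y. x \<in> ?T \<and> y \<in> ?S'} \<subseteq> ?S"
    using sub0 by (auto simp: pr_add part_G intro: ms.subspace_add)
  then have "ms.dim {x + y |x y. x \<in> ?T \<and> y \<in> ?S'} \<le> ms.dim ?S" by (rule fd.dim_subset)
  ultimately have "ms.dim ?T \<le> ms.dim ?Z" using le by simp
  moreover have "?Z \<subseteq> ?T"
  proof safe
    fix X and k :: int assume "X \<in> osp_part 0" "weight 0 X" "k \<noteq> 0" "k \<noteq> 1"
    then show "pr k X = 0" using pr_of_weight[OF part_G, of X 0 0 k] by simp
  qed
  moreover have "ms.subspace ?Z"
    using sub0 by (intro ms.subspaceI)
      (auto simp: sb_add_right sb_scale_right weight_simps intro: ms.subspace_add ms.subspace_scale ms.subspace_0)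
  ultimately have ZT: "?Z = ?T" using subT by (intro fd.subspace_dim_equal)
  have "X \<in> ?T" using X pr_of_weight[OF part_G[OF X(1)]] by auto
  then have "X \<in> ?Z" unfolding ZT .
  then show ?thesis by simp
qed

lemma om_weight:
  assumes "X \<in> osp_part 1" "weight k X" "weight l Y" "k + l \<noteq> 0" shows "om X Y = 0"
proof -
  have "om (sb h X) Y = - om X (sb h Y)" by (rule om_invariant[OF triple(2) assms(1)])
  then have "of_int k * om X Y + of_int l * om X Y = 0"
    using assms by (simp add: weight_def om_simps)
  then have "of_int (k + l) * om X Y = 0" by (simp add: distrib_right)
  then show ?thesis using assms(4) by (simp flip: of_int_add)
qed

lemma om_sum: "om X (sum y A) = (\<Sum>k\<in>A. om X (y k))"
proof -
  have "om X 0 = 0" using om_simps(4)[of X 0 0] by simp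
  then show ?thesis by (induction A rule: infinite_finite_induct) (auto simp: om_simps)
qed

lemma om_dual:
  assumes "X \<in> osp_part 1" "weight k X" "X \<noteq> 0"
  shows "\<exists>Y\<in>osp_part 1. weight (- k) Y \<and> om X Y \<noteq> 0"
proof -
  obtain Y where Y: "Y \<in> osp_part 1" "om X Y \<noteq> 0" using om_nondegenerate assms by blast
  have YG: "Y \<in> G" using Y part_G by auto
  have "om X (\<Sum>l\<in>wrange. pr l Y) \<noteq> 0" using Y pr_sum[OF YG] by simp
  then obtain l where l: "om X (pr l Y) \<noteq> 0" unfolding om_sum by (metis sum.neutral)
  then have "k + l = 0" using om_weight[OF assms(1,2) pr_weight[OF YG]] by blast
  then have "l = - k" by simp
  then show ?thesis using l pr_part[OF Y(1)] pr_weight[OF YG] by blast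
qed

lemma odd_bracket_even: "X \<in> osp_part 1 \<Longrightarrow> Y \<in> osp_part 1 \<Longrightarrow> sb X Y \<in> osp_part 0"
  using osp_bracket[of X 1 Y 1] by simp

lemma om_self: "X \<in> osp_part 1 \<Longrightarrow> om X X = 0"
  using om_skew[of X X] by simp

context
  assumes reg: "regular_even osp e"
begin

lemma degree_0_commute:
  assumes "Z \<in> osp_part 0" "weight 0 Z" "Z' \<in> osp_part 0" "weight 0 Z'"
  shows "sb Z (sb Z' W) = sb Z' (sb Z W)"
  using sb_derivation[OF assms(1,3), of W] regular_degree_0[OF reg assms(1,2,3)] assms(4) by simp

text \<open>
  With \<open>Y\<close> in degree one dual to \<open>X\<close>, the elements \<open>sb Y X'\<close> and \<open>sb Y X\<close> of degree zero act on
  \<open>X\<close> and \<open>X'\<close> like matrix units, and they commute only if \<open>X'\<close> is a multiple of \<open>X\<close>.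
\<close>

lemma odd_degree_minus_1_line:
  assumes X: "X \<in> osp_part 1" "weight (-1) X" "X \<noteq> 0" and X': "X' \<in> osp_part 1" "weight (-1) X'"
  shows "\<exists>c. X' = mat_scale c X"
proof -
  obtain Y where Y: "Y \<in> osp_part 1" "weight 1 Y" "om X Y \<noteq> 0" using om_dual[OF X] by auto
  have "weight (1 + (- 1)) (sb Y V)" if "V \<in> osp_part 1" "weight (-1) V" for V
    using that Y by (intro weight_bracket part_G) auto
  then have w: "weight 0 (sb Y V)" if "V \<in> osp_part 1" "weight (-1) V" for V using that by simp
  have XX: "om X X' = 0" by (rule om_weight[OF X(1,2) X'(2)]) simp
  then have XX': "om X' X = 0" using om_skew[OF X(1), of X'] by simp
  have "sb (sb Y X') (sb (sb Y X) X) = sb (sb Y X) (sb (sb Y X') X)"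
    using X X' Y by (intro degree_0_commute odd_bracket_even w) auto
  then have "mat_scale (om X Y) (mat_scale (om X Y) X') = mat_scale (om X Y) (mat_scale (om X' Y) X)"
    using odd_triple_bracket[OF Y(1) X(1) X(1)] odd_triple_bracket[OF Y(1) X'(1) X(1)]
      odd_triple_bracket[OF Y(1) X(1) X'(1)]
    by (simp add: XX XX' om_self[OF X(1)] sb_scale_right del: ms.scale_scale)
  then have "mat_scale (om X Y) X' = mat_scale (om X' Y) X" using Y(3) by (simp only: ms.scale_cancel_left) simp
  then have "mat_scale (1 / om X Y) (mat_scale (om X Y) X') = mat_scale (1 / om X Y) (mat_scale (om X' Y) X)" by simp
  then show ?thesis using Y(3) by auto
qed

text \<open>
  Otherwise there are \<open>X\<close> and \<open>Y\<close> in degree zero with \<open>om X Y\<close> different from zero, and \<open>sb X X\<close> and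
  \<open>sb Y Y\<close> generate a copy of $\mathfrak{sl}_2$ in $\mathfrak g(0)_{\bar0}$.
\<close>

lemma odd_degree_0_zero:
  assumes "X \<in> osp_part 1" "weight 0 X" shows "X = 0"
proof (rule ccontr)
  assume "X \<noteq> 0"
  then obtain Y where Y: "Y \<in> osp_part 1" "weight 0 Y" "om X Y \<noteq> 0" using om_dual[OF assms] by auto
  have "weight (0 + 0) (sb X X)" "weight (0 + 0) (sb Y Y)"
    using assms Y by (intro weight_bracket part_G; simp)+
  then have "sb (sb X X) (sb (sb Y Y) X) = sb (sb Y Y) (sb (sb X X) X)"
    using assms Y by (intro degree_0_commute odd_bracket_even) auto
  moreover have "sb (sb X X) X = 0"
    using odd_triple_bracket[OF assms(1,1,1)] om_self[OF assms(1)] by simp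
  moreover have "sb (sb Y Y) X = mat_scale (2 * om X Y) Y"
    by (simp only: odd_triple_bracket[OF Y(1,1) assms(1)] mult_2 ms.scale_left_distrib)
  moreover have "sb (sb X X) Y = mat_scale (2 * om Y X) X"
    by (simp only: odd_triple_bracket[OF assms(1,1) Y(1)] mult_2 ms.scale_left_distrib)
  ultimately have "mat_scale (2 * om X Y * (2 * om Y X)) X = 0" by (simp add: sb_scale_right)
  moreover have "om Y X \<noteq> 0" using om_skew[OF assms(1), of Y] Y(3) by simp
  ultimately show False using Y(3) \<open>X \<noteq> 0\<close> by simp
qed

text \<open>
  By the symplectic form the odd weights are symmetric about zero, which is not a weight, so negative
  ones occur. If the largest negative weight were smaller than \<open>-1\<close>, its vectors would be annihilated
  by \<open>e\<close>, but highest weights are not negative.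
\<close>

lemma odd_degree_minus_1_nonzero: "\<exists>X\<in>osp_part 1. weight (-1) X \<and> X \<noteq> 0"
proof (rule ccontr)
  assume no: "\<not> ?thesis"
  let ?N = "{k \<in> wrange. k < 0 \<and> (\<exists>X\<in>osp_part 1. weight k X \<and> X \<noteq> 0)}"
  have inKs: "k \<in> wrange" if "X \<in> osp_part 1" "weight k X" "X \<noteq> 0" for k X
    using pr_of_weight[OF part_G[OF that(1)] that(2), of k] pr_outside[OF part_G[OF that(1)], of k] that(3) by auto
  obtain X :: "'n smat" where X: "X \<in> osp_part 1" "X \<noteq> 0" using osp_odd_nonzero by blast
  have XG: "X \<in> G" using part_G X by auto
  obtain k where k: "pr k X \<noteq> 0" using pr_eqI[OF XG osp.G_zero] X(2) by auto
  have pk: "pr k X \<in> osp_part 1" "weight k (pr k X)" using pr_part X pr_weight XG by auto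
  obtain Y where Y: "Y \<in> osp_part 1" "weight (- k) Y" "om (pr k X) Y \<noteq> 0" using om_dual[OF pk k] by auto
  have "Y \<noteq> 0" using Y(3) om_simps(4)[of "pr k X" 0 0] by auto
  have "k \<noteq> 0" using odd_degree_0_zero[OF pk(1)] pk(2) k by auto
  have "k \<in> ?N \<or> - k \<in> ?N"
  proof (cases "k < 0")
    case True
    then have "k \<in> ?N" using inKs[OF pk k] pk k by blast
    then show ?thesis ..
  next
    case False
    then have "- k < 0" using \<open>k \<noteq> 0\<close> by simp
    then have "- k \<in> ?N" using inKs[OF Y(1,2) \<open>Y \<noteq> 0\<close>] Y(1,2) \<open>Y \<noteq> 0\<close> by blast
    then show ?thesis ..
  qed
  then have "?N \<noteq> {}" by blast
  moreover have fin: "finite ?N" by (rule finite_subset[of _ wrange]) auto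
  ultimately have max: "Max ?N \<in> ?N" "\<And>l. l \<in> ?N \<Longrightarrow> l \<le> Max ?N" using Max_in Max_ge by blast+
  define l where "l = Max ?N"
  obtain W where W: "W \<in> osp_part 1" "weight l W" "W \<noteq> 0" and l: "l < 0" using max(1) unfolding l_def[symmetric] by blast
  have "l \<noteq> -1" using no W by auto
  have eW: "sb e W \<in> osp_part 1" using osp_bracket[OF triple(1) W(1)] by simp
  have we: "weight (2 + l) (sb e W)" using weight_bracket[OF weight_triple(1) W(2)] part_G triple W by auto
  have "sb e W = 0"
  proof (cases "l = -2")
    case True then show ?thesis using odd_degree_0_zero eW we by simp
  next
    case False
    show ?thesis
    proof (rule ccontr)
      assume "sb e W \<noteq> 0"
      then have "2 + l \<in> ?N" using eW we inKs[OF eW we] l \<open>l \<noteq> -1\<close> False by auto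
      then show False using max(2) l_def by force
    qed
  qed
  then show False using negative_weight_lowering[OF W(2) l] W part_G by auto
qed

text \<open>
  The element \<open>e\<close> maps it to $\mathfrak g(1)_{\bar0} = 0$, and highest weights are not negative.
\<close>

lemma even_degree_minus_1_zero:
  assumes "X \<in> osp_part 0" "weight (-1) X" shows "X = 0"
proof -
  have "weight (2 + (- 1)) (sb e X)" using assms weight_triple triple part_G by (intro weight_bracket) auto
  then have w: "weight 1 (sb e X)" by simp
  have "sb e X \<in> osp_part 0" using osp_bracket[OF triple(1) assms(1)] by simp
  then have "weight 0 (sb e X)" using regular_degree_0[OF reg triple(2) weight_triple(2)] w by blast
  then have "sb e X = 0" using weight_unique[OF w] by simp
  then show ?thesis using negative_weight_lowering[OF assms(2)] assms part_G by auto
qed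

end

end

section \<open>The finite W-superalgebra of a regular nilpotent element\<close>

theorem proposition4p8:
  fixes e h f :: "('n::finite) smat"
    and B :: "'n smat \<Rightarrow> 'n smat \<Rightarrow> complex"
    and s r :: nat
    and u v :: "nat \<Rightarrow> 'n smat"
  assumes "mat_nilpotent e" and "regular_even osp e"
    and "sl2_triple osp e h f"
    and "invariant_form osp B" and "B e f = 1"
    and "adapted_bases osp h (B e) s u r v"
  shows "\<exists>(W :: bit \<Rightarrow> (complex ^ 2) set) act.
    superrepresentation (finite_W osp (m_subspace osp h s u r v) (B e)) W act \<and>
    vec.dim (W 0) + vec.dim (W 1) = 2"
proof -
  note reg = assms(2)
  interpret osp_sl2 e h f by unfold_locales (rule assms(3))
  let ?\<xi> = "B e"
  have eG: "e \<in> G" using part_G triple by auto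
  have B_lin: "?\<xi> (X + Y) = ?\<xi> X + ?\<xi> Y" "?\<xi> (mat_scale c X) = c * ?\<xi> X" if "X \<in> G" "Y \<in> G" for X Y c
    using assms(4) that eG unfolding invariant_form_def osp_simps by blast+
  have B_odd: "?\<xi> X = 0" if "X \<in> osp_part 1" for X
    using assms(4) that triple(1) unfolding invariant_form_def osp_simps by (metis zero_neq_one)
  have B_inv: "B (sb X Y) Z = B X (sb Y Z)" if "X \<in> G" "Y \<in> G" "Z \<in> G" for X Y Z
    using assms(4) that unfolding invariant_form_def osp_simps by blast
  have B_scale: "B (mat_scale c X) Y = c * B X Y" if "X \<in> G" "Y \<in> G" for X Y c
    using assms(4) that unfolding invariant_form_def osp_simps by blast
  have hG: "h \<in> G" using part_G triple by auto
  have B_weight: "?\<xi> X = 0" if "X \<in> G" "weight k X" "k \<noteq> -2" for X k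
  proof -
    have "sb e h = mat_scale (-2) e"
    proof -
      have "sb e h = - sb h e"
        unfolding sb_even[OF ospD(1)[OF triple(1)]] sb_even[OF ospD(1)[OF triple(2)]] by simp
      then show ?thesis by (simp add: triple(4))
    qed
    then have "(-2) * ?\<xi> X = ?\<xi> (sb h X)" using B_inv[OF eG hG that(1)] B_scale[OF eG that(1), of "-2"] by simp
    also have "\<dots> = of_int k * ?\<xi> X" using that B_lin(2)[OF that(1,1)] by (simp add: weight_def)
    finally have *: "(-2) * ?\<xi> X = of_int k * ?\<xi> X" .
    have "of_int (k + 2) * ?\<xi> X = of_int k * ?\<xi> X + 2 * ?\<xi> X" by (simp add: distrib_right)
    also have "\<dots> = 0" unfolding *[symmetric] by simp
    finally have "of_int (k + 2) * ?\<xi> X = 0" .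
    then have "of_int (k + 2) = (0 :: complex) \<or> ?\<xi> X = 0" by simp
    then show ?thesis using that(3) by (simp only: of_int_eq_0_iff) auto
  qed
  have B_pr: "?\<xi> X = ?\<xi> (pr (-2) X)" if "X \<in> G" for X
  proof -
    have s: "?\<xi> (sum y A) = (\<Sum>k\<in>A. ?\<xi> (y k))" if "finite A" "\<And>k. k \<in> A \<Longrightarrow> y k \<in> G" for y and A :: "int set"
      using that by (induction A) (auto simp: B_lin pr_G_sum B_lin(2)[of 0 0 0, simplified])
    have "?\<xi> X = ?\<xi> (\<Sum>k\<in>wrange. pr k X)" using pr_sum[OF that] by simp
    also have "\<dots> = (\<Sum>k\<in>wrange. ?\<xi> (pr k X))" using dec_pr(2)[OF that] by (intro s) auto
    also have "\<dots> = (\<Sum>k\<in>wrange. if k = -2 then ?\<xi> (pr (-2) X) else 0)"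
      using B_weight[OF dec_pr(2)[OF that] pr_weight[OF that]] by (intro sum.cong) auto
    also have "\<dots> = ?\<xi> (pr (-2) X)"
      using pr_outside[OF that, of "-2"] B_lin(2)[of 0 0 0] by auto
    finally show ?thesis .
  qed
  have grad: "grading osp h k = {X \<in> G. weight k X}" for k
    by (auto simp: grading_def weight_def)
  have bases: "is_basis_of osp {1..2 * s} u (grading osp h (- 1) \<inter> osp_part 0)"
    "is_basis_of osp {1..r} v (grading osp h (- 1) \<inter> osp_part 1)"
    "\<And>i j. i \<in> {1..r} \<Longrightarrow> j \<in> {1..r} \<Longrightarrow> ?\<xi> (sb (v i) (v j)) = (if i + j = r + 1 then 1 else 0)"
    using assms(6) unfolding adapted_bases_def by auto
  \<comment> \<open>The even part of degree \<open>-1\<close> is zero and the odd part is a line.\<close>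
  have s0: "s = 0"
  proof (rule ccontr)
    assume "s \<noteq> 0"
    then have "u 1 \<in> u ` {1..2 * s}" by auto
    moreover from this have "u 1 \<in> ms.span (u ` {1..2 * s})" by (rule ms.span_base)
    then have "u 1 \<in> grading osp h (- 1) \<inter> osp_part 0" using bases(1) by (simp add: is_basis_of_def)
    then have "u 1 = 0" using even_degree_minus_1_zero[OF reg] by (auto simp: grad)
    ultimately show False using bases(1) ms.dependent_zero by (auto simp: is_basis_of_def)
  qed
  have v_in: "v i \<in> osp_part 1" "weight (-1) (v i)" "v i \<noteq> 0" if "i \<in> {1..r}" for i
  proof -
    have "v i \<in> v ` {1..r}" using that by auto
    then have "v i \<in> ms.span (v ` {1..r})" by (rule ms.span_base)
    then have "v i \<in> grading osp h (- 1) \<inter> osp_part 1" using bases(2) by (simp add: is_basis_of_def)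
    then show "v i \<in> osp_part 1" "weight (-1) (v i)" by (auto simp: grad)
    have "ms.independent (v ` {1..r})" using bases(2) by (simp add: is_basis_of_def)
    then show "v i \<noteq> 0" using ms.dependent_zero[of "v ` {1..r}"] \<open>v i \<in> v ` {1..r}\<close> by metis
  qed
  have "r \<noteq> 0"
  proof
    assume "r = 0"
    then have "grading osp h (- 1) \<inter> osp_part 1 = {0}" using bases(2) by (auto simp: is_basis_of_def)
    moreover obtain X where "X \<in> osp_part 1" "weight (-1) X" "X \<noteq> 0" using odd_degree_minus_1_nonzero[OF reg] by blast
    ultimately show False using part_G unfolding grad by blast
  qed
  moreover have "\<not> r \<ge> 2"
  proof
    assume "r \<ge> 2"
    then have i: "1 \<in> {1..r}" "2 \<in> {1..r}" by auto
    obtain c where c: "v 2 = mat_scale c (v 1)"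
      using odd_degree_minus_1_line[OF reg v_in[OF i(1)] v_in(1,2)[OF i(2)]] by (elim exE)
    have "inj_on v {1..r}" using bases(2) by (simp add: is_basis_of_def)
    then have "v 1 \<noteq> v 2" using inj_onD[of v "{1..r}" 1 2] i by auto
    then have "v 1 \<in> v ` {1..r} - {v 2}" using i by auto
    then have "mat_scale c (v 1) \<in> ms.span (v ` {1..r} - {v 2})" by (intro ms.span_scale ms.span_base)
    then have "v 2 \<in> ms.span (v ` {1..r} - {v 2})" by (simp only: c[symmetric])
    moreover have "v 2 \<in> v ` {1..r}" using i(2) by (rule imageI)
    ultimately have "ms.dependent (v ` {1..r})" unfolding ms.dependent_def by (rule bexI)
    moreover have "ms.independent (v ` {1..r})" using bases(2) by (simp add: is_basis_of_def)
    ultimately show False by (rule notE[rotated])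
  qed
  ultimately have r1: "r = 1" by simp
  define \<Theta> where "\<Theta> = v 1"
  have Th: "\<Theta> \<in> osp_part 1" "weight (-1) \<Theta>" "\<Theta> \<noteq> 0" "\<Theta> \<in> G" and ThTh: "?\<xi> (sb \<Theta> \<Theta>) = 1"
    using v_in[of 1] bases(3)[of 1 1] part_G[of "v 1" 1] by (auto simp: r1 \<Theta>_def)
  have prTh: "pr k \<Theta> = (if k = -1 then \<Theta> else 0)" for k by (rule pr_of_weight[OF Th(4,2)])
  define m where "m = {X \<in> G. \<forall>k\<ge>-1. pr k X = 0}"
  define b where "b = {X \<in> G. \<forall>k<0. pr k X = 0}"
  define \<beta> where "\<beta> X = (\<Sum>k\<in>{0..wmax}. pr k X)" for X
  define \<theta> where "\<theta> X = ?\<xi> (sb \<Theta> (pr (-1) X))" for X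
  have sub: "ms.subspace {X \<in> G. \<forall>k. C k \<longrightarrow> pr k X = 0}" for C
    using osp.subspace_G by (intro ms.subspaceI) (auto simp: pr_add pr_scale intro: ms.subspace_add ms.subspace_scale)
  \<comment> \<open>None of the basis vectors of degree \<open>-1\<close> belongs to the subalgebra, as \<open>2 * 1 > 1 + 1\<close> is false.\<close>
  have m: "m_subspace osp h s u r v = m"
  proof -
    have "u ` {s + 1..2 * s} = {}" "v ` {j \<in> {1..r}. 2 * j > r + 1} = {}" by (auto simp: s0 r1)
    then have "m_subspace osp h s u r v = ms.span (\<Union>i\<in>{..-2}. grading osp h i)"
      by (simp only: m_subspace_def osp_simps Un_empty_right)
    also have "\<dots> = m"
    proof
      show "ms.span (\<Union>i\<in>{..-2}. grading osp h i) \<subseteq> m"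
        unfolding m_def grad by (rule ms.span_minimal) (auto simp: pr_of_weight sub)
      show "m \<subseteq> ms.span (\<Union>i\<in>{..-2}. grading osp h i)"
      proof
        fix X assume "X \<in> m"
        then have X: "X \<in> G" "\<And>k. k \<ge> -1 \<Longrightarrow> pr k X = 0" by (auto simp: m_def)
        have "pr k X \<in> ms.span (\<Union>i\<in>{..-2}. grading osp h i)" for k
        proof (cases "k \<ge> -1")
          case False
          then show ?thesis using dec_pr(2)[OF X(1)] pr_weight[OF X(1)]
            by (intro ms.span_base) (auto simp: grad intro!: bexI[of _ k])
        qed (use X(2) ms.span_zero in simp)
        then have "(\<Sum>k\<in>wrange. pr k X) \<in> ms.span (\<Union>i\<in>{..-2}. grading osp h i)" by (intro ms.span_sum)
        then show "X \<in> ms.span (\<Union>i\<in>{..-2}. grading osp h i)" using pr_sum[OF X(1)] by simp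
      qed
    qed
    finally show ?thesis .
  qed
  have br: "sb X Y \<in> G" if "X \<in> G" "Y \<in> G" for X Y using osp.br_G[OF that] by simp
  have \<beta>G: "\<beta> X \<in> G" if "X \<in> G" for X unfolding \<beta>_def using dec_pr(2)[OF that] by (intro pr_G_sum) auto
  have pr\<beta>: "pr k (\<beta> X) = (if k \<ge> 0 then pr k X else 0)" if "X \<in> G" for k X
  proof -
    have "pr k (\<beta> X) = (\<Sum>l\<in>{0..wmax}. if l = k then pr k X else 0)"
      unfolding \<beta>_def using dec_pr(2)[OF that] pr_pr[OF that, of k]
      by (subst pr_sum_dist) (auto intro!: sum.cong)
    then show ?thesis using pr_outside[OF that, of k] by auto
  qed
  have line: "pr (-1) X = mat_scale (\<theta> X) \<Theta>" if X: "X \<in> G" for X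
  proof -
    obtain X0 X1 where X01: "X0 \<in> osp_part 0" "X1 \<in> osp_part 1" "X = X0 + X1"
      using X osp.G_iff[of X] by auto
    have "pr (-1) X0 = 0"
      by (rule even_degree_minus_1_zero[OF reg pr_part[OF X01(1)] pr_weight[OF part_G[OF X01(1)]]])
    then have p: "pr (-1) X = pr (-1) X1" using X01 part_G by (simp add: pr_add)
    obtain c where c: "pr (-1) X1 = mat_scale c \<Theta>"
      using odd_degree_minus_1_line[OF reg Th(1-3) pr_part[OF X01(2)] pr_weight[OF part_G[OF X01(2)]]] by blast
    have "\<theta> X = c" unfolding \<theta>_def p c using B_lin(2)[of "sb \<Theta> \<Theta>" 0 c] br[OF Th(4,4)] ThTh
      by (simp add: sb_scale_right)
    then show ?thesis using p c by simp
  qed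
  have mem_b: "X \<in> b \<longleftrightarrow> X \<in> G \<and> (\<forall>k<0. pr k X = 0)" and mem_m: "X \<in> m \<longleftrightarrow> X \<in> G \<and> (\<forall>k\<ge>-1. pr k X = 0)" for X
    by (auto simp: b_def m_def)
  \<comment> \<open>Brackets of a negative degree with degrees below \<open>-1\<close> have degree below \<open>-2\<close>, where the form with \<open>e\<close> vanishes.\<close>
  have m_chi: "sb X Y \<in> m \<and> ?\<xi> (sb X Y) = 0"
    if "X \<in> G" "Y \<in> m" "\<And>k. k \<ge> 0 \<Longrightarrow> pr k X = 0" for X Y
  proof -
    have z: "pr j (sb X Y) = 0" if "j \<ge> -2" for j
    proof (rule pr_bracket_zero)
      fix k l assume "pr k X \<noteq> 0" "pr l Y \<noteq> 0"
      then have "k < 0" "l < -1" using \<open>Y \<in> m\<close> \<open>\<And>k. k \<ge> 0 \<Longrightarrow> pr k X = 0\<close>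
        by (auto simp: mem_m not_less[symmetric])
      then show "k + l \<noteq> j" using \<open>j \<ge> -2\<close> by simp
    qed (use \<open>X \<in> G\<close> \<open>Y \<in> m\<close> mem_m in auto)
    have "sb X Y \<in> G" using that mem_m br by auto
    then show ?thesis using z B_pr[of "sb X Y"] B_lin(2)[of 0 0 0] by (auto simp: mem_m)
  qed
  have "split_lie_super osp b m \<Theta> ?\<xi> \<beta> \<theta>"
  proof (unfold_locales, unfold osp_simps)
    show "ms.subspace b" unfolding b_def by (rule sub)
    show "ms.subspace m" unfolding m_def by (rule sub)
    show "b \<subseteq> G" "m \<subseteq> G" by (auto simp: b_def m_def)
    show "sb X Y \<in> b" if "X \<in> b" "Y \<in> b" for X Y
      unfolding mem_b
    proof (intro conjI allI impI)
      show "sb X Y \<in> G" using that br by (simp add: mem_b)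
      fix j :: int assume "j < 0"
      show "pr j (sb X Y) = 0"
      proof (rule pr_bracket_zero)
        fix k l assume "pr k X \<noteq> 0" "pr l Y \<noteq> 0"
        then have "\<not> k < 0" "\<not> l < 0" using that by (auto simp: mem_b)
        then show "k + l \<noteq> j" using \<open>j < 0\<close> by simp
      qed (use that mem_b in auto)
    qed
    show "sb X Y \<in> m \<and> ?\<xi> (sb X Y) = 0" if "X \<in> m" "Y \<in> m" for X Y
      using that by (intro m_chi) (auto simp: mem_m)
    show "\<Theta> \<in> osp_part 1" by (rule Th(1))
    show "sb \<Theta> X \<in> m \<and> ?\<xi> (sb \<Theta> X) = 0" if "X \<in> m" for X
      using that Th by (intro m_chi) (auto simp: prTh)
    show "sb \<Theta> \<Theta> \<in> m"
    proof -
      have "pr k (sb \<Theta> \<Theta>) = 0" if "k \<ge> -1" for k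
        using that Th by (intro pr_bracket_zero) (auto simp: prTh split: if_splits)
      then show ?thesis using br Th by (simp add: mem_m)
    qed
    show "?\<xi> (sb \<Theta> \<Theta>) = 1" by (rule ThTh)
    show "?\<xi> (X + Y) = ?\<xi> X + ?\<xi> Y" if "X \<in> m" "Y \<in> m" for X Y
      using that B_lin by (auto simp: mem_m)
    show "?\<xi> (mat_scale c X) = c * ?\<xi> X" if "X \<in> m" for c X
      using that B_lin(2)[of X X] by (auto simp: mem_m)
    show "?\<xi> X = 0" if "X \<in> osp_part 1" for X by (rule B_odd[OF that])
    show "\<beta> (X + Y) = \<beta> X + \<beta> Y" if "X \<in> G" "Y \<in> G" for X Y
      using that by (simp add: \<beta>_def pr_add sum.distrib)
    show "\<beta> (mat_scale c X) = mat_scale c (\<beta> X)" if "X \<in> G" for c X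
      using that by (simp add: \<beta>_def pr_scale ms.scale_sum_right)
    show "\<beta> X \<in> osp_part p" if "X \<in> osp_part p" for X p
      unfolding \<beta>_def by (intro ms.subspace_sum osp_part_subspace pr_part that)
    show "\<beta> X \<in> b" if "X \<in> G" for X using that \<beta>G pr\<beta> by (auto simp: mem_b)
    show "\<beta> X = X" if "X \<in> b" for X
    proof (rule pr_eqI)
      fix k show "pr k (\<beta> X) = pr k X" using that pr\<beta>[of X k] by (auto simp: mem_b)
    qed (use that \<beta>G mem_b in auto)
    show "\<beta> X = 0" if "X \<in> m" for X
      using that by (auto simp: \<beta>_def mem_m intro!: sum.neutral)
    show "\<beta> \<Theta> = 0" by (auto simp: \<beta>_def prTh intro!: sum.neutral)
    show "\<theta> (X + Y) = \<theta> X + \<theta> Y" if "X \<in> G" "Y \<in> G" for X Y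
      using that dec_pr(2) br Th(4) by (simp add: \<theta>_def pr_add sb_add_right B_lin)
    show "\<theta> (mat_scale c X) = c * \<theta> X" if "X \<in> G" for c X
      using that dec_pr(2) br Th(4) B_lin(2)[of "sb \<Theta> (pr (-1) X)" 0 c] by (simp add: \<theta>_def pr_scale sb_scale_right)
    have z: "\<theta> X = 0" if "pr (-1) X = 0" for X
      using that B_lin(2)[of 0 0 0] by (simp add: \<theta>_def)
    show "\<theta> X = 0" if "X \<in> osp_part 0" for X
      using even_degree_minus_1_zero[OF reg pr_part[OF that] pr_weight[OF part_G[OF that]]] by (rule z)
    show "\<theta> X = 0" if "X \<in> b" for X using that by (intro z) (simp add: mem_b)
    show "\<theta> X = 0" if "X \<in> m" for X using that by (intro z) (simp add: mem_m)
    show "\<theta> \<Theta> = 1" by (simp add: \<theta>_def prTh ThTh)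
    show "X - \<beta> X - mat_scale (\<theta> X) \<Theta> \<in> m" if "X \<in> G" for X
    proof -
      have d: "pr k (A - A') = pr k A - pr k A'" if "A \<in> G" "A' \<in> G" for A A' k
        using pr_add[of "A - A'" A' k] that osp.G_diff[OF that] by (simp add: algebra_simps)
      have G: "X \<in> G" "\<beta> X \<in> G" "mat_scale (\<theta> X) \<Theta> \<in> G" "X - \<beta> X \<in> G"
        using that \<beta>G osp.G_scale[OF Th(4)] osp.G_diff by auto
      have "pr k (X - \<beta> X - mat_scale (\<theta> X) \<Theta>) = 0" if "k \<ge> -1" for k
        using that line[OF G(1)] by (auto simp: d G pr\<beta> pr_scale[OF Th(4)] prTh)
      then show ?thesis using osp.G_diff[OF G(4,3)] by (simp add: mem_m)
    qed
  qed
  then interpret W: split_lie_super osp b m \<Theta> ?\<xi> \<beta> \<theta> .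
  show ?thesis unfolding m using W.two_dimensional_representation by blast
qed

end
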